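(* Let $p$ be a prime and let $F=F(x_1,\ldots,x_n)$ be a non-abelian free pro-$p$ group of finite rank. Then the set of test elements of $F$ is a dense subset of $\Phi(F)$.
   Context: $F(x_1,\ldots,x_n)$ denotes the free pro-$p$ group on $\{x_1,\ldots,x_n\}$, and $\Phi(F)$ is its Frattini subgroup. An element $g$ of a pro-$p$ group $G$ is a test element of $G$ if every continuous endomorphism $\varphi:G\to G$ with $\varphi(g)=g$ is an automorphism. (The statement includes that all test elements of $F$ lie in $\Phi(F)$.) Density is with respect to the pro-$p$ topology on $F$. *)

theory Defs
  imports "HOL-Analysis.Analysis" "HOL-Algebra.Generated_Groups"
begin

locale topological_group = group G for G (structure) +
  fixes T :: "'a topology"
  assumes topspace_eq: "topspace T = carrier G"
    and continuous_mult: "continuous_map (prod_topology T T) T (\<lambda>(a, b). a \<otimes> b)"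
    and continuous_inv: "continuous_map T T (\<lambda>a. inv a)"

text \<open>A profinite group is a compact Hausdorff group whose open subgroups form a base of
  neighbourhoods of the identity; it is pro-\<open>p\<close> if every open normal subgroup has index a power
  of \<open>p\<close>. An infinite index is excluded by \<open>card = p ^ k\<close> as long as \<open>p\<close> is nonzero.\<close>

locale pro_p_group = topological_group +
  fixes p :: nat
  assumes compact: "compact_space T"
    and Hausdorff: "Hausdorff_space T"
    and open_subgroup_base:
      "openin T U \<Longrightarrow> \<one> \<in> U \<Longrightarrow> \<exists>H. subgroup H G \<and> openin T H \<and> H \<subseteq> U"
    and open_normal_index:
      "N \<lhd> G \<Longrightarrow> openin T N \<Longrightarrow> \<exists>k. card (rcosets N) = p ^ k"

definition continuous_hom ::
    "('a, 'c) monoid_scheme \<Rightarrow> 'a topology \<Rightarrow> ('b, 'd) monoid_scheme \<Rightarrow> 'b topology \<Rightarrow> ('a \<Rightarrow> 'b) set"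
  where "continuous_hom G T H S = {f \<in> hom G H. continuous_map T S f}"

definition topologically_generates ::
    "('a, 'c) monoid_scheme \<Rightarrow> 'a topology \<Rightarrow> 'a set \<Rightarrow> bool"
  where "topologically_generates G T X \<longleftrightarrow>
    X \<subseteq> carrier G \<and> T closure_of (generate G X) = carrier G"

text \<open>The pair \<open>(F, x)\<close> is a free pro-\<open>p\<close> group on \<open>x 1, \<dots>, x n\<close> if the \<open>x i\<close> generate \<open>F\<close>
  topologically and every assignment of the \<open>x i\<close> to topological generators of a pro-\<open>p\<close> group
  \<open>G\<close> extends to a unique continuous homomorphism (the condition \<open>f \<in> extensional (carrier F)\<close>
  only makes functions on the carrier unique as total functions).

  A definition cannot quantify over types, so \<open>G\<close> ranges over the pro-\<open>p\<close> groups with elements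
  in the fixed type \<^typ>\<open>nat set set\<close>. This is no restriction: a finitely generated pro-\<open>p\<close> group
  is separable and Hausdorff, so it is isomorphic to such a group. The universal property for
  groups \<open>G\<close> over an arbitrary type is lemma \<open>free_pro_p_group.universal\<close> below.\<close>

locale free_pro_p_group = pro_p_group F T p for F (structure) and T p +
  fixes n :: nat and x :: "nat \<Rightarrow> 'a"
  assumes generators: "topologically_generates F T (x ` {1..n})"
    and universal_nat_set_set:
      "\<And>(G :: nat set set monoid) S y.
        pro_p_group G S p \<Longrightarrow> topologically_generates G S (y ` {1..n}) \<Longrightarrow>
        \<exists>!f. f \<in> continuous_hom F T G S \<and> f \<in> extensional (carrier F) \<and> (\<forall>i\<in>{1..n}. f (x i) = y i)"

definition maximal_open_subgroup ::
    "('a, 'c) monoid_scheme \<Rightarrow> 'a topology \<Rightarrow> 'a set \<Rightarrow> bool"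
  where "maximal_open_subgroup G T M \<longleftrightarrow>
    subgroup M G \<and> openin T M \<and> M \<noteq> carrier G \<and>
    (\<forall>H. subgroup H G \<and> openin T H \<and> M \<subseteq> H \<longrightarrow> H = M \<or> H = carrier G)"

text \<open>Intersecting with the carrier matters only if there is no maximal open subgroup, i.e. for
  the trivial group.\<close>

definition frattini :: "('a, 'c) monoid_scheme \<Rightarrow> 'a topology \<Rightarrow> 'a set"
  where "frattini G T = carrier G \<inter> \<Inter>{M. maximal_open_subgroup G T M}"

definition topological_automorphism ::
    "('a, 'c) monoid_scheme \<Rightarrow> 'a topology \<Rightarrow> ('a \<Rightarrow> 'a) \<Rightarrow> bool"
  where "topological_automorphism G T f \<longleftrightarrow> f \<in> iso G G \<and> homeomorphic_map T T f"

definition test_element :: "('a, 'c) monoid_scheme \<Rightarrow> 'a topology \<Rightarrow> 'a \<Rightarrow> bool"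
  where "test_element G T g \<longleftrightarrow>
    g \<in> carrier G \<and> (\<forall>f \<in> continuous_hom G T G T. f g = g \<longrightarrow> topological_automorphism G T f)"

definition dense_subset_of :: "'a topology \<Rightarrow> 'a set \<Rightarrow> 'a set \<Rightarrow> bool"
  where "dense_subset_of T A B \<longleftrightarrow> A \<subseteq> B \<and> (subtopology T B) closure_of A = B"


subsection \<open>Independence of the type of the test groups\<close>

lemma countable_generate:
  assumes "countable X"
  shows "countable (generate G X)"
proof -
  define step where "step = (\<lambda>Y. Y \<union> (\<lambda>(a, b). a \<otimes>\<^bsub>G\<^esub> b) ` (Y \<times> Y))"
  define C where "C k = (step ^^ k) ({\<one>\<^bsub>G\<^esub>} \<union> X \<union> (\<lambda>a. inv\<^bsub>G\<^esub> a) ` X)" for k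
  have C_Suc: "C (Suc k) = step (C k)" for k by (simp add: C_def)
  have cnt: "countable (C k)" for k
  proof (induction k)
    case 0
    show ?case using assms by (simp add: C_def)
  next
    case (Suc k)
    then show ?case by (auto simp: C_Suc step_def)
  qed
  have mono: "C i \<subseteq> C j" if "i \<le> j" for i j
    using that by (rule lift_Suc_mono_le[rotated]) (auto simp: C_Suc step_def)
  have "a \<in> (\<Union>k. C k)" if "a \<in> generate G X" for a
    using that
  proof (induction a rule: generate.induct)
    case one
    have "\<one>\<^bsub>G\<^esub> \<in> C 0" by (simp add: C_def)
    then show ?case by blast
  next
    case (incl h)
    then have "h \<in> C 0" by (simp add: C_def)
    then show ?case by blast
  next
    case (inv h)
    then have "inv\<^bsub>G\<^esub> h \<in> C 0" by (simp add: C_def)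
    then show ?case by blast
  next
    case (eng h1 h2)
    then obtain i j where "h1 \<in> C i" "h2 \<in> C j" by blast
    then have "h1 \<in> C (max i j)" "h2 \<in> C (max i j)"
      using mono by (meson in_mono max.cobounded1 max.cobounded2)+
    then have "h1 \<otimes>\<^bsub>G\<^esub> h2 \<in> C (Suc (max i j))"
      by (force simp: C_Suc step_def)
    then show ?case by blast
  qed
  then have "generate G X \<subseteq> (\<Union>k. C k)" by blast
  then show ?thesis by (rule countable_subset) (use cnt in auto)
qed

lemma separable_Hausdorff_inj:
  assumes "Hausdorff_space T" "countable D" "T closure_of D = topspace T"
  shows "\<exists>h :: 'a \<Rightarrow> nat set set. inj_on h (topspace T)"
proof -
  define h0 where "h0 a = (\<lambda>U. U \<inter> D) ` {U. openin T U \<and> a \<in> U}" for a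
  define h where "h a = (image (to_nat_on D)) ` h0 a" for a
  have inj0: "inj_on (to_nat_on D) D" using assms(2) by (rule inj_on_to_nat_on)
  have "inj_on h0 (topspace T)"
  proof (rule inj_onI, rule ccontr)
    fix a b assume ab: "a \<in> topspace T" "b \<in> topspace T" "h0 a = h0 b" "a \<noteq> b"
    then obtain U V where UV: "openin T U" "openin T V" "a \<in> U" "b \<in> V" "disjnt U V"
      using assms(1) unfolding Hausdorff_space_def by metis
    have "U \<inter> D \<in> h0 b" using UV ab(3) unfolding h0_def by blast
    then obtain W where W: "openin T W" "b \<in> W" "U \<inter> D = W \<inter> D" unfolding h0_def by blast
    have "b \<in> T closure_of D" using ab assms(3) by simp
    moreover have "openin T (W \<inter> V)" "b \<in> W \<inter> V" using W UV by auto
    ultimately obtain d where "d \<in> D" "d \<in> W \<inter> V" by (meson in_closure_of)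
    then show False using W UV by (auto simp: disjnt_def)
  qed
  moreover have "inj_on (image (image (to_nat_on D))) (h0 ` topspace T)"
  proof (rule inj_on_subset)
    show "h0 ` topspace T \<subseteq> Pow (Pow D)" by (auto simp: h0_def)
    show "inj_on (image (image (to_nat_on D))) (Pow (Pow D))"
      by (intro inj_on_image_Pow inj0)
  qed
  ultimately have "inj_on (image (image (to_nat_on D)) \<circ> h0) (topspace T)"
    by (rule comp_inj_on)
  then show ?thesis by blast
qed

lemma pro_p_group_iso:
  fixes G (structure) and H :: "('b, 'd) monoid_scheme"
  assumes "pro_p_group G T p" and H: "group H" and iso: "h \<in> iso G H"
    and homeo: "homeomorphic_map T S h" and S: "topspace S = carrier H"
  shows "pro_p_group H S p"
proof -
  interpret G: pro_p_group G T p by fact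
  interpret H: group H by fact
  interpret h: group_hom G H h
    using iso by unfold_locales (auto simp: iso_def)
  have bij: "bij_betw h (carrier G) (carrier H)" using iso by (simp add: iso_def)
  obtain g where g: "homeomorphic_maps T S h g" using homeo homeomorphic_map_maps by blast
  have cg: "continuous_map S T g" and ch: "continuous_map T S h"
    and gh: "\<And>a. a \<in> carrier G \<Longrightarrow> g (h a) = a" and hg: "\<And>b. b \<in> carrier H \<Longrightarrow> h (g b) = b"
    using g S G.topspace_eq by (auto simp: homeomorphic_maps_def)
  have gcl: "g b \<in> carrier G" if "b \<in> carrier H" for b
    using cg that S G.topspace_eq by (auto simp: continuous_map_def)
  show ?thesis
  proof unfold_locales
    show "topspace S = carrier H" by fact
  next
    have "continuous_map (prod_topology S S) (prod_topology T T) (\<lambda>(a, b). (g a, g b))"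
      by (simp add: cg continuous_map_prod_top)
    from continuous_map_compose[OF continuous_map_compose[OF this G.continuous_mult] ch]
    have "continuous_map (prod_topology S S) S (h \<circ> ((\<lambda>(a, b). a \<otimes> b) \<circ> (\<lambda>(a, b). (g a, g b))))" .
    then show "continuous_map (prod_topology S S) S (\<lambda>(a, b). a \<otimes>\<^bsub>H\<^esub> b)"
      by (rule continuous_map_eq) (auto simp: S gcl hg)
  next
    from continuous_map_compose[OF continuous_map_compose[OF cg G.continuous_inv] ch]
    have "continuous_map S S (h \<circ> ((\<lambda>a. inv a) \<circ> g))" .
    then show "continuous_map S S (\<lambda>a. inv\<^bsub>H\<^esub> a)"
      by (rule continuous_map_eq) (auto simp: S gcl hg)
  next
    show "compact_space S"
      using G.compact homeo homeomorphic_compact_space homeomorphic_map_imp_homeomorphic_space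
      by blast
  next
    show "Hausdorff_space S"
      using G.Hausdorff homeo homeomorphic_Hausdorff_space homeomorphic_map_imp_homeomorphic_space
      by blast
  next
    fix U assume U: "openin S U" "\<one>\<^bsub>H\<^esub> \<in> U"
    have "openin T {a \<in> topspace T. h a \<in> U}"
      using ch U openin_continuous_map_preimage by blast
    moreover have "\<one> \<in> {a \<in> topspace T. h a \<in> U}" using U G.topspace_eq by auto
    ultimately obtain K where K: "subgroup K G" "openin T K" "K \<subseteq> {a \<in> topspace T. h a \<in> U}"
      using G.open_subgroup_base by meson
    have "subgroup (h ` K) H" using K(1) by (rule h.subgroup_img_is_subgroup)
    moreover have "openin S (h ` K)"
      using homeomorphic_map_openness_eq[OF homeo] K(2) by blast
    ultimately show "\<exists>K. subgroup K H \<and> openin S K \<and> K \<subseteq> U" using K(3) by blast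
  next
    fix N assume N: "N \<lhd> H" "openin S N"
    define N' where "N' = {a \<in> carrier G. h a \<in> N}"
    have NH: "N \<subseteq> carrier H" using N normal_imp_subgroup subgroup.subset by blast
    have hN': "h ` N' = N"
    proof
      show "h ` N' \<subseteq> N" by (auto simp: N'_def)
      show "N \<subseteq> h ` N'"
      proof
        fix b assume "b \<in> N"
        then have "b = h (g b)" "g b \<in> N'" using NH gcl hg by (auto simp: N'_def subset_iff)
        then show "b \<in> h ` N'" by (rule image_eqI)
      qed
    qed
    have sub: "subgroup N' G"
      unfolding N'_def using normal_imp_subgroup[OF N(1)]
      by unfold_locales (auto simp: subgroup.m_closed subgroup.m_inv_closed subgroup.one_closed)
    have "N' \<lhd> G"
      unfolding G.normal_inv_iff using sub N(1)
      by (auto simp: N'_def normal.inv_op_closed2)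
    moreover have "openin T N'"
      using openin_continuous_map_preimage[OF ch N(2)] G.topspace_eq by (simp add: N'_def)
    ultimately obtain k where k: "card (rcosets N') = p ^ k"
      using G.open_normal_index by blast
    have coset: "h ` (N' #> a) = N #>\<^bsub>H\<^esub> h a" if "a \<in> carrier G" for a
    proof -
      have "h ` (N' #> a) = (\<lambda>m. h (m \<otimes> a)) ` N'" by (auto simp: r_coset_def)
      also have "\<dots> = (\<lambda>m. h m \<otimes>\<^bsub>H\<^esub> h a) ` N'"
        using that by (intro image_cong) (auto simp: N'_def)
      also have "\<dots> = (\<lambda>m. m \<otimes>\<^bsub>H\<^esub> h a) ` (h ` N')" by (simp add: image_image)
      finally show ?thesis by (auto simp: hN' r_coset_def)
    qed
    have "rcosets\<^bsub>H\<^esub> N = (\<lambda>b. N #>\<^bsub>H\<^esub> b) ` (h ` carrier G)"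
      unfolding bij_betw_imp_surj_on[OF bij] RCOSETS_def by blast
    also have "\<dots> = (\<lambda>a. h ` (N' #> a)) ` carrier G"
      by (simp add: image_image coset)
    also have "\<dots> = (image h) ` (rcosets N')"
      unfolding RCOSETS_def by blast
    finally have "rcosets\<^bsub>H\<^esub> N = (image h) ` (rcosets N')" .
    moreover have "inj_on (image h) (rcosets N')"
    proof (rule inj_on_subset)
      show "inj_on (image h) (Pow (carrier G))"
        using bij by (simp add: bij_betw_def inj_on_image_Pow)
      show "rcosets N' \<subseteq> Pow (carrier G)"
        using G.rcosets_part_G[OF sub] by blast
    qed
    ultimately show "\<exists>k. card (rcosets\<^bsub>H\<^esub> N) = p ^ k" using k by (auto simp: card_image)
  qed
qed

lemma topological_group_transport:
  assumes "topological_group G T" and inj: "inj_on h (carrier G)"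
  shows "\<exists>(H :: 'b monoid) S. group H \<and> topspace S = carrier H \<and> h \<in> iso G H \<and> homeomorphic_map T S h"
proof -
  interpret topological_group G T by fact
  define g where "g = inv_into (carrier G) h"
  define H where "H = \<lparr>carrier = h ` carrier G, mult = (\<lambda>a b. h (g a \<otimes>\<^bsub>G\<^esub> g b)), one = h \<one>\<^bsub>G\<^esub>\<rparr>"
  define S where "S = pullback_topology (carrier H) g T"
  have gh [simp]: "g (h a) = a" if "a \<in> carrier G" for a
    using that inj by (simp add: g_def)
  have iso: "h \<in> iso G H"
    using inj by (auto simp: iso_def hom_def bij_betw_def H_def)
  have "group (H\<lparr>one := h \<one>\<^bsub>G\<^esub>\<rparr>)" using iso by (rule iso_imp_img_group)
  then have "group H" by (simp add: H_def)
  moreover have top: "topspace S = carrier H"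
    using topspace_eq by (auto simp: S_def topspace_pullback_topology H_def)
  moreover have "homeomorphic_maps T S h g"
    unfolding homeomorphic_maps_def
  proof (intro conjI ballI)
    show "continuous_map T S h"
      unfolding S_def
    proof (rule continuous_map_pullback')
      show "continuous_map T T (g \<circ> h)"
        by (rule continuous_map_eq[OF continuous_map_id]) (simp add: topspace_eq)
      show "topspace T \<subseteq> h -` carrier H" by (auto simp: topspace_eq H_def)
    qed
    show "continuous_map S T g"
      using continuous_map_pullback[OF continuous_map_id, of "carrier H" g T] by (simp add: S_def)
  qed (auto simp: topspace_eq top H_def)
  then have "homeomorphic_map T S h" using homeomorphic_maps_imp_map by blast
  ultimately show ?thesis using iso by blast
qed

lemma (in free_pro_p_group) universal:
  fixes G :: "('b, 'd) monoid_scheme"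
  assumes G: "pro_p_group G S p" and gen: "topologically_generates G S (y ` {1..n})"
  shows "\<exists>!f. f \<in> continuous_hom F T G S \<and> f \<in> extensional (carrier F) \<and> (\<forall>i\<in>{1..n}. f (x i) = y i)"
proof -
  interpret G: pro_p_group G S p by fact
  have yG: "y ` {1..n} \<subseteq> carrier G" and cl: "S closure_of generate G (y ` {1..n}) = topspace S"
    using gen by (auto simp: topologically_generates_def G.topspace_eq)
  obtain h :: "'b \<Rightarrow> nat set set" where "inj_on h (carrier G)"
    using separable_Hausdorff_inj[OF G.Hausdorff countable_generate cl]
    by (auto simp: G.topspace_eq)
  then obtain H :: "nat set set monoid" and R where H: "group H" "topspace R = carrier H"
      and iso: "h \<in> iso G H" and homeo: "homeomorphic_map S R h"
    using topological_group_transport[OF G.topological_group_axioms] by blast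
  interpret H: group H by fact
  interpret h: group_hom G H h
    using iso by unfold_locales (auto simp: iso_def)
  obtain g where g: "homeomorphic_maps S R h g" using homeo homeomorphic_map_maps by blast
  have cg: "continuous_map R S g" and ch: "continuous_map S R h"
    and gh: "\<And>a. a \<in> carrier G \<Longrightarrow> g (h a) = a" and hg: "\<And>b. b \<in> carrier H \<Longrightarrow> h (g b) = b"
    using g H G.topspace_eq by (auto simp: homeomorphic_maps_def)
  have gcl: "g b \<in> carrier G" if "b \<in> carrier H" for b
    using cg that H G.topspace_eq by (auto simp: continuous_map_def)
  have ghom: "g \<in> hom H G"
  proof (rule homI)
    fix a b assume ab: "a \<in> carrier H" "b \<in> carrier H"
    then have "g (h (g a \<otimes>\<^bsub>G\<^esub> g b)) = g a \<otimes>\<^bsub>G\<^esub> g b" by (intro gh) (auto simp: gcl)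
    then show "g (a \<otimes>\<^bsub>H\<^esub> b) = g a \<otimes>\<^bsub>G\<^esub> g b" using ab by (simp add: gcl hg)
  qed (rule gcl)
  have proH: "pro_p_group H R p" using G H(1) iso homeo H(2) by (rule pro_p_group_iso)
  have img: "generate H ((h \<circ> y) ` {1..n}) = h ` generate G (y ` {1..n})"
    using h.generate_img[OF yG] by (simp add: image_comp)
  have "R closure_of (h ` generate G (y ` {1..n})) = h ` (S closure_of generate G (y ` {1..n}))"
    using G.generate_incl[OF yG] by (intro homeomorphic_map_closure_of[OF homeo]) (simp add: G.topspace_eq)
  also have "\<dots> = carrier H"
    using cl homeomorphic_imp_surjective_map[OF homeo] H(2) by simp
  finally have "topologically_generates H R ((h \<circ> y) ` {1..n})"
    using yG img by (auto simp: topologically_generates_def)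
  from universal_nat_set_set[OF proH this]
  obtain f where f: "f \<in> continuous_hom F T H R" "f \<in> extensional (carrier F)"
      "\<forall>i\<in>{1..n}. f (x i) = (h \<circ> y) i"
    and uniq: "\<And>f'. f' \<in> continuous_hom F T H R \<Longrightarrow> f' \<in> extensional (carrier F) \<Longrightarrow>
      \<forall>i\<in>{1..n}. f' (x i) = (h \<circ> y) i \<Longrightarrow> f' = f"
    by metis
  have xF: "x i \<in> carrier F" if "i \<in> {1..n}" for i
    using generators that by (auto simp: topologically_generates_def)
  have restr: "restrict (k \<circ> f') (carrier F) \<in> continuous_hom F T K' R'"
    if "f' \<in> continuous_hom F T K Q" "k \<in> hom K K'" "continuous_map Q R' k"
    for f' k and K :: "('k, 'l) monoid_scheme" and K' :: "('m, 'o) monoid_scheme" and Q R'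
  proof -
    have 1: "k \<circ> f' \<in> hom F K'" using that Group.hom_compose by (auto simp: continuous_hom_def)
    then have "restrict (k \<circ> f') (carrier F) \<in> hom F K'"
      by (auto simp: hom_def Pi_iff)
    moreover have "continuous_map T R' (k \<circ> f')"
      using that continuous_map_compose by (auto simp: continuous_hom_def)
    then have "continuous_map T R' (restrict (k \<circ> f') (carrier F))"
      by (rule continuous_map_eq) (simp add: topspace_eq)
    ultimately show ?thesis by (simp add: continuous_hom_def)
  qed
  show ?thesis
  proof (rule ex1I[of _ "restrict (g \<circ> f) (carrier F)"], intro conjI)
    show "restrict (g \<circ> f) (carrier F) \<in> continuous_hom F T G S"
      using restr[OF f(1) ghom cg] .
    show "\<forall>i\<in>{1..n}. restrict (g \<circ> f) (carrier F) (x i) = y i"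
      using f(3) xF gh yG by (auto simp: image_subset_iff)
  next
    fix f' assume f': "f' \<in> continuous_hom F T G S \<and> f' \<in> extensional (carrier F) \<and>
      (\<forall>i\<in>{1..n}. f' (x i) = y i)"
    have eq: "restrict (h \<circ> f') (carrier F) = f"
      using restr[OF _ h.homh ch] f' xF by (intro uniq) auto
    show "f' = restrict (g \<circ> f) (carrier F)"
    proof (rule extensionalityI[of _ "carrier F"])
      fix a assume a: "a \<in> carrier F"
      then have "f' a \<in> carrier G" using f' by (auto simp: continuous_hom_def hom_def)
      then show "f' a = restrict (g \<circ> f) (carrier F) a"
        using a gh by (simp flip: eq)
    qed (use f' in auto)
  qed simp
qed

end

theory Submission
  imports
    Defs
    "HOL-Number_Theory.Number_Theory"
    "HOL-Algebra.Group_Action"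
    "HOL-Algebra.Multiplicative_Group"
    "HOL-Algebra.Zassenhaus"
begin

hide_const (open) Polynomial.order

text \<open>
  The Magnus embedding \<open>x i \<mapsto> 1 + X i\<close> sends \<open>F\<close> into the units of the ring of noncommutative power
  series modulo \<open>p\<close>. If an endomorphism \<open>f\<close> of \<open>F\<close> fixes \<open>g\<close>, then some power \<open>e\<close> of \<open>f\<close> is
  idempotent modulo series of order \<open>> q\<close>, and if \<open>f\<close> is not an automorphism, \<open>e\<close> does not induce the
  identity on \<open>F / \<Phi>(F)\<close>. The Fox derivatives \<open>d j\<close> of \<open>g\<close>, given by \<open>g - 1 = (\<Sum>j. d j * X j)\<close>, then
  satisfy a relation \<open>(\<Sum>j. d j * c j) = 0\<close> up to order \<open>q\<close> in which not all constant terms of the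
  \<open>c j\<close> vanish; so do, on the other side, the derivatives that remove first letters.

  Let \<open>w \<in> \<Phi>(F)\<close>, let \<open>q\<close> be a large power of \<open>p\<close>, and let \<open>v\<close> be the product of the \<open>q\<close>-th powers
  of all \<open>x i\<close> and all \<open>x i * x j\<close> with \<open>i < j\<close>. Then \<open>v\<close> is close to \<open>1\<close> and has leading form
  \<open>(\<Sum>i. X i ^ q) + (\<Sum>i<j. (X i + X j) ^ q)\<close>. If neither \<open>w\<close> nor \<open>w * v\<close> were a test element, a left
  relation for \<open>w\<close> and a right relation for \<open>w * v\<close>, with constant terms \<open>\<xi> i\<close> and \<open>\<epsilon> j\<close>, could be
  applied to this form from both sides; comparing coefficients gives \<open>\<xi> i * \<epsilon> i = 0\<close> and
  \<open>(\<xi> i + \<xi> j) * (\<epsilon> i + \<epsilon> j) = 0\<close> for \<open>i < j\<close>, which forces \<open>\<xi> = 0\<close> or \<open>\<epsilon> = 0\<close>. Hence \<open>w\<close> or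
  \<open>w * v\<close> is a test element.
\<close>

section \<open>Noncommutative power series\<close>

text \<open>About \<open>w\<close> nothing is known beyond the vanishing of its linear part modulo
  \<open>p\<close>, so a one-sided relation for \<open>w\<close> alone contradicts nothing. A left
  relation for \<open>w\<close> and a right relation for \<open>w * v\<close> combine into one
  operator, which sandwiches second derivatives between coefficients and annihilates both elements
  up to the relevant order. The unknown \<open>w\<close> drops out of the difference, and only the
  leading form of \<open>v\<close> remains.

  The shape of \<open>v\<close> is dictated by what must follow. The powers of the
  \<open>X i\<close> alone would allow \<open>\<xi>\<close> and \<open>\<epsilon>\<close> with
  disjoint supports; the powers of \<open>X i + X j\<close> supply the mixed products. As
  \<open>q\<close> is a power of \<open>p\<close>, Frobenius leaves no terms between 1 and
  \<open>t ^ q\<close> in \<open>(1 + t) ^ q\<close>. If \<open>q\<close> is also a multiple of the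
  index of an open normal subgroup, \<open>v\<close> lies in that subgroup, whence density.

  Idempotence can only be had modulo an order, since it comes from a finite quotient of
  \<open>F\<close>; therefore all series are truncated at \<open>q\<close>.

  That test elements lie in \<Phi>(F) is a separate argument: an element outside it belongs to a
  basis, and the retraction killing the other basis elements fixes it.\<close>

text \<open>No type has \<open>p\<close> elements for a variable \<open>p\<close>, so the coefficients are integers and congruence
  modulo \<open>p\<close> is built into the filtration \<open>filt\<close> below. A word is a list of indices of letters.\<close>

datatype ncps = NCPS (cf: "nat list \<Rightarrow> int")

lemma ncps_eqI: "(\<And>w. cf a w = cf b w) \<Longrightarrow> a = b"
  by (cases a; cases b) auto

instantiation ncps :: ring_1
begin

definition "0 = NCPS (\<lambda>w. 0)"
definition "1 = NCPS (\<lambda>w. if w = [] then 1 else 0)"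
definition "a + b = NCPS (\<lambda>w. cf a w + cf b w)"
definition "a - b = NCPS (\<lambda>w. cf a w - cf b w)"
definition "- a = NCPS (\<lambda>w. - cf a w)"
definition "a * b = NCPS (\<lambda>w. \<Sum>i\<le>length w. cf a (take i w) * cf b (drop i w))"

lemma cf_simps [simp]:
  "cf 0 w = 0" "cf 1 w = (if w = [] then 1 else 0)" "cf (a + b) w = cf a w + cf b w"
  "cf (a - b) w = cf a w - cf b w" "cf (- a) w = - cf a w" "cf (a * b) [] = cf a [] * cf b []"
  by (simp_all add: zero_ncps_def one_ncps_def plus_ncps_def minus_ncps_def uminus_ncps_def
      times_ncps_def)

lemma cf_mult: "cf (a * b) w = (\<Sum>i\<le>length w. cf a (take i w) * cf b (drop i w))"
  by (simp add: times_ncps_def)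

text \<open>The empty prefix is split off from the convolution; every other prefix starts with
  \<open>x\<close>, so the rest is a convolution at the shorter word. Inductions on words rest on
  this recursion.\<close>

lemma cf_mult_Cons:
  "cf (a * b) (x # w) = cf a [] * cf b (x # w) + cf (NCPS (\<lambda>w. cf a (x # w)) * b) w"
  by (simp add: times_ncps_def sum.atMost_Suc_shift del: sum.atMost_Suc)

instance
proof
  fix a b c :: ncps
  show "(a + b) * c = a * c + b * c" "a * (b + c) = a * b + a * c"
    by (rule ncps_eqI; simp add: cf_mult sum.distrib algebra_simps)+
  show "a * b * c = a * (b * c)"
  proof (rule ncps_eqI)
    fix w show "cf (a * b * c) w = cf (a * (b * c)) w"
    proof (induction w arbitrary: a)
      case (Cons x w)
      \<comment> \<open>The product rule for left derivatives. It turns associativity at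
        \<open>x # w\<close> into associativity at \<open>w\<close> for another first factor, which
        is why \<open>a\<close> is arbitrary in the induction.\<close>
      have *: "NCPS (\<lambda>w. cf (a * b) (x # w)) =
          NCPS (\<lambda>w. cf a [] * cf b (x # w)) + NCPS (\<lambda>w. cf a (x # w)) * b"
        by (rule ncps_eqI) (simp add: cf_mult_Cons)
      have "cf (a * b * c) (x # w) = cf a [] * cf b [] * cf c (x # w) +
          cf (NCPS (\<lambda>w. cf (a * b) (x # w)) * c) w"
        by (simp only: cf_mult_Cons[of "a * b"] cf_simps)
      moreover have "cf (NCPS (\<lambda>w. cf a [] * cf b (x # w)) * c) w = cf a [] * cf (NCPS (\<lambda>w. cf b (x # w)) * c) w"
        by (simp add: cf_mult sum_distrib_left mult.assoc)
      moreover have "(a' + b') * c = a' * c + b' * c" for a' b'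
        by (rule ncps_eqI; simp add: cf_mult sum.distrib algebra_simps)
      ultimately show ?case
        unfolding cf_mult_Cons[of a "b * c"] cf_mult_Cons[of b c] *
        by (simp add: Cons algebra_simps)
    qed simp
  qed
  show "1 * a = a"
    by (rule ncps_eqI, case_tac w) (auto simp: cf_mult sum.atMost_Suc_shift simp del: sum.atMost_Suc)
  show "a * 1 = a"
  proof (rule ncps_eqI)
    fix w :: "nat list"
    have "cf (a * 1) w = (\<Sum>i\<le>length w. if i = length w then cf a w else 0)"
      unfolding cf_mult by (intro sum.cong) auto
    then show "cf (a * 1) w = cf a w" by simp
  qed
  have "cf (0::ncps) [] \<noteq> cf 1 []" by simp
  then show "(0::ncps) \<noteq> 1" by metis
qed (rule ncps_eqI; simp)+

end

lemma cf_sum [simp]: "cf (sum f A) w = (\<Sum>i\<in>A. cf (f i) w)"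
  by (induction A rule: infinite_finite_induct) auto

lemma cf_of_nat: "cf (of_nat m) w = (if w = [] then int m else 0)"
  by (induction m) auto

lemma cf_of_int [simp]: "cf (of_int c) w = (if w = [] then c else 0)"
  by (cases c) (auto simp: cf_of_nat simp del: of_nat_Suc)

text \<open>\<open>Dr j\<close> and \<open>Dl j\<close> are the Fox derivatives: a series \<open>a\<close> in the letters \<open>1, \<dots>, n\<close> is its constant
  term plus \<open>(\<Sum>j=1..n. Dr j a * letter j)\<close>, or plus \<open>(\<Sum>j=1..n. letter j * Dl j a)\<close>.\<close>

definition letter :: "nat \<Rightarrow> ncps" where "letter j = NCPS (\<lambda>w. if w = [j] then 1 else 0)"
definition Dl :: "nat \<Rightarrow> ncps \<Rightarrow> ncps" where "Dl j a = NCPS (\<lambda>w. cf a (j # w))"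
definition Dr :: "nat \<Rightarrow> ncps \<Rightarrow> ncps" where "Dr j a = NCPS (\<lambda>w. cf a (w @ [j]))"
definition ncps_rev :: "ncps \<Rightarrow> ncps" where "ncps_rev a = NCPS (\<lambda>w. cf a (rev w))"

lemma cf_letter [simp]: "cf (letter j) w = (if w = [j] then 1 else 0)" by (simp add: letter_def)
lemma cf_Dl [simp]: "cf (Dl j a) w = cf a (j # w)" by (simp add: Dl_def)
lemma cf_Dr [simp]: "cf (Dr j a) w = cf a (w @ [j])" by (simp add: Dr_def)
lemma cf_ncps_rev [simp]: "cf (ncps_rev a) w = cf a (rev w)" by (simp add: ncps_rev_def)

lemma cf_of_int_mult [simp]: "cf (of_int c * a) w = c * cf a w"
proof -
  have "cf (of_int c * a) w = (\<Sum>i\<le>length w. if i = 0 then c * cf a w else 0)"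
    unfolding cf_mult by (intro sum.cong) auto
  then show ?thesis by simp
qed

lemma cf_mult_of_int [simp]: "cf (a * of_int c) w = cf a w * c"
proof -
  have "cf (a * of_int c) w = (\<Sum>i\<le>length w. if i = length w then cf a w * c else 0)"
    unfolding cf_mult by (intro sum.cong) auto
  then show ?thesis by simp
qed

lemma Dl_add [simp]: "Dl j (a + b) = Dl j a + Dl j b" by (rule ncps_eqI) simp
lemma Dl_diff [simp]: "Dl j (a - b) = Dl j a - Dl j b" by (rule ncps_eqI) simp
lemma Dl_sum [simp]: "Dl j (sum f A) = (\<Sum>i\<in>A. Dl j (f i))" by (rule ncps_eqI) simp
lemma Dl_of_int [simp]: "Dl j (of_int c) = 0" by (rule ncps_eqI) simp
text \<open>Fox's product rule, with the constant term as augmentation: the first letter comes from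
  \<open>b\<close> only if \<open>a\<close> contributes the empty word.\<close>

lemma Dl_mult: "Dl j (a * b) = Dl j a * b + of_int (cf a []) * Dl j b"
  by (rule ncps_eqI) (simp add: cf_mult_Cons Dl_def)
lemma Dr_add [simp]: "Dr j (a + b) = Dr j a + Dr j b" by (rule ncps_eqI) simp
lemma Dr_diff [simp]: "Dr j (a - b) = Dr j a - Dr j b" by (rule ncps_eqI) simp
lemma Dr_sum [simp]: "Dr j (sum f A) = (\<Sum>i\<in>A. Dr j (f i))" by (rule ncps_eqI) simp
lemma Dr_of_int [simp]: "Dr j (of_int c) = 0" by (rule ncps_eqI) simp
lemma Dr_Dl: "Dr i (Dl j a) = Dl j (Dr i a)" by (rule ncps_eqI) simp

lemma ncps_rev_ncps_rev [simp]: "ncps_rev (ncps_rev a) = a" by (rule ncps_eqI) simp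
lemma ncps_rev_add [simp]: "ncps_rev (a + b) = ncps_rev a + ncps_rev b" by (rule ncps_eqI) simp
lemma ncps_rev_diff [simp]: "ncps_rev (a - b) = ncps_rev a - ncps_rev b" by (rule ncps_eqI) simp
lemma ncps_rev_of_int [simp]: "ncps_rev (of_int c) = of_int c" by (rule ncps_eqI) simp
lemma ncps_rev_sum [simp]: "ncps_rev (sum f A) = (\<Sum>i\<in>A. ncps_rev (f i))" by (rule ncps_eqI) simp
text \<open>Reversing a word exchanges its prefixes and suffixes. This anti-automorphism provides
  the mirror images \<open>Dr_mult\<close>, \<open>left_relation\<close> and
  \<open>leading_mult_right\<close>.\<close>

lemma ncps_rev_mult: "ncps_rev (a * b) = ncps_rev b * ncps_rev a"
proof (rule ncps_eqI)
  fix w :: "nat list"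
  have "cf (ncps_rev (a * b)) w = (\<Sum>i\<le>length w. cf a (rev (drop (length w - i) w)) * cf b (rev (take (length w - i) w)))"
    by (simp add: cf_mult take_rev drop_rev)
  also have "\<dots> = (\<Sum>i\<le>length w. cf a (rev (drop i w)) * cf b (rev (take i w)))"
    by (rule sum.reindex_bij_witness[of _ "\<lambda>i. length w - i" "\<lambda>i. length w - i"]) auto
  finally show "cf (ncps_rev (a * b)) w = cf (ncps_rev b * ncps_rev a) w"
    by (simp add: cf_mult mult.commute)
qed
lemma Dl_ncps_rev: "Dl j (ncps_rev a) = ncps_rev (Dr j a)" by (rule ncps_eqI) simp
lemma Dr_ncps_rev: "Dr j (ncps_rev a) = ncps_rev (Dl j a)" by (rule ncps_eqI) simp
lemma Dr_mult: "Dr j (a * b) = a * Dr j b + of_int (cf b []) * Dr j a"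
proof -
  have "Dr j (a * b) = ncps_rev (Dl j (ncps_rev (a * b)))" by (simp add: Dl_ncps_rev)
  also have "\<dots> = a * Dr j b + Dr j a * of_int (cf b [])"
    by (simp only: ncps_rev_mult Dl_mult ncps_rev_add Dl_ncps_rev ncps_rev_ncps_rev ncps_rev_of_int) simp
  also have "Dr j a * of_int (cf b []) = of_int (cf b []) * Dr j a"
    by (rule ncps_eqI) simp
  finally show ?thesis .
qed

section \<open>The filtration by order modulo \<open>p\<close>\<close>

definition filt :: "nat \<Rightarrow> nat \<Rightarrow> ncps set" where
  "filt p k = {a. \<forall>w. length w < k \<longrightarrow> int p dvd cf a w}"

lemma filtI: "(\<And>w. length w < k \<Longrightarrow> int p dvd cf a w) \<Longrightarrow> a \<in> filt p k"
  by (simp add: filt_def)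
lemma filtD: "a \<in> filt p k \<Longrightarrow> length w < k \<Longrightarrow> int p dvd cf a w"
  by (simp add: filt_def)
lemma filt_0 [simp]: "a \<in> filt p 0" by (simp add: filt_def)
lemma filt_zero [simp]: "0 \<in> filt p k" by (simp add: filt_def)
lemma filt_add [intro]: "a \<in> filt p k \<Longrightarrow> b \<in> filt p k \<Longrightarrow> a + b \<in> filt p k"
  by (simp add: filt_def)
lemma filt_diff [intro]: "a \<in> filt p k \<Longrightarrow> b \<in> filt p k \<Longrightarrow> a - b \<in> filt p k"
  by (simp add: filt_def)
lemma filt_cancel: "a + b \<in> filt p k \<Longrightarrow> b \<in> filt p k \<Longrightarrow> a \<in> filt p k"
  using filt_diff[of "a + b" p k b] by simp
lemma filt_uminus [intro]: "a \<in> filt p k \<Longrightarrow> - a \<in> filt p k"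
  by (simp add: filt_def)
lemma filt_sum [intro]: "(\<And>i. i \<in> A \<Longrightarrow> f i \<in> filt p k) \<Longrightarrow> sum f A \<in> filt p k"
  by (simp add: filt_def dvd_sum)
lemma filt_mono: "a \<in> filt p k \<Longrightarrow> l \<le> k \<Longrightarrow> a \<in> filt p l"
  by (auto simp: filt_def)
lemma filt_of_int: "int p dvd c \<Longrightarrow> of_int c \<in> filt p k"
  by (auto simp: filt_def)
lemma filt_of_int_mult: "int p dvd c \<Longrightarrow> of_int c * a \<in> filt p k"
  by (auto simp: filt_def)
lemma filt_mult: assumes "a \<in> filt p i" "b \<in> filt p j" shows "a * b \<in> filt p (i + j)"
proof (rule filtI)
  fix w :: "nat list" assume w: "length w < i + j"
  show "int p dvd cf (a * b) w"
    unfolding cf_mult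
  proof (rule dvd_sum)
    fix l assume "l \<in> {..length w}"
    then have "length (take l w) < i \<or> length (drop l w) < j" using w by auto
    then show "int p dvd cf a (take l w) * cf b (drop l w)"
      using filtD[OF assms(1)] filtD[OF assms(2)] dvd_mult dvd_mult2 by (elim disjE) simp_all
  qed
qed
lemma filt_mult_left: "b \<in> filt p k \<Longrightarrow> a * b \<in> filt p k"
  using filt_mult[of a p 0 b k] by simp
lemma filt_mult_right: "a \<in> filt p k \<Longrightarrow> a * b \<in> filt p k"
  using filt_mult[of a p k b 0] by simp
lemma filt_mult_Suc: "a \<in> filt p 1 \<Longrightarrow> b \<in> filt p k \<Longrightarrow> a * b \<in> filt p (Suc k)"
  "a \<in> filt p k \<Longrightarrow> b \<in> filt p 1 \<Longrightarrow> a * b \<in> filt p (Suc k)"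
  using filt_mult[of a p 1 b k] filt_mult[of a p k b 1] by simp_all
lemma filt_Suc_0 [simp]: "a \<in> filt p (Suc 0) \<longleftrightarrow> int p dvd cf a []"
  by (auto simp: filt_def)
lemma filt_Dl: "a \<in> filt p (Suc k) \<Longrightarrow> Dl j a \<in> filt p k"
  by (auto simp: filt_def)
lemma filt_Dr: "a \<in> filt p (Suc k) \<Longrightarrow> Dr j a \<in> filt p k"
  by (auto simp: filt_def)
lemma filt_ncps_rev [simp]: "ncps_rev a \<in> filt p k \<longleftrightarrow> a \<in> filt p k"
  by (auto simp: filt_def) (metis length_rev rev_rev_ident)

text \<open>Congruence modulo the two-sided ideal \<open>filt p k\<close>. The index is a strict
  bound on lengths: level \<open>Suc q\<close> compares the words of length at most
  \<open>q\<close>.\<close>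

definition eqf :: "nat \<Rightarrow> nat \<Rightarrow> ncps \<Rightarrow> ncps \<Rightarrow> bool" where
  "eqf p k a b \<longleftrightarrow> a - b \<in> filt p k"

lemma eqf_refl [simp]: "eqf p k a a" by (simp add: eqf_def)
lemma eqf_sym: "eqf p k a b \<Longrightarrow> eqf p k b a"
  using filt_uminus[of "a - b" p k] by (simp add: eqf_def)
lemma eqf_trans [trans]: "eqf p k a b \<Longrightarrow> eqf p k b c \<Longrightarrow> eqf p k a c"
  using filt_add[of "a - b" p k "b - c"] by (simp add: eqf_def)
lemma eqf_eq_trans [trans]: "eqf p k a b \<Longrightarrow> b = c \<Longrightarrow> eqf p k a c"
  and eq_eqf_trans [trans]: "a = b \<Longrightarrow> eqf p k b c \<Longrightarrow> eqf p k a c"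
  by simp_all
lemma eqf_add: "eqf p k a b \<Longrightarrow> eqf p k c d \<Longrightarrow> eqf p k (a + c) (b + d)"
  using filt_add[of "a - b" p k "c - d"] by (simp add: eqf_def algebra_simps)
lemma eqf_diff: "eqf p k a b \<Longrightarrow> eqf p k c d \<Longrightarrow> eqf p k (a - c) (b - d)"
  using filt_diff[of "a - b" p k "c - d"] by (simp add: eqf_def algebra_simps)
lemma eqf_sum: "(\<And>i. i \<in> A \<Longrightarrow> eqf p k (f i) (g i)) \<Longrightarrow> eqf p k (sum f A) (sum g A)"
  using filt_sum[of A "\<lambda>i. f i - g i" p k] by (simp add: eqf_def sum_subtractf)
lemma eqf_mult: assumes "eqf p k a b" "eqf p k c d" shows "eqf p k (a * c) (b * d)"
proof -
  have "a * c - b * d = (a - b) * c + b * (c - d)" by (simp add: algebra_simps)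
  then show ?thesis
    using assms filt_mult_left filt_mult_right unfolding eqf_def by (metis filt_add)
qed
text \<open>A factor without constant term modulo \<open>p\<close> gains one degree of precision.
  This pays for the degree lost with each derivative in the inductions on truncated
  substitutions.\<close>

lemma eqf_mult_Suc: assumes "a \<in> filt p 1" "eqf p k c d" shows "eqf p (Suc k) (a * c) (a * d)"
  using filt_mult_Suc(1)[OF assms(1), of "c - d" k] assms(2) by (simp add: eqf_def algebra_simps)
lemma eqf_mono: "eqf p k a b \<Longrightarrow> l \<le> k \<Longrightarrow> eqf p l a b"
  unfolding eqf_def by (rule filt_mono)
lemma eqf_power: "eqf p k a b \<Longrightarrow> eqf p k (a ^ m) (b ^ m)"
  by (induction m) (auto intro: eqf_mult)
lemma eqf_filt: "eqf p k a b \<Longrightarrow> a \<in> filt p k \<longleftrightarrow> b \<in> filt p k"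
  unfolding eqf_def by (metis add.commute diff_add_cancel filt_add filt_diff minus_diff_eq filt_uminus add_diff_cancel)
lemma eqf_Dr: "eqf p (Suc k) a b \<Longrightarrow> eqf p k (Dr j a) (Dr j b)"
  unfolding eqf_def by (metis Dr_diff filt_Dr)
lemma eqf_ncps_rev [simp]: "eqf p k (ncps_rev a) (ncps_rev b) \<longleftrightarrow> eqf p k a b"
  unfolding eqf_def by (metis ncps_rev_diff filt_ncps_rev)

text \<open>Substitution of \<open>z j\<close> for \<open>letter j\<close>, where only words of length at most \<open>k\<close> are kept. It is a
  ring homomorphism modulo series of order \<open>> k\<close> if the \<open>z j\<close> have no constant term.\<close>

fun trunc_subst :: "nat \<Rightarrow> (nat \<Rightarrow> ncps) \<Rightarrow> nat \<Rightarrow> ncps \<Rightarrow> ncps" where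
  "trunc_subst n z 0 a = of_int (cf a [])"
| "trunc_subst n z (Suc k) a = of_int (cf a []) + (\<Sum>j=1..n. z j * trunc_subst n z k (Dl j a))"

lemma trunc_subst_of_int [simp]: "trunc_subst n z k (of_int c) = of_int c"
proof (induction k arbitrary: c)
  case (Suc k)
  have "trunc_subst n z k 0 = 0" using Suc[of 0] by simp
  then show ?case by simp
qed simp

lemma trunc_subst_add [simp]: "trunc_subst n z k (a + b) = trunc_subst n z k a + trunc_subst n z k b"
  by (induction k arbitrary: a b) (auto simp: algebra_simps sum.distrib)
lemma trunc_subst_zero [simp]: "trunc_subst n z k 0 = 0"
  using trunc_subst_of_int[of n z k 0] by simp
lemma trunc_subst_one [simp]: "trunc_subst n z k 1 = 1"
  using trunc_subst_of_int[of n z k 1] by simp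
lemma trunc_subst_diff [simp]: "trunc_subst n z k (a - b) = trunc_subst n z k a - trunc_subst n z k b"
  using trunc_subst_add[of n z k "a - b" b] by simp
lemma trunc_subst_sum [simp]: "trunc_subst n z k (sum f A) = (\<Sum>i\<in>A. trunc_subst n z k (f i))"
  by (induction A rule: infinite_finite_induct) auto
lemma trunc_subst_of_int_mult [simp]: "trunc_subst n z k (of_int c * a) = of_int c * trunc_subst n z k a"
proof (induction k arbitrary: a)
  case (Suc k)
  have "of_int c * (z j * b) = z j * (of_int c * b)" for j b
    by (metis mult.assoc mult_of_int_commute)
  then show ?case by (simp add: Dl_mult Suc algebra_simps sum_distrib_left)
qed simp

lemma trunc_subst_letter: "j \<in> {1..n} \<Longrightarrow> trunc_subst n z (Suc k) (letter j) = z j"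
proof -
  have "Dl i (letter j) = (if i = j then 1 else 0)" for i
    by (rule ncps_eqI) simp
  then have "z i * trunc_subst n z k (Dl i (letter j)) = (if i = j then z i else 0)" for i
    by simp
  then have "trunc_subst n z (Suc k) (letter j) = (\<Sum>i=1..n. if i = j then z i else 0)"
    by simp
  then show "j \<in> {1..n} \<Longrightarrow> ?thesis" by simp
qed

text \<open>The substitution \<open>trunc_subst\<close> peels off first letters; it may equally well peel off last letters.\<close>

lemma trunc_subst_Suc_right:
  "trunc_subst n z (Suc k) a = of_int (cf a []) + (\<Sum>j=1..n. trunc_subst n z k (Dr j a) * z j)"
proof (induction k arbitrary: a)
  case 0
  show ?case by (simp add: mult_of_int_commute)
next
  case (Suc k)
  have "trunc_subst n z (Suc (Suc k)) a = of_int (cf a []) + (\<Sum>j=1..n. z j * trunc_subst n z (Suc k) (Dl j a))"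
    by simp
  also have "(\<Sum>j=1..n. z j * trunc_subst n z (Suc k) (Dl j a)) =
      (\<Sum>j=1..n. z j * (of_int (cf a [j]) + (\<Sum>i=1..n. trunc_subst n z k (Dr i (Dl j a)) * z i)))"
    by (subst Suc) simp
  also have "\<dots> = (\<Sum>j=1..n. of_int (cf a [j]) * z j) +
      (\<Sum>j=1..n. \<Sum>i=1..n. z j * trunc_subst n z k (Dl j (Dr i a)) * z i)"
    by (simp add: algebra_simps sum.distrib sum_distrib_left mult_of_int_commute Dr_Dl)
  also have "(\<Sum>j=1..n. \<Sum>i=1..n. z j * trunc_subst n z k (Dl j (Dr i a)) * z i) =
      (\<Sum>i=1..n. (\<Sum>j=1..n. z j * trunc_subst n z k (Dl j (Dr i a))) * z i)"
    by (subst sum.swap) (simp add: sum_distrib_right)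
  also have "(\<Sum>j=1..n. of_int (cf a [j]) * z j) +
      (\<Sum>i=1..n. (\<Sum>j=1..n. z j * trunc_subst n z k (Dl j (Dr i a))) * z i) =
      (\<Sum>i=1..n. trunc_subst n z (Suc k) (Dr i a) * z i)"
    by (simp add: sum.distrib[symmetric] distrib_right)
  finally show ?case .
qed

lemma trunc_subst_ncps_rev: "trunc_subst n (\<lambda>j. ncps_rev (z j)) k (ncps_rev a) = ncps_rev (trunc_subst n z k a)"
proof (induction k arbitrary: a)
  case (Suc k)
  show ?case
    by (subst trunc_subst_Suc_right) (simp add: Dl_ncps_rev Suc ncps_rev_mult Dr_ncps_rev)
qed simp

context
  fixes p n :: nat and z :: "nat \<Rightarrow> ncps"
  assumes z: "\<And>j. j \<in> {1..n} \<Longrightarrow> cf (z j) [] = 0"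
begin

lemma z_filt: "j \<in> {1..n} \<Longrightarrow> z j \<in> filt p 1"
  using z by simp

lemma trunc_subst_Nil: "cf (trunc_subst n z k a) [] = cf a []"
  by (cases k) (simp_all add: z)

lemma trunc_subst_filt: "a \<in> filt p i \<Longrightarrow> trunc_subst n z k a \<in> filt p i"
proof (induction k arbitrary: a i)
  case 0
  then show ?case using filtD[of a p i "[]"] by (cases i) (auto intro!: filt_of_int)
next
  case (Suc k)
  show ?case
  proof (cases i)
    case (Suc i')
    have "z j * trunc_subst n z k (Dl j a) \<in> filt p (Suc i')" if "j \<in> {1..n}" for j
      using Suc.IH Suc.prems that Suc by (intro filt_mult_Suc z_filt) (auto intro: filt_Dl)
    moreover have "int p dvd cf a []" using Suc.prems Suc filtD[of a p i "[]"] by simp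
    ultimately show ?thesis
      using Suc by (auto intro!: filt_add filt_of_int filt_sum)
  qed simp
qed

lemma trunc_subst_eqf: "eqf p i a b \<Longrightarrow> eqf p i (trunc_subst n z k a) (trunc_subst n z k b)"
  unfolding eqf_def by (metis trunc_subst_diff trunc_subst_filt)

text \<open>Only words of length \<open>Suc k\<close> are added, and their images contain
  \<open>Suc k\<close> factors from \<open>filt p 1\<close>.\<close>

lemma trunc_subst_Suc_eqf: "eqf p (Suc k) (trunc_subst n z (Suc k) a) (trunc_subst n z k a)"
proof (induction k arbitrary: a)
  case 0
  show ?case by (auto simp: eqf_def trunc_subst_Nil z)
next
  case (Suc k)
  have "eqf p (Suc (Suc k)) (\<Sum>j=1..n. z j * trunc_subst n z (Suc k) (Dl j a)) (\<Sum>j=1..n. z j * trunc_subst n z k (Dl j a))"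
    using Suc by (intro eqf_sum eqf_mult_Suc z_filt)
  then show ?case
    unfolding trunc_subst.simps(2)[of n z "Suc k" a] trunc_subst.simps(2)[of n z k a] by (intro eqf_add eqf_refl)
qed

lemma trunc_subst_mult: "eqf p (Suc k) (trunc_subst n z k (a * b)) (trunc_subst n z k a * trunc_subst n z k b)"
proof (induction k arbitrary: a b)
  case 0
  show ?case by (auto simp: eqf_def)
next
  case (Suc k)
  let ?T = "\<lambda>a. \<Sum>j=1..n. z j * trunc_subst n z k (Dl j a)"
  have comm: "z j * (of_int c * y) = of_int c * (z j * y)" for j c y
    by (metis mult.assoc mult_of_int_commute)
  have "trunc_subst n z (Suc k) (a * b) = of_int (cf a [] * cf b []) +
      (\<Sum>j=1..n. z j * (trunc_subst n z k (Dl j a * b) + of_int (cf a []) * trunc_subst n z k (Dl j b)))"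
    by (simp add: Dl_mult)
  \<comment> \<open>The induction hypothesis yields a product with
    \<open>trunc_subst n z k b\<close>. Passing to level \<open>Suc k\<close> there costs an error
    of order \<open>Suc k\<close>, and the factor \<open>z j\<close> lifts both errors to order
    \<open>Suc (Suc k)\<close>.\<close>
  also have "eqf p (Suc (Suc k)) \<dots> (of_int (cf a [] * cf b []) +
      (\<Sum>j=1..n. z j * (trunc_subst n z k (Dl j a) * trunc_subst n z (Suc k) b + of_int (cf a []) * trunc_subst n z k (Dl j b))))"
    using Suc eqf_trans[OF Suc eqf_mult[OF eqf_refl eqf_sym[OF trunc_subst_Suc_eqf]]]
    by (intro eqf_add eqf_refl eqf_sum eqf_mult_Suc z_filt)
  also have "\<dots> = ?T a * trunc_subst n z (Suc k) b + of_int (cf a []) * (of_int (cf b []) + ?T b)"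
    by (simp add: distrib_left sum.distrib sum_distrib_left sum_distrib_right comm mult.assoc
        del: trunc_subst.simps)
  also have "\<dots> = trunc_subst n z (Suc k) a * trunc_subst n z (Suc k) b"
    by (simp only: trunc_subst.simps(2) distrib_right add.commute)
  finally show ?case .
qed

lemma trunc_subst_ge_eqf: "k \<le> l \<Longrightarrow> eqf p (Suc k) (trunc_subst n z l a) (trunc_subst n z k a)"
proof (induction l rule: dec_induct)
  case (step m)
  then show ?case
    using eqf_trans[OF eqf_mono[OF trunc_subst_Suc_eqf, of "Suc k" m a]] by simp
qed simp

text \<open>Since \<open>z j\<close> is the image of \<open>letter j\<close>, the hypothesis is
  idempotence on the letters; multiplicativity carries it over to all series, one letter at a
  time.\<close>

lemma trunc_subst_idem:
  assumes idem: "\<And>j. j \<in> {1..n} \<Longrightarrow> eqf p (Suc q) (trunc_subst n z q (z j)) (z j)"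
  shows "k \<le> q \<Longrightarrow> eqf p (Suc k) (trunc_subst n z k (trunc_subst n z k a)) (trunc_subst n z k a)"
proof (induction k arbitrary: a)
  case (Suc k)
  let ?S = "trunc_subst n z (Suc k)"
  have zj: "eqf p (Suc (Suc k)) (?S (z j)) (z j)" if "j \<in> {1..n}" for j
    using eqf_trans[OF eqf_sym[OF trunc_subst_ge_eqf] eqf_mono[OF idem[OF that]], of "Suc k"] Suc.prems by simp
  have 1: "eqf p (Suc k) (?S (trunc_subst n z k b)) (trunc_subst n z k b)" for b
    using eqf_trans[OF trunc_subst_Suc_eqf Suc.IH] Suc.prems by simp
  have "?S (?S a) = of_int (cf a []) + (\<Sum>j=1..n. ?S (z j * trunc_subst n z k (Dl j a)))"
    by (subst (2) trunc_subst.simps(2)) (simp only: trunc_subst_add trunc_subst_of_int trunc_subst_sum)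
  also have "eqf p (Suc (Suc k)) \<dots> (of_int (cf a []) + (\<Sum>j=1..n. z j * trunc_subst n z k (Dl j a)))"
  proof (intro eqf_add eqf_refl eqf_sum)
    fix j assume j: "j \<in> {1..n}"
    have "eqf p (Suc (Suc k)) (?S (z j * trunc_subst n z k (Dl j a))) (?S (z j) * ?S (trunc_subst n z k (Dl j a)))"
      by (rule trunc_subst_mult)
    also have "eqf p (Suc (Suc k)) \<dots> (z j * ?S (trunc_subst n z k (Dl j a)))"
      using zj[OF j] by (intro eqf_mult eqf_refl)
    also have "eqf p (Suc (Suc k)) \<dots> (z j * trunc_subst n z k (Dl j a))"
      using 1 j by (intro eqf_mult_Suc z_filt)
    finally show "eqf p (Suc (Suc k)) (?S (z j * trunc_subst n z k (Dl j a))) (z j * trunc_subst n z k (Dl j a))" .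
  qed
  also have "of_int (cf a []) + (\<Sum>j=1..n. z j * trunc_subst n z k (Dl j a)) = ?S a" by simp
  finally show ?case .
qed simp

end

section \<open>Relations between Fox derivatives\<close>

text \<open>Write \<open>d\<close> for the row of derivatives of \<open>a\<close>, \<open>J\<close> for the Jacobian matrix of the substitution \<open>S\<close>,
  and \<open>\<delta> = S d\<close>. The chain rule gives \<open>d = \<delta> J\<close>, and idempotence gives \<open>\<delta> = \<delta> S(J)\<close>. Hence
  \<open>d = \<delta> (1 + N)\<close>, where \<open>N = J - S(J)\<close> has no constant terms, so that \<open>1 + N\<close> is invertible, and
  any column of \<open>(1 + N)\<^sup>-\<^sup>1 (1 - S(J))\<close> is annihilated by \<open>d\<close>.\<close>

lemma right_relation:
  fixes p n q :: nat and z :: "nat \<Rightarrow> ncps"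
  assumes q: "q > 0"
    and z: "\<And>j. j \<in> {1..n} \<Longrightarrow> cf (z j) [] = 0"
    and idem: "\<And>j. j \<in> {1..n} \<Longrightarrow> eqf p (Suc q) (trunc_subst n z q (z j)) (z j)"
    and a: "eqf p (Suc q) (trunc_subst n z q a) a"
    and ne: "j0 \<in> {1..n}" "l0 \<in> {1..n}" "\<not> int p dvd cf (z j0) [l0] - of_bool (j0 = l0)"
  shows "\<exists>c. (\<Sum>j=1..n. Dr j a * c j) \<in> filt p q \<and> (\<exists>j\<in>{1..n}. \<not> int p dvd cf (c j) [])"
proof -
  obtain r where r: "q = Suc r" using q by (cases q) auto
  \<comment> \<open>The derivative of a series known up to words of length \<open>q\<close> is known
    only up to length \<open>q - 1\<close>, so the substitution in the chain rule is truncated at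
    \<open>r\<close>.\<close>
  define S where "S = trunc_subst n z r"
  define J where "J j l = Dr l (z j)" for j l
  define \<delta> where "\<delta> j = S (Dr j a)" for j
  define N where "N j l = J j l - S (J j l)" for j l
  have S_Nil: "cf (S y) [] = cf y []" for y
    unfolding S_def by (rule trunc_subst_Nil) (rule z)
  have d: "eqf p q (Dr l a) (\<Sum>j=1..n. \<delta> j * J j l)" for l
  proof -
    have "eqf p q (Dr l a) (Dr l (trunc_subst n z (Suc r) a))"
      using eqf_sym[OF a] r by (intro eqf_Dr) simp
    \<comment> \<open>The chain rule: when last letters are peeled off, \<open>Dr l\<close> acts on
      the final factor \<open>z j\<close> alone, because \<open>z j\<close> has no constant
      term.\<close>
    also have "Dr l (trunc_subst n z (Suc r) a) = (\<Sum>j=1..n. \<delta> j * J j l)"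
      unfolding trunc_subst_Suc_right by (simp add: Dr_mult z \<delta>_def S_def J_def)
    finally show ?thesis .
  qed
  have \<delta>: "eqf p q (\<delta> l) (\<Sum>j=1..n. \<delta> j * S (J j l))" for l
  proof -
    have "eqf p q (\<delta> l) (S (\<Sum>j=1..n. \<delta> j * J j l))"
      unfolding \<delta>_def[of l] S_def by (rule trunc_subst_eqf[OF z]) (use d S_def in auto)
    also have "S (\<Sum>j=1..n. \<delta> j * J j l) = (\<Sum>j=1..n. S (\<delta> j * J j l))"
      by (simp add: S_def)
    also have "eqf p q \<dots> (\<Sum>j=1..n. \<delta> j * S (J j l))"
    proof (rule eqf_sum)
      fix j
      have "eqf p q (S (\<delta> j * J j l)) (S (\<delta> j) * S (J j l))"
        unfolding S_def r by (rule trunc_subst_mult[OF z])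
      also have "eqf p q \<dots> (\<delta> j * S (J j l))"
        unfolding S_def \<delta>_def r
        by (intro eqf_mult eqf_refl trunc_subst_idem[OF z, where q = q] idem) (auto simp: r)
      finally show "eqf p q (S (\<delta> j * J j l)) (\<delta> j * S (J j l))" .
    qed
    finally show ?thesis .
  qed
  have N: "N j l \<in> filt p 1" if "j \<in> {1..n}" for j l
    by (simp add: N_def S_Nil)
  have dN: "eqf p q (Dr l a) (\<delta> l + (\<Sum>j=1..n. \<delta> j * N j l))" for l
  proof -
    have "eqf p q (Dr l a + \<delta> l) ((\<Sum>j=1..n. \<delta> j * J j l) + \<delta> l)" by (intro eqf_add d eqf_refl)
    from eqf_diff[OF this \<delta>[of l]] show ?thesis
      by (simp add: N_def algebra_simps sum_subtractf)
  qed
  \<comment> \<open>This inverts \<open>1 + N\<close>: \<open>c\<close> is the truncated Neumann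
    series \<open>b - N b + N (N b) - ...\<close>. Each application of \<open>N\<close> raises the
    order by one, so the recursion runs from order \<open>i\<close> up to order \<open>q\<close>,
    where \<open>c = b\<close> suffices.\<close>
  have solve: "\<exists>c. (\<forall>j\<in>{1..n}. eqf p 1 (c j) (b j)) \<and>
      eqf p q (\<Sum>j=1..n. Dr j a * c j) (\<Sum>j=1..n. \<delta> j * b j)"
    if "i \<le> q" "\<forall>j\<in>{1..n}. b j \<in> filt p i" for i b
    using that
  proof (induction i arbitrary: b rule: inc_induct)
    case base
    then have "(\<Sum>j=1..n. Dr j a * b j) - (\<Sum>j=1..n. \<delta> j * b j) \<in> filt p q"
      by (intro filt_diff filt_sum filt_mult_left) auto
    then show ?case by (intro exI[of _ b]) (auto simp: eqf_def)
  next
    case (step i)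
    define b' where "b' j = (\<Sum>l=1..n. N j l * b l)" for j
    have "\<forall>j\<in>{1..n}. b' j \<in> filt p (Suc i)"
      unfolding b'_def using step.prems N by (intro ballI filt_sum filt_mult_Suc) auto
    from step.IH[OF this] obtain c' where c': "\<forall>j\<in>{1..n}. eqf p 1 (c' j) (b' j)"
      "eqf p q (\<Sum>j=1..n. Dr j a * c' j) (\<Sum>j=1..n. \<delta> j * b' j)" by blast
    have "eqf p 1 (b j - c' j) (b j)" if j: "j \<in> {1..n}" for j
    proof -
      have "b' j \<in> filt p 1" 
        using \<open>\<forall>j\<in>{1..n}. b' j \<in> filt p (Suc i)\<close> j filt_mono[of "b' j" p "Suc i" 1] by simp
      then have "c' j \<in> filt p 1" using c' j eqf_filt by blast
      then show ?thesis by (simp add: eqf_def)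
    qed
    moreover have "eqf p q (\<Sum>j=1..n. Dr j a * (b j - c' j)) (\<Sum>j=1..n. \<delta> j * b j)"
    proof -
      have "(\<Sum>j=1..n. Dr j a * (b j - c' j)) = (\<Sum>j=1..n. Dr j a * b j) - (\<Sum>j=1..n. Dr j a * c' j)"
        by (simp add: algebra_simps sum_subtractf)
      also have "eqf p q \<dots> ((\<Sum>l=1..n. (\<delta> l + (\<Sum>j=1..n. \<delta> j * N j l)) * b l) - (\<Sum>j=1..n. \<delta> j * b' j))"
        by (intro eqf_diff eqf_sum eqf_mult dN eqf_refl c')
      also have "(\<Sum>l=1..n. (\<delta> l + (\<Sum>j=1..n. \<delta> j * N j l)) * b l) =
          (\<Sum>l=1..n. \<delta> l * b l) + (\<Sum>j=1..n. \<delta> j * b' j)"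
        unfolding distrib_right sum.distrib b'_def sum_distrib_left sum_distrib_right mult.assoc
        by (subst sum.swap) simp
      finally show ?thesis by simp
    qed
    ultimately show ?case by (intro exI[of _ "\<lambda>j. b j - c' j"]) auto
  qed
  \<comment> \<open>Column \<open>l0\<close> of \<open>1 - S(J)\<close>, which
    \<open>\<delta>\<close> annihilates. Up to sign, its entry at \<open>j0\<close> has the constant
    term of hypothesis \<open>ne\<close>, which \<open>p\<close> does not divide, and
    \<open>c\<close> inherits this.\<close>
  define b where "b j = of_int (of_bool (j = l0)) - S (J j l0)" for j
  obtain c where c: "\<forall>j\<in>{1..n}. eqf p 1 (c j) (b j)"
      "eqf p q (\<Sum>j=1..n. Dr j a * c j) (\<Sum>j=1..n. \<delta> j * b j)"
    using solve[of 0 b] by auto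
  have "(\<Sum>j=1..n. \<delta> j * of_int (of_bool (j = l0))) = (\<Sum>j=1..n. if j = l0 then \<delta> j else 0)"
    by (intro sum.cong) auto
  then have "(\<Sum>j=1..n. \<delta> j * b j) = \<delta> l0 - (\<Sum>j=1..n. \<delta> j * S (J j l0))"
    using ne by (simp add: b_def right_diff_distrib sum_subtractf)
  then have "(\<Sum>j=1..n. \<delta> j * b j) \<in> filt p q" using \<delta>[of l0] by (simp add: eqf_def)
  then have "(\<Sum>j=1..n. Dr j a * c j) \<in> filt p q" using c eqf_filt by blast
  moreover have "\<not> int p dvd cf (b j0) []"
    using ne(3) by (cases "j0 = l0") (simp_all add: b_def S_Nil J_def dvd_diff_commute)
  then have "\<not> int p dvd cf (c j0) []" using c(1) ne(1) eqf_filt[of p 1 "c j0" "b j0"] by simp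
  ultimately show ?thesis using ne(1) by blast
qed

text \<open>Word reversal turns this into the mirror image.\<close>

lemma left_relation:
  fixes p n q :: nat and z :: "nat \<Rightarrow> ncps"
  assumes q: "q > 0"
    and z: "\<And>j. j \<in> {1..n} \<Longrightarrow> cf (z j) [] = 0"
    and idem: "\<And>j. j \<in> {1..n} \<Longrightarrow> eqf p (Suc q) (trunc_subst n z q (z j)) (z j)"
    and a: "eqf p (Suc q) (trunc_subst n z q a) a"
    and ne: "j0 \<in> {1..n}" "l0 \<in> {1..n}" "\<not> int p dvd cf (z j0) [l0] - of_bool (j0 = l0)"
  shows "\<exists>c. (\<Sum>j=1..n. c j * Dl j a) \<in> filt p q \<and> (\<exists>j\<in>{1..n}. \<not> int p dvd cf (c j) [])"
proof -
  have "\<exists>c. (\<Sum>j=1..n. Dr j (ncps_rev a) * c j) \<in> filt p q \<and> (\<exists>j\<in>{1..n}. \<not> int p dvd cf (c j) [])"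
    by (rule right_relation[where z = "\<lambda>j. ncps_rev (z j)" and ?j0.0 = j0 and ?l0.0 = l0])
      (use assms in \<open>simp_all add: trunc_subst_ncps_rev\<close>)
  then obtain c where c: "(\<Sum>j=1..n. Dr j (ncps_rev a) * c j) \<in> filt p q"
    "\<exists>j\<in>{1..n}. \<not> int p dvd cf (c j) []" by blast
  have "ncps_rev (\<Sum>j=1..n. Dr j (ncps_rev a) * c j) = (\<Sum>j=1..n. ncps_rev (c j) * Dl j a)"
    by (simp add: ncps_rev_mult Dr_ncps_rev)
  then have "(\<Sum>j=1..n. ncps_rev (c j) * Dl j a) \<in> filt p q" using c(1) by (metis filt_ncps_rev)
  moreover have "\<exists>j\<in>{1..n}. \<not> int p dvd cf (ncps_rev (c j)) []" using c(2) by simp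
  ultimately show ?thesis by (intro exI[of _ "\<lambda>j. ncps_rev (c j)"]) simp
qed

text \<open>Subtracting its constant term from \<open>a\<close> leaves a factor that pushes
  \<open>b\<close> beyond length \<open>k\<close>.\<close>

lemma leading_mult_left:
  assumes "b \<in> filt p k" "length w = k"
  shows "int p dvd cf (a * b) w - cf a [] * cf b w"
proof -
  have "(a - of_int (cf a [])) * b \<in> filt p (Suc k)" using assms by (intro filt_mult_Suc) auto
  then have "int p dvd cf ((a - of_int (cf a [])) * b) w" using assms by (auto dest: filtD)
  then show ?thesis by (simp add: left_diff_distrib)
qed

lemma leading_mult_right:
  assumes "b \<in> filt p k" "length w = k"
  shows "int p dvd cf (b * a) w - cf b w * cf a []"
  using leading_mult_left[of "ncps_rev b" p k "rev w" "ncps_rev a"] assms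
  by (simp flip: ncps_rev_mult add: mult.commute)

text \<open>The operator \<open>B\<close> sandwiches second derivatives between \<open>c'\<close>
  and \<open>c\<close>. The left relation makes it small on \<open>a\<close>, the right relation on
  \<open>b\<close>, hence it is small on \<open>u\<close>, where leading coefficients see only the
  constant terms of \<open>c'\<close> and \<open>c\<close>. Membership in \<open>filt p 2\<close>
  disposes of the correction terms of the product rule.\<close>

lemma two_sided_relation:
  assumes q: "q = Suc (Suc r)" and a: "a \<in> filt p 2" and b: "eqf p (Suc q) b (a + u)"
    and u: "u \<in> filt p q"
    and rel_b: "(\<Sum>j=1..n. Dr j b * c j) \<in> filt p q"
    and rel_a: "(\<Sum>i=1..n. c' i * Dl i a) \<in> filt p q"
    and w: "length w = r"
  shows "int p dvd (\<Sum>i=1..n. \<Sum>j=1..n. cf (c' i) [] * cf u (i # w @ [j]) * cf (c j) [])"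
proof -
  define B where "B y = (\<Sum>i=1..n. \<Sum>j=1..n. c' i * Dl i (Dr j y) * c j)" for y
  have b2: "b \<in> filt p 2"
  proof -
    have "a + u \<in> filt p 2" using a filt_mono[OF u] q by auto
    moreover have "eqf p 2 b (a + u)" using b q by (auto intro: eqf_mono)
    ultimately show ?thesis using eqf_filt by blast
  qed
  have Ba: "B a \<in> filt p (Suc r)"
  proof -
    have "(\<Sum>i=1..n. c' i * Dl i (Dr j a)) \<in> filt p (Suc r)" for j
    proof -
      have "Dr j (\<Sum>i=1..n. c' i * Dl i a) \<in> filt p (Suc r)"
        using rel_a q by (auto intro!: filt_Dr simp del: Dr_sum)
      then have "(\<Sum>i=1..n. c' i * Dl i (Dr j a)) + (\<Sum>i=1..n. of_int (cf a [i]) * Dr j (c' i)) \<in> filt p (Suc r)"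
        by (simp add: Dr_mult sum.distrib Dr_Dl)
      moreover have "(\<Sum>i=1..n. of_int (cf a [i]) * Dr j (c' i)) \<in> filt p (Suc r)"
        using filtD[OF a] by (auto intro!: filt_sum filt_of_int_mult)
      ultimately show ?thesis by (rule filt_cancel)
    qed
    then have "(\<Sum>j=1..n. (\<Sum>i=1..n. c' i * Dl i (Dr j a)) * c j) \<in> filt p (Suc r)"
      by (intro filt_sum) (rule filt_mult_right)
    then show ?thesis unfolding B_def by (subst sum.swap) (simp add: sum_distrib_right)
  qed
  have Bb: "B b \<in> filt p (Suc r)"
  proof -
    have "(\<Sum>j=1..n. Dl i (Dr j b) * c j) \<in> filt p (Suc r)" for i
    proof -
      have "Dl i (\<Sum>j=1..n. Dr j b * c j) \<in> filt p (Suc r)"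
        using rel_b q by (auto intro!: filt_Dl simp del: Dl_sum)
      then have "(\<Sum>j=1..n. Dl i (Dr j b) * c j) + (\<Sum>j=1..n. of_int (cf b [j]) * Dl i (c j)) \<in> filt p (Suc r)"
        by (simp add: Dl_mult sum.distrib)
      moreover have "(\<Sum>j=1..n. of_int (cf b [j]) * Dl i (c j)) \<in> filt p (Suc r)"
        using filtD[OF b2] by (auto intro!: filt_sum filt_of_int_mult)
      ultimately show ?thesis by (rule filt_cancel)
    qed
    then have "(\<Sum>i=1..n. c' i * (\<Sum>j=1..n. Dl i (Dr j b) * c j)) \<in> filt p (Suc r)"
      by (intro filt_sum) (rule filt_mult_left)
    then show ?thesis by (simp add: B_def sum_distrib_left mult.assoc)
  qed
  \<comment> \<open>Order \<open>Suc q\<close> minus two derivatives is \<open>Suc r\<close>, just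
    enough for words of length \<open>r\<close>.\<close>
  have "B (b - (a + u)) \<in> filt p (Suc r)"
    unfolding B_def
  proof (rule filt_sum, rule filt_sum, rule filt_mult_right, rule filt_mult_left)
    show "Dl i (Dr j (b - (a + u))) \<in> filt p (Suc r)" for i j
      using b q unfolding eqf_def by (intro filt_Dl filt_Dr) simp
  qed
  moreover have "B (b - (a + u)) = B b - B a - B u"
    by (simp add: B_def algebra_simps sum.distrib sum_subtractf)
  ultimately have "B u \<in> filt p (Suc r)"
    using filt_diff[OF filt_diff[OF Bb Ba], of "B (b - (a + u))"] by simp
  then have "int p dvd cf (B u) w" using w by (auto dest: filtD)
  moreover have "int p dvd cf (B u) w - (\<Sum>i=1..n. \<Sum>j=1..n. cf (c' i) [] * cf u (i # w @ [j]) * cf (c j) [])"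
    unfolding B_def cf_sum sum_subtractf[symmetric]
  proof (intro dvd_sum)
    fix i j
    let ?Y = "Dl i (Dr j u)"
    have Y: "?Y \<in> filt p r" using u q by (auto intro: filt_Dl filt_Dr)
    have "int p dvd cf (c' i * ?Y * c j) w - cf (c' i * ?Y) w * cf (c j) []"
      by (rule leading_mult_right[OF filt_mult_left[OF Y] w])
    moreover have "int p dvd (cf (c' i * ?Y) w - cf (c' i) [] * cf ?Y w) * cf (c j) []"
      by (rule dvd_mult2[OF leading_mult_left[OF Y w]])
    ultimately have "int p dvd (cf (c' i * ?Y * c j) w - cf (c' i * ?Y) w * cf (c j) []) +
        (cf (c' i * ?Y) w - cf (c' i) [] * cf ?Y w) * cf (c j) []" by (rule dvd_add)
    then show "int p dvd cf (c' i * ?Y * c j) w - cf (c' i) [] * cf u (i # w @ [j]) * cf (c j) []"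
      by (simp add: algebra_simps)
  qed
  ultimately show ?thesis using dvd_diff_right_iff[of "int p" "cf (B u) w"] by simp
qed

lemma filt_power: "t \<in> filt p 1 \<Longrightarrow> t ^ k \<in> filt p k"
  by (induction k) (auto intro: filt_mult_Suc)

text \<open>Modulo \<open>p\<close> the first factor cannot contribute the empty word, so at this
  length it contributes exactly the first letter of \<open>w\<close>: the leading form of a power is
  the power of the linear part.\<close>

lemma leading_power:
  assumes "t \<in> filt p 1"
  shows "int p dvd cf (t ^ length w) w - (\<Prod>l\<leftarrow>w. cf t [l])"
proof (induction w)
  case (Cons x w)
  let ?k = "length w"
  have 1: "int p dvd cf (Dl x t * t ^ ?k) w - cf t [x] * cf (t ^ ?k) w"
    using leading_mult_left[where w = w and a = "Dl x t", OF filt_power[OF assms] refl] by simp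
  have 2: "int p dvd cf t [] * cf (t ^ ?k) (x # w)" using assms by simp
  have 3: "int p dvd cf t [x] * (cf (t ^ ?k) w - (\<Prod>l\<leftarrow>w. cf t [l]))"
    using Cons by (rule dvd_mult)
  from dvd_add[OF dvd_add[OF 1 2] 3] show ?case
    by (simp add: cf_mult_Cons Dl_def algebra_simps)
qed simp

lemma binomial_one_plus: "(1 + t) ^ m = (\<Sum>i\<le>m. of_nat (m choose i) * t ^ i)" for t :: "'a::ring_1"
proof (induction m)
  case (Suc m)
  have "(1 + t) ^ Suc m = (\<Sum>i\<le>m. of_nat (m choose i) * t ^ i) * (1 + t)"
    by (simp only: power_Suc2 Suc)
  also have "\<dots> = (\<Sum>i\<le>m. of_nat (m choose i) * t ^ i) + (\<Sum>i\<le>m. of_nat (m choose i) * t ^ Suc i)"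
    by (simp add: distrib_left sum_distrib_right mult.assoc power_Suc2 del: power_Suc)
  also have "(\<Sum>i\<le>m. of_nat (m choose i) * t ^ i) = (\<Sum>i\<le>Suc m. of_nat (m choose i) * t ^ i)"
    by (simp add: binomial_eq_0)
  also have "\<dots> = 1 + (\<Sum>i\<le>m. of_nat (m choose Suc i) * t ^ Suc i)"
    by (subst sum.atMost_Suc_shift) simp
  also have "\<dots> + (\<Sum>i\<le>m. of_nat (m choose i) * t ^ Suc i) =
      1 + (\<Sum>i\<le>m. of_nat (Suc m choose Suc i) * t ^ Suc i)"
    by (simp only: binomial_Suc_Suc of_nat_add distrib_right sum.distrib add_ac)
  also have "\<dots> = (\<Sum>i\<le>Suc m. of_nat (Suc m choose i) * t ^ i)"
    by (simp add: sum.atMost_Suc_shift del: sum.atMost_Suc power_Suc binomial_Suc_Suc)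
  finally show ?case .
qed simp

text \<open>The inner binomial coefficients of exponent \<open>p\<close> are divisible by
  \<open>p\<close>; iteration gives \<open>p ^ s\<close>. The level \<open>k\<close> is arbitrary
  because the congruence holds in all degrees.\<close>

lemma frobenius:
  assumes "prime p"
  shows "eqf p k ((1 + t) ^ (p ^ s)) (1 + t ^ (p ^ s))"
proof (induction s)
  case (Suc s)
  have p: "eqf p k ((1 + y) ^ p) (1 + y ^ p)" for y
  proof -
    obtain m where m: "p = Suc m" using assms prime_gt_0_nat by (metis gr0_conv_Suc)
    have "(1 + y) ^ p = 1 + (\<Sum>i\<in>{1..m}. of_nat (p choose i) * y ^ i) + y ^ p"
    proof -
      have "{..m} = insert 0 {1..m}" by auto
      then show ?thesis by (simp add: binomial_one_plus m del: power_Suc)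
    qed
    moreover have "(\<Sum>i\<in>{1..m}. of_nat (p choose i) * y ^ i) \<in> filt p k"
    proof (intro filt_sum)
      fix i assume "i \<in> {1..m}"
      then have "p dvd p choose i" using assms m by (intro dvd_choose_prime) auto
      then have "int p dvd int (p choose i)" by simp
      then show "of_nat (p choose i) * y ^ i \<in> filt p k"
        by (metis filt_of_int_mult of_int_of_nat_eq)
    qed
    ultimately show ?thesis by (simp add: eqf_def)
  qed
  have "(1 + t) ^ (p ^ Suc s) = ((1 + t) ^ (p ^ s)) ^ p" by (simp add: power_mult[symmetric] mult.commute)
  also have "eqf p k \<dots> ((1 + t ^ (p ^ s)) ^ p)" by (rule eqf_power[OF Suc])
  also have "eqf p k \<dots> (1 + (t ^ (p ^ s)) ^ p)" by (rule p)
  also have "(t ^ (p ^ s)) ^ p = t ^ (p ^ Suc s)" by (simp add: power_mult[symmetric] mult.commute)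
  finally show ?case .
qed simp

lemma sum_rotate:
  "(\<Sum>k\<in>K. \<Sum>l\<in>L. \<Sum>x\<in>A. g k l x) = (\<Sum>x\<in>A. \<Sum>k\<in>K. \<Sum>l\<in>L. g k l x)"
proof -
  have "(\<Sum>l\<in>L. \<Sum>x\<in>A. g k l x) = (\<Sum>x\<in>A. \<Sum>l\<in>L. g k l x)" for k by (rule sum.swap)
  then show ?thesis by (simp only:) (rule sum.swap)
qed

text \<open>Here \<open>u\<close> is the leading form of \<open>v\<close>: modulo \<open>p\<close>,
  a word has coefficient 1 in \<open>(X i + X j) ^ q\<close> if its letters lie in
  \<open>{i, j}\<close>, and 0 otherwise; diagonal pairs stand for \<open>X i ^ q\<close>. Summing
  \<open>\<xi>\<close> and \<open>\<epsilon>\<close> over the outer letters turns the summand of a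
  pair into \<open>f i j\<close> for every inner word with letters in \<open>{i, j}\<close>.
  Suitable inner words then isolate the pairs.\<close>

lemma pair_powers_separate:
  fixes \<xi> \<epsilon> :: "nat \<Rightarrow> int" and u :: "nat list \<Rightarrow> int" and p n r :: nat
  defines "A \<equiv> {(i, j). 1 \<le> i \<and> i \<le> j \<and> j \<le> n}"
  assumes p: "prime p" and r: "2 \<le> r"
    and u: "\<And>w. length w = Suc (Suc r) \<Longrightarrow>
      int p dvd u w - (\<Sum>(i, j)\<in>A. of_bool (set w \<subseteq> {i, j}))"
    and rel: "\<And>w. length w = r \<Longrightarrow> int p dvd (\<Sum>k=1..n. \<Sum>l=1..n. \<xi> k * u (k # w @ [l]) * \<epsilon> l)"
    and \<xi>: "i \<in> {1..n}" "\<not> int p dvd \<xi> i" and \<epsilon>: "j \<in> {1..n}" "\<not> int p dvd \<epsilon> j"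
  shows False
proof -
  have finA: "finite A" by (rule finite_subset[of _ "{1..n} \<times> {1..n}"]) (auto simp: A_def)
  \<comment> \<open>The sums range over sets, so \<open>f k k\<close> is
    \<open>\<xi> k * \<epsilon> k\<close> and not four times this, which would carry no information
    for \<open>p = 2\<close>.\<close>
  define f where "f k l = (\<Sum>m\<in>{k, l}. \<xi> m) * (\<Sum>m\<in>{k, l}. \<epsilon> m)" for k l
  have rel': "int p dvd (\<Sum>(i, j)\<in>A. of_bool (set w \<subseteq> {i, j}) * f i j)" if w: "length w = r" for w
  proof -
    let ?v = "\<lambda>w. \<Sum>(i, j)\<in>A. of_bool (set w \<subseteq> {i, j}) :: int"
    have sub: "(\<Sum>k=1..n. \<xi>' k * of_bool (k \<in> {i, j})) = (\<Sum>m\<in>{i, j}. \<xi>' m)"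
      if "(i, j) \<in> A" for \<xi>' :: "nat \<Rightarrow> int" and i j
    proof -
      have "(\<Sum>m\<in>{i, j}. \<xi>' m) = (\<Sum>m\<in>{i, j}. \<xi>' m * of_bool (m \<in> {i, j}))" by (intro sum.cong) auto
      also have "\<dots> = (\<Sum>k=1..n. \<xi>' k * of_bool (k \<in> {i, j}))"
        using that by (intro sum.mono_neutral_left) (auto simp: A_def)
      finally show ?thesis by simp
    qed
    have "int p dvd (\<Sum>k=1..n. \<Sum>l=1..n. \<xi> k * (u (k # w @ [l]) - ?v (k # w @ [l])) * \<epsilon> l)"
      using w by (intro dvd_sum dvd_mult dvd_mult2 u) auto
    then have "int p dvd (\<Sum>k=1..n. \<Sum>l=1..n. \<xi> k * u (k # w @ [l]) * \<epsilon> l) -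
        (\<Sum>k=1..n. \<Sum>l=1..n. \<xi> k * ?v (k # w @ [l]) * \<epsilon> l)"
      by (simp add: right_diff_distrib left_diff_distrib sum_subtractf)
    then have "int p dvd (\<Sum>k=1..n. \<Sum>l=1..n. \<xi> k * ?v (k # w @ [l]) * \<epsilon> l)"
      by (simp only: dvd_diff_right_iff[OF rel[OF w]])
    also have "(\<Sum>k=1..n. \<Sum>l=1..n. \<xi> k * ?v (k # w @ [l]) * \<epsilon> l) =
        (\<Sum>k=1..n. \<Sum>l=1..n. \<Sum>(i, j)\<in>A. of_bool (set w \<subseteq> {i, j}) *
          ((\<xi> k * of_bool (k \<in> {i, j})) * (\<epsilon> l * of_bool (l \<in> {i, j}))))"
      unfolding sum_distrib_left sum_distrib_right
      by (intro sum.cong) (auto simp: of_bool_def)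
    also have "\<dots> = (\<Sum>(i, j)\<in>A. \<Sum>k=1..n. \<Sum>l=1..n. of_bool (set w \<subseteq> {i, j}) *
          ((\<xi> k * of_bool (k \<in> {i, j})) * (\<epsilon> l * of_bool (l \<in> {i, j}))))"
      unfolding case_prod_unfold by (rule sum_rotate)
    also have "\<dots> = (\<Sum>(i, j)\<in>A. of_bool (set w \<subseteq> {i, j}) * f i j)"
    proof (intro sum.cong refl, clarify)
      fix i j assume ij: "(i, j) \<in> A"
      have "f i j = (\<Sum>k=1..n. \<Sum>l=1..n. (\<xi> k * of_bool (k \<in> {i, j})) * (\<epsilon> l * of_bool (l \<in> {i, j})))"
        unfolding f_def sub[OF ij, of \<xi>, symmetric] sub[OF ij, of \<epsilon>, symmetric] by (rule sum_product)
      then show "(\<Sum>k=1..n. \<Sum>l=1..n. of_bool (set w \<subseteq> {i, j}) *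
          ((\<xi> k * of_bool (k \<in> {i, j})) * (\<epsilon> l * of_bool (l \<in> {i, j})))) =
          of_bool (set w \<subseteq> {i, j}) * f i j"
        by (simp only: sum_distrib_left)
    qed
    finally show ?thesis .
  qed
  have mixed: "int p dvd f k l" if kl: "1 \<le> k" "k < l" "l \<le> n" for k l
  proof -
    \<comment> \<open>Both letters must occur, so that \<open>(k, l)\<close> is the only pair in
      \<open>A\<close> containing them; this takes inner words of length at least 2.\<close>
    define w where "w = k # replicate (r - 1) l"
    have w: "length w = r" "set w = {k, l}" using r by (auto simp: w_def)
    have "(\<Sum>(i, j)\<in>A. of_bool (set w \<subseteq> {i, j}) * f i j) = (\<Sum>(i, j)\<in>{(k, l)}. of_bool (set w \<subseteq> {i, j}) * f i j)"
      using finA kl w by (intro sum.mono_neutral_right) (auto simp: A_def)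
    then show ?thesis using rel'[OF w(1)] w(2) by simp
  qed
  have f_sym: "f k l = f l k" for k l by (simp add: f_def insert_commute)
  have pure: "int p dvd \<xi> k * \<epsilon> k" if k: "k \<in> {1..n}" for k
  proof -
    define w where "w = replicate r k"
    have w: "length w = r" "set w = {k}" using r by (auto simp: w_def)
    have "(\<Sum>(i, j)\<in>A. of_bool (set w \<subseteq> {i, j}) * f i j) = f k k +
        (\<Sum>(i, j)\<in>A - {(k, k)}. of_bool (set w \<subseteq> {i, j}) * f i j)"
      using k w finA by (subst sum.remove[of _ "(k, k)"]) (auto simp: A_def)
    \<comment> \<open>Besides \<open>(k, k)\<close>, only mixed pairs contain the letter
      \<open>k\<close>, and their contributions vanish by \<open>mixed\<close>.\<close>
    moreover have "int p dvd (\<Sum>(i, j)\<in>A - {(k, k)}. of_bool (set w \<subseteq> {i, j}) * f i j)"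
    proof (rule dvd_sum)
      fix x assume x: "x \<in> A - {(k, k)}"
      then obtain i j where ij: "x = (i, j)" "1 \<le> i" "i \<le> j" "j \<le> n" by (auto simp: A_def)
      show "int p dvd (case x of (i, j) \<Rightarrow> of_bool (set w \<subseteq> {i, j}) * f i j)"
        using ij x w mixed[of i j] by (cases "i = j") auto
    qed
    ultimately have "int p dvd f k k" using rel'[OF w(1)] by (simp add: dvd_add_left_iff)
    then show ?thesis by (simp add: f_def)
  qed
  have P: "prime (int p)" using p by simp
  have cross: "int p dvd \<xi> k * \<epsilon> l + \<xi> l * \<epsilon> k" if "k \<in> {1..n}" "l \<in> {1..n}" "k \<noteq> l" for k l
  proof -
    have "int p dvd f k l" using mixed[of k l] mixed[of l k] f_sym that by (cases "k < l") auto
    then have "int p dvd \<xi> k * \<epsilon> k + \<xi> l * \<epsilon> l + (\<xi> k * \<epsilon> l + \<xi> l * \<epsilon> k)"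
      using that by (simp add: f_def algebra_simps)
    then show ?thesis using pure that by (meson dvd_add dvd_add_right_iff)
  qed
  have \<xi>j: "int p dvd \<xi> j" using pure[OF \<epsilon>(1)] \<epsilon>(2) P prime_dvd_mult_iff by blast
  then have "i \<noteq> j" using \<xi> by auto
  then have "int p dvd \<xi> i * \<epsilon> j + \<xi> j * \<epsilon> i" using cross \<xi>(1) \<epsilon>(1) by blast
  then have "int p dvd \<xi> i * \<epsilon> j" using \<xi>j by (simp add: dvd_add_left_iff)
  then show False using \<xi> \<epsilon> P prime_dvd_mult_iff by blast
qed

section \<open>Characters of finite \<open>p\<close>-groups\<close>

text \<open>A homomorphism to the integers modulo \<open>p\<close>, given by integer representatives.\<close>

definition mod_character :: "('a, 'b) monoid_scheme \<Rightarrow> nat \<Rightarrow> ('a \<Rightarrow> int) \<Rightarrow> bool" where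
  "mod_character G p \<theta> \<longleftrightarrow>
    (\<forall>a\<in>carrier G. \<forall>b\<in>carrier G. int p dvd \<theta> (a \<otimes>\<^bsub>G\<^esub> b) - (\<theta> a + \<theta> b))"

lemma mod_characterD:
  "mod_character G p \<theta> \<Longrightarrow> a \<in> carrier G \<Longrightarrow> b \<in> carrier G \<Longrightarrow>
    int p dvd \<theta> (a \<otimes>\<^bsub>G\<^esub> b) - (\<theta> a + \<theta> b)"
  by (simp add: mod_character_def)

context group
begin

lemma mod_character_one: assumes "mod_character G p \<theta>" shows "int p dvd \<theta> \<one>"
  using mod_characterD[OF assms, of \<one> \<one>] by simp

lemma mod_character_inv:
  assumes "mod_character G p \<theta>" "a \<in> carrier G" shows "int p dvd \<theta> (inv a) + \<theta> a"
proof -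
  have "int p dvd \<theta> \<one> - (\<theta> a + \<theta> (inv a))" using mod_characterD[OF assms(1), of a "inv a"] assms by simp
  then have "int p dvd \<theta> a + \<theta> (inv a)"
    using dvd_diff_right_iff[OF mod_character_one[OF assms(1)]] by simp
  then show ?thesis by (simp add: add.commute)
qed

lemma mod_character_pow:
  assumes "mod_character G p \<theta>" "a \<in> carrier G"
  shows "int p dvd \<theta> (a [^] k) - int k * \<theta> a"
proof (induction k)
  case (Suc k)
  have "int p dvd (\<theta> (a [^] k \<otimes> a) - (\<theta> (a [^] k) + \<theta> a)) + (\<theta> (a [^] k) - int k * \<theta> a)"
    using mod_characterD[OF assms(1), of "a [^] k" a] assms Suc by (intro dvd_add) auto
  then show ?case by (simp add: algebra_simps)
qed (simp add: mod_character_one[OF assms(1)])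

lemma subgroup_mod_character:
  assumes "mod_character G p \<theta>" shows "subgroup {a \<in> carrier G. int p dvd \<theta> a} G"
proof (rule subgroupI)
  show "{a \<in> carrier G. int p dvd \<theta> a} \<noteq> {}" using mod_character_one[OF assms] by blast
  show "inv a \<in> {a \<in> carrier G. int p dvd \<theta> a}" if "a \<in> {a \<in> carrier G. int p dvd \<theta> a}" for a
    using mod_character_inv[OF assms, of a] that by (simp add: dvd_add_left_iff)
  show "a \<otimes> b \<in> {a \<in> carrier G. int p dvd \<theta> a}"
    if "a \<in> {a \<in> carrier G. int p dvd \<theta> a}" "b \<in> {a \<in> carrier G. int p dvd \<theta> a}" for a b
  proof -
    have "int p dvd (\<theta> (a \<otimes> b) - (\<theta> a + \<theta> b)) + (\<theta> a + \<theta> b)"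
      using mod_characterD[OF assms, of a b] that by (intro dvd_add) auto
    then show ?thesis using that by simp
  qed
qed auto

end

text \<open>Orbits that are not single points have size divisible by \<open>p\<close>. If
  \<open>x\<close> were the only fixed point, \<open>card E\<close> would be 1 modulo
  \<open>p\<close>.\<close>

lemma (in group_action) p_group_second_fixed_point:
  assumes p: "prime (p::nat)" and order: "order G = p ^ k" and E: "finite E" "p dvd card E"
    and x: "x \<in> E" "\<And>g. g \<in> carrier G \<Longrightarrow> \<phi> g x = x"
  shows "\<exists>y\<in>E. y \<noteq> x \<and> (\<forall>g\<in>carrier G. \<phi> g y = y)"
proof (rule ccontr)
  assume neg: "\<not> ?thesis"
  interpret group_hom G "BijGroup E" \<phi> by (rule group_hom)
  let ?W = "orbits G E \<phi>"
  have sub: "W \<subseteq> E" if "W \<in> ?W" for W using that orbits_coverture by blast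
  then have "?W \<subseteq> Pow E" by blast
  then have fin: "finite ?W" using E(1) finite_subset[of ?W "Pow E"] by simp
  have orbx: "orbit G \<phi> x = {x}"
  proof -
    have "(\<lambda>g. \<phi> g x) ` carrier G = {x}" using x(2) G.one_closed by (auto simp del: G.one_closed)
    then show ?thesis by (auto simp: orbit_def)
  qed
  then have xO: "{x} \<in> ?W" using x(1) unfolding orbits_def by blast
  have "p dvd card W" if W: "W \<in> ?W" "W \<noteq> {x}" for W
  proof -
    obtain y where y: "y \<in> E" "W = orbit G \<phi> y" using W(1) by (auto simp: orbits_def)
    have "card W dvd p ^ k"
      using orbit_stabilizer_theorem[OF y(1)] y(2) order by (metis dvd_triv_left)
    moreover have "card W \<noteq> 1"
    proof
      assume "card W = 1"
      moreover have yO: "y \<in> W" using orbit_refl[OF y(1)] y(2) by simp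
      ultimately have Oy: "W = {y}" by (metis card_1_singletonE singletonD)
      have "\<phi> g y = y" if "g \<in> carrier G" for g
        using that Oy y(2) unfolding orbit_def by blast
      then have "y = x" using neg y(1) by blast
      then show False using W(2) Oy by simp
    qed
    ultimately show ?thesis using p
      by (metis divides_primepow_nat dvd_power dvd_refl power_0 gr0I)
  qed
  then have "p dvd (\<Sum>W\<in>?W - {{x}}. card W)" by (intro dvd_sum) auto
  moreover have "card E = (\<Sum>W\<in>?W. card W)"
    using disjoint_sum[OF E(1), of "\<lambda>_. 1::nat"] by simp
  then have "card E = 1 + (\<Sum>W\<in>?W - {{x}}. card W)"
    using sum.remove[OF fin xO, of card] by simp
  ultimately have "p dvd 1" using E(2) by (metis dvd_add_left_iff)
  then show False using p by (simp add: prime_nat_iff)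
qed

text \<open>\<open>M\<close> acts by right multiplication on its right cosets, whose number is
  divisible by \<open>p\<close>, and fixes the coset \<open>M\<close>. A second fixed coset
  \<open>M #> a\<close> says precisely that \<open>a\<close> conjugates \<open>M\<close> into
  itself.\<close>

lemma (in group) p_group_normalizer_grows:
  assumes p: "prime (p::nat)" and order: "order G = p ^ k" and M: "subgroup M G" "M \<noteq> carrier G"
  shows "\<exists>a\<in>carrier G - M. \<forall>m\<in>M. a \<otimes> m \<otimes> inv a \<in> M"
proof -
  have "order G > 0" using order prime_gt_0_nat[OF p] by simp
  then have fin: "finite (carrier G)" unfolding order_gt_0_iff_finite .
  let ?M = "G\<lparr>carrier := M\<rparr>"
  define E where "E = rcosets M"
  \<comment> \<open>The inverse makes right multiplication a left action; the restriction to
    \<open>E\<close> is what \<open>BijGroup E\<close> demands of its elements.\<close>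
  define \<phi> where "\<phi> m = (\<lambda>C\<in>E. C #> inv m)" for m
  have Msub: "M \<subseteq> carrier G" using M(1) by (rule subgroup.subset)
  have Mg: "group ?M" using M(1) by (rule subgroup_imp_group)
  have E: "finite E" unfolding E_def RCOSETS_def using fin by simp
  have Ecl: "C \<subseteq> carrier G" if "C \<in> E" for C
    using that rcosets_part_G[OF M(1)] unfolding E_def by blast
  have mem: "C #> m \<in> E" if CE: "C \<in> E" "m \<in> carrier G" for C m
  proof -
    obtain g where g: "g \<in> carrier G" "C = M #> g" using CE by (auto simp: E_def RCOSETS_def)
    then have "C #> m = M #> (g \<otimes> m)" using coset_mult_assoc Msub CE by simp
    then show ?thesis using g CE by (auto simp: E_def RCOSETS_def)
  qed
  have assoc: "C #> a #> b = C #> (a \<otimes> b)" if "C \<in> E" "a \<in> carrier G" "b \<in> carrier G" for C a b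
    using coset_mult_assoc Ecl that by simp
  have one: "C #> \<one> = C" if "C \<in> E" for C using Ecl[OF that] by (rule coset_mult_one)
  have Bij: "\<phi> m \<in> Bij E" if m: "m \<in> carrier G" for m
  proof -
    have "bij_betw (\<phi> m) E E"
      by (rule bij_betw_byWitness[where f' = "\<phi> (inv m)"])
        (use m mem assoc one in \<open>auto simp: \<phi>_def\<close>)
    then show ?thesis by (simp add: Bij_def \<phi>_def)
  qed
  have "\<phi> \<in> hom ?M (BijGroup E)"
  proof (rule homI)
    show "\<phi> m \<in> carrier (BijGroup E)" if "m \<in> carrier ?M" for m
      using Bij that Msub by (auto simp: BijGroup_def)
    fix a b assume "a \<in> carrier ?M" "b \<in> carrier ?M"
    then have ab: "a \<in> carrier G" "b \<in> carrier G" using Msub by auto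
    have "\<phi> (a \<otimes> b) = compose E (\<phi> a) (\<phi> b)"
      using ab mem assoc by (intro ext) (auto simp: \<phi>_def compose_def inv_mult_group)
    then show "\<phi> (a \<otimes>\<^bsub>?M\<^esub> b) = \<phi> a \<otimes>\<^bsub>BijGroup E\<^esub> \<phi> b"
      using Bij ab by (simp add: BijGroup_def)
  qed
  then have "group_action ?M E \<phi>"
    using Mg group_BijGroup[of E] by (simp add: group_action_def group_hom_def group_hom_axioms_def)
  then interpret act: group_action ?M E \<phi> .
  have card: "card E * card M = p ^ k" using lagrange[OF M(1)] order by (simp add: E_def)
  then obtain i where i: "card M = p ^ i" using p by (metis divides_primepow_nat dvd_triv_right)
  obtain j where j: "card E = p ^ j" using card p by (metis divides_primepow_nat dvd_triv_left)
  have "j \<noteq> 0"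
  proof
    assume "j = 0"
    then have "card M = card (carrier G)" using card j order by (simp add: Coset.order_def)
    then show False using M(2) Msub fin card_subset_eq by blast
  qed
  then have pE: "p dvd card E" using j by simp
  have ME: "M \<in> E" using rcosetsI[OF Msub one_closed] coset_mult_one[OF Msub] by (simp add: E_def)
  have fixM: "\<phi> m M = M" if "m \<in> carrier ?M" for m
    using that ME Msub coset_join2[OF _ M(1) subgroup.m_inv_closed[OF M(1)], of m] by (auto simp: \<phi>_def)
  obtain C where C: "C \<in> E" "C \<noteq> M" "\<forall>m\<in>M. \<phi> m C = C"
  proof -
    have "order ?M = p ^ i" using i by (simp add: Coset.order_def)
    from act.p_group_second_fixed_point[OF p this E pE ME fixM] show ?thesis using that by auto
  qed
  obtain a where a: "a \<in> carrier G" "C = M #> a" using C(1) by (auto simp: E_def RCOSETS_def)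
  have "a \<otimes> m \<otimes> inv a \<in> M" if m: "m \<in> M" for m
  proof -
    have mG: "m \<in> carrier G" using m Msub by blast
    have im: "inv m \<in> M" using M(1) m by (rule subgroup.m_inv_closed)
    have "C #> m = C" using C im mG by (auto simp: \<phi>_def)
    moreover have "a \<otimes> m \<in> C #> m"
      using rcos_self[OF a(1) M(1)] a(2) unfolding r_coset_def[of _ C] by blast
    ultimately obtain m' where "m' \<in> M" "a \<otimes> m = m' \<otimes> a" using a(2) by (auto simp: r_coset_def)
    moreover have "m' \<in> carrier G" using \<open>m' \<in> M\<close> Msub by blast
    ultimately show ?thesis using a(1) by (simp add: inv_solve_right' m_assoc)
  qed
  moreover have "a \<notin> M" using C(2) a M(1) coset_join2 by blast
  ultimately show ?thesis using a(1) by blast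
qed

text \<open>The preimage of the cyclic subgroup of \<open>G Mod M\<close> generated by the image of
  \<open>a\<close>, described without the quotient.\<close>

lemma (in group) normal_cyclic_extension:
  assumes M: "M \<lhd> G" and a: "a \<in> carrier G"
  shows "subgroup {g \<in> carrier G. \<exists>j::int. g \<otimes> inv (a [^] j) \<in> M} G" (is "subgroup ?K G")
proof (rule subgroupI)
  interpret normal M G by fact
  show "?K \<noteq> {}" using a by (auto intro!: exI[of _ \<one>] exI[of _ "0::int"])
  show "inv g \<in> ?K" if "g \<in> ?K" for g
  proof -
    obtain j :: int where g: "g \<in> carrier G" and j: "g \<otimes> inv (a [^] j) \<in> M" using \<open>g \<in> ?K\<close> by blast
    have "inv (a [^] j) \<otimes> inv (g \<otimes> inv (a [^] j)) \<otimes> (a [^] j) \<in> M"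
      using j a by (intro inv_op_closed1) auto
    also have "inv (a [^] j) \<otimes> inv (g \<otimes> inv (a [^] j)) \<otimes> (a [^] j) = inv g \<otimes> inv (a [^] (-j))"
      using g a by (simp add: inv_mult_group m_assoc[symmetric] int_pow_neg)
    finally show ?thesis using g by blast
  qed
  show "g \<otimes> h \<in> ?K" if "g \<in> ?K" "h \<in> ?K" for g h
  proof -
    obtain i :: int where g: "g \<in> carrier G" and i: "g \<otimes> inv (a [^] i) \<in> M"
      using \<open>g \<in> ?K\<close> by blast
    obtain j :: int where h: "h \<in> carrier G" and j: "h \<otimes> inv (a [^] j) \<in> M"
      using \<open>h \<in> ?K\<close> by blast
    have "(g \<otimes> inv (a [^] i)) \<otimes> (a [^] i \<otimes> (h \<otimes> inv (a [^] j)) \<otimes> inv (a [^] i)) \<in> M"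
      by (rule subgroup.m_closed[OF normal_imp_subgroup[OF M] i inv_op_closed2[OF _ j]]) (use a in simp)
    also have "(g \<otimes> inv (a [^] i)) \<otimes> (a [^] i \<otimes> (h \<otimes> inv (a [^] j)) \<otimes> inv (a [^] i)) =
        g \<otimes> h \<otimes> inv (a [^] i \<otimes> a [^] j)"
    proof -
      have "inv (a [^] i) \<otimes> (a [^] i \<otimes> y) = y" if "y \<in> carrier G" for y
        using that a by (simp add: m_assoc[symmetric])
      then show ?thesis using g h a by (simp add: m_assoc inv_mult_group)
    qed
    also have "a [^] i \<otimes> a [^] j = a [^] (i + j)" using a by (simp add: int_pow_mult)
    finally show ?thesis using g h by blast
  qed
qed auto

text \<open>A maximal subgroup \<open>M\<close> above \<open>H\<close> is normal because its
  normalizer is larger. An element \<open>b\<close> outside \<open>M\<close> then generates the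
  group modulo \<open>M\<close>, and the exponent of \<open>b\<close>, well defined modulo
  \<open>p\<close>, is the character.\<close>

lemma (in group) p_group_mod_character:
  assumes p: "prime (p::nat)" and order: "order G = p ^ k" and H: "subgroup H G" "H \<noteq> carrier G"
  shows "\<exists>\<theta>. mod_character G p \<theta> \<and> (\<forall>h\<in>H. int p dvd \<theta> h) \<and> (\<exists>a\<in>carrier G. \<not> int p dvd \<theta> a)"
proof -
  have "order G > 0" using order prime_gt_0_nat[OF p] by simp
  then have fin: "finite (carrier G)" unfolding order_gt_0_iff_finite .
  define \<M> where "\<M> = {K. subgroup K G \<and> H \<subseteq> K \<and> K \<noteq> carrier G}"
  have "\<M> \<subseteq> Pow (carrier G)" using subgroup.subset by (auto simp: \<M>_def)
  then have "finite \<M>" using fin finite_subset by blast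
  moreover have "H \<in> \<M>" using H by (simp add: \<M>_def)
  ultimately obtain M where M\<M>: "M \<in> \<M>" and max: "\<And>K. K \<in> \<M> \<Longrightarrow> M \<subseteq> K \<Longrightarrow> K = M"
    using finite_has_maximal[of \<M>] by (metis empty_iff)
  have M: "subgroup M G" "H \<subseteq> M" "M \<noteq> carrier G" using M\<M> by (auto simp: \<M>_def)
  have Msub: "M \<subseteq> carrier G" using M(1) by (rule subgroup.subset)
  have max': "K = M \<or> K = carrier G" if "subgroup K G" "M \<subseteq> K" for K
    using max[of K] that M by (auto simp: \<M>_def)
  obtain b where b: "b \<in> carrier G" "b \<notin> M" "\<And>m. m \<in> M \<Longrightarrow> b \<otimes> m \<otimes> inv b \<in> M"
    using p_group_normalizer_grows[OF p order M(1) M(3)] by blast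
  define N where "N = {g \<in> carrier G. (\<lambda>m. g \<otimes> m \<otimes> inv g) ` M = M}"
  have inj: "inj_on (\<lambda>m. g \<otimes> m \<otimes> inv g) M" if "g \<in> carrier G" for g
    using that Msub by (auto intro!: inj_onI simp: subset_iff)
  \<comment> \<open>\<open>M\<close> is finite, so a conjugation that maps \<open>M\<close> into
    itself maps it onto itself.\<close>
  have NI: "g \<in> N" if "g \<in> carrier G" "\<And>m. m \<in> M \<Longrightarrow> g \<otimes> m \<otimes> inv g \<in> M" for g
    using that endo_inj_surj[OF finite_subset[OF Msub fin] _ inj] unfolding N_def by blast
  have "subgroup N G"
  proof (rule subgroupI)
    show "N \<noteq> {}" using b NI by blast
    show "N \<subseteq> carrier G" by (auto simp: N_def)
    show "inv g \<in> N" if "g \<in> N" for g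
    proof (rule NI)
      show "inv g \<in> carrier G" using that by (simp add: N_def)
      fix m assume "m \<in> M"
      then have "m \<in> (\<lambda>m. g \<otimes> m \<otimes> inv g) ` M" using that by (simp add: N_def)
      then obtain m' where m': "m' \<in> M" "m = g \<otimes> m' \<otimes> inv g" by blast
      have "inv g \<otimes> m \<otimes> inv (inv g) = m'"
        using m' that Msub by (auto simp: N_def m_assoc[symmetric] subset_iff) (simp add: m_assoc)
      then show "inv g \<otimes> m \<otimes> inv (inv g) \<in> M" using m' by simp
    qed
    show "g \<otimes> h \<in> N" if "g \<in> N" "h \<in> N" for g h
    proof (rule NI)
      show "g \<otimes> h \<in> carrier G" using that by (simp add: N_def)
      fix m assume m: "m \<in> M"
      have "g \<otimes> (h \<otimes> m \<otimes> inv h) \<otimes> inv g \<in> M" using that m by (auto simp: N_def)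
      then show "g \<otimes> h \<otimes> m \<otimes> inv (g \<otimes> h) \<in> M"
        using that m Msub by (simp add: N_def m_assoc inv_mult_group subset_iff)
    qed
  qed
  moreover have "M \<subseteq> N"
  proof
    fix g assume g: "g \<in> M"
    show "g \<in> N"
      using g M(1) Msub by (intro NI) (auto simp: subgroup.m_closed subgroup.m_inv_closed)
  qed
  moreover have "b \<in> N" using b by (intro NI) auto
  ultimately have NG: "N = carrier G" using max' b(2) by blast
  have Mn: "M \<lhd> G" unfolding normal_inv_iff using M(1) NG by (auto simp: N_def)
  interpret normal M G by (rule Mn)
  define K where "K c = {g \<in> carrier G. \<exists>j::int. g \<otimes> inv ((b [^] c) [^] j) \<in> M}" for c :: int
  have K: "subgroup (K c) G" for c unfolding K_def by (rule normal_cyclic_extension[OF Mn]) (use b in auto)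
  have MK: "M \<subseteq> K c" for c
  proof
    fix m assume m: "m \<in> M"
    then have "m \<otimes> inv ((b [^] c) [^] (0::int)) \<in> M" using Msub by (simp add: subset_iff)
    then show "m \<in> K c" using m Msub unfolding K_def by blast
  qed
  \<comment> \<open>The exponents of the powers of \<open>b\<close> in \<open>M\<close> form an
    ideal of the integers that contains \<open>p ^ k\<close> but not 1; by Bezout none of them is
    prime to \<open>p\<close>.\<close>
  define D where "D = {j::int. b [^] j \<in> M}"
  have D_add: "i + j \<in> D" if "i \<in> D" "j \<in> D" for i j
  proof -
    have "b [^] i \<otimes> b [^] j \<in> M" using that M(1) by (simp add: D_def subgroup.m_closed)
    then show ?thesis using b(1) by (simp add: D_def int_pow_mult)
  qed
  have D_mult: "c * j \<in> D" if "j \<in> D" for c j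
  proof -
    have "(b [^] j) [^] c \<in> M" using that M(1) by (simp add: D_def subgroup_int_pow_closed)
    then show ?thesis using b by (simp add: D_def int_pow_pow mult.commute)
  qed
  have D1: "1 \<notin> D" using b by (simp add: D_def)
  have pkD: "int (p ^ k) \<in> D"
    using pow_order_eq_1[OF b(1)] order by (simp add: D_def int_pow_int del: of_nat_power)
  have copr: "\<not> (u \<in> D \<and> v \<in> D)" if "coprime u v" for u v
  proof
    assume uv: "u \<in> D \<and> v \<in> D"
    obtain r s where "r * u + s * v = 1" using \<open>coprime u v\<close> by (metis bezout_int coprime_iff_gcd_eq_1)
    then show False using D_add D_mult uv D1 by metis
  qed
  have cp: "coprime j (int (p ^ k))" if "\<not> int p dvd j" for j
    using prime_imp_coprime[of "int p" j] p that by (simp add: coprime_commute)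
  have Dp: "int p dvd j" if "j \<in> D" for j
    using copr cp pkD that by blast
  have pD: "int p \<in> D"
  proof (rule ccontr)
    assume neg: "int p \<notin> D"
    have "b [^] int p \<in> K (int p)" using b M(1) by (auto simp: K_def subgroup.one_closed intro!: exI[of _ "1::int"])
    then have "K (int p) \<noteq> M" using neg by (auto simp: D_def)
    then have "b \<in> K (int p)" using max'[OF K MK] b(1) by blast
    then obtain j :: int where "b \<otimes> inv ((b [^] int p) [^] j) \<in> M" by (auto simp: K_def)
    also have "b \<otimes> inv ((b [^] int p) [^] j) = b [^] (1 - int p * j)"
      using b(1) by (simp add: int_pow_pow int_pow_diff)
    finally have "1 - int p * j \<in> D" by (simp add: D_def)
    then have "int p dvd 1 - int p * j" by (rule Dp)
    then have "int p dvd 1" by (metis dvd_diff_left_iff dvd_triv_left)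
    then show False using p by (simp add: prime_nat_iff)
  qed
  have "b \<in> K 1" using b M(1) by (auto simp: K_def subgroup.one_closed intro!: exI[of _ "1::int"])
  then have K1: "K 1 = carrier G" using max'[OF K MK] b(2) by blast
  \<comment> \<open>A discrete logarithm to base \<open>b\<close> modulo \<open>M\<close>; by
    \<open>uniq\<close> any two choices differ by a multiple of \<open>p\<close>.\<close>
  define \<theta> where "\<theta> g = (SOME j::int. g \<otimes> inv (b [^] j) \<in> M)" for g
  have \<theta>: "g \<otimes> inv (b [^] \<theta> g) \<in> M" if "g \<in> carrier G" for g
  proof -
    have "\<exists>j::int. g \<otimes> inv (b [^] j) \<in> M" using that K1 b(1) by (auto simp: K_def)
    then show ?thesis unfolding \<theta>_def by (rule someI_ex)
  qed
  have uniq: "int p dvd i - j" if "g \<in> carrier G" "g \<otimes> inv (b [^] i) \<in> M" "g \<otimes> inv (b [^] j) \<in> M"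
    for g and i j :: int
  proof -
    have "inv (g \<otimes> inv (b [^] i)) \<otimes> (g \<otimes> inv (b [^] j)) \<in> M"
      using that M(1) by (simp add: subgroup.m_closed subgroup.m_inv_closed)
    also have "inv (g \<otimes> inv (b [^] i)) \<otimes> (g \<otimes> inv (b [^] j)) = b [^] (i - j)"
    proof -
      have "inv g \<otimes> (g \<otimes> y) = y" if "y \<in> carrier G" for y
        using that \<open>g \<in> carrier G\<close> by (simp add: m_assoc[symmetric])
      then show ?thesis using that b(1) by (simp add: inv_mult_group m_assoc int_pow_diff)
    qed
    finally show ?thesis using Dp by (simp add: D_def)
  qed
  have "mod_character G p \<theta>"
    unfolding mod_character_def
  proof (intro ballI)
    fix g h assume gh: "g \<in> carrier G" "h \<in> carrier G"
    have "(g \<otimes> inv (b [^] \<theta> g)) \<otimes> (b [^] \<theta> g \<otimes> (h \<otimes> inv (b [^] \<theta> h)) \<otimes> inv (b [^] \<theta> g)) \<in> M"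
      by (rule subgroup.m_closed[OF M(1) \<theta> inv_op_closed2[OF _ \<theta>]]) (use gh b(1) in simp_all)
    also have "(g \<otimes> inv (b [^] \<theta> g)) \<otimes> (b [^] \<theta> g \<otimes> (h \<otimes> inv (b [^] \<theta> h)) \<otimes> inv (b [^] \<theta> g)) =
        g \<otimes> h \<otimes> inv (b [^] \<theta> g \<otimes> b [^] \<theta> h)"
    proof -
      have "inv (b [^] \<theta> g) \<otimes> (b [^] \<theta> g \<otimes> y) = y" if "y \<in> carrier G" for y
        using that b(1) by (simp add: m_assoc[symmetric])
      then show ?thesis using gh b(1) by (simp add: m_assoc inv_mult_group)
    qed
    also have "b [^] \<theta> g \<otimes> b [^] \<theta> h = b [^] (\<theta> g + \<theta> h)" using b(1) by (simp add: int_pow_mult)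
    finally show "int p dvd \<theta> (g \<otimes> h) - (\<theta> g + \<theta> h)"
      using uniq[of "g \<otimes> h"] \<theta>[of "g \<otimes> h"] gh by simp
  qed
  moreover have "int p dvd \<theta> h" if "h \<in> H" for h
    using uniq[of h "\<theta> h" 0] \<theta>[of h] that M(2) Msub by (auto simp: subset_iff)
  moreover have "\<not> int p dvd \<theta> b"
  proof
    assume "int p dvd \<theta> b"
    moreover have "int p dvd 1 - \<theta> b" using uniq[of b 1 "\<theta> b"] \<theta>[OF b(1)] b(1) M(1) by (simp add: subgroup.one_closed)
    ultimately have "int p dvd 1" by (metis dvd_diff_left_iff)
    then show False using p by (simp add: prime_nat_iff)
  qed
  ultimately show ?thesis using b(1) by blast
qed

section \<open>Pro-\<open>p\<close> groups\<close>

context topological_group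
begin

lemma continuous_mult_maps:
  "continuous_map X T f \<Longrightarrow> continuous_map X T g \<Longrightarrow> continuous_map X T (\<lambda>c. f c \<otimes> g c)"
  using continuous_map_compose[OF continuous_map_pairedI continuous_mult] by (simp add: o_def)

lemma openin_carrier: "openin T U \<Longrightarrow> U \<subseteq> carrier G"
  using openin_subset topspace_eq by auto

lemma openin_l_coset:
  assumes "openin T U" "a \<in> carrier G" shows "openin T (a <# U)"
proof -
  have "continuous_map T T (\<lambda>b. inv a \<otimes> b)"
    using assms(2) by (intro continuous_mult_maps) (auto simp: topspace_eq)
  from openin_continuous_map_preimage[OF this assms(1)]
  have "openin T {b \<in> carrier G. inv a \<otimes> b \<in> U}" by (simp add: topspace_eq)
  also have "{b \<in> carrier G. inv a \<otimes> b \<in> U} = a <# U"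
  proof (intro equalityI subsetI)
    fix b assume "b \<in> {b \<in> carrier G. inv a \<otimes> b \<in> U}"
    then have "b = a \<otimes> (inv a \<otimes> b)" "inv a \<otimes> b \<in> U"
      using assms by (auto simp: m_assoc[symmetric])
    then show "b \<in> a <# U" unfolding l_coset_def by blast
  next
    fix b assume "b \<in> a <# U"
    then obtain u where u: "u \<in> U" "b = a \<otimes> u" by (auto simp: l_coset_def)
    moreover have "u \<in> carrier G" using u openin_carrier[OF assms(1)] by blast
    ultimately show "b \<in> {b \<in> carrier G. inv a \<otimes> b \<in> U}"
      using assms by (simp add: m_assoc[symmetric])
  qed
  finally show ?thesis .
qed

lemma openin_subgroup:
  assumes H: "subgroup H G" and U: "subgroup U G" "openin T U" "U \<subseteq> H"
  shows "openin T H"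
proof (subst openin_subopen, intro ballI)
  fix h assume h: "h \<in> H"
  then have hG: "h \<in> carrier G" using subgroup.subset[OF H] by blast
  have "h \<in> h <# U" using subgroup.one_closed[OF U(1)] hG by (force simp: l_coset_def)
  moreover have "h <# U \<subseteq> H" using h U(3) subgroup.m_closed[OF H] by (auto simp: l_coset_def)
  ultimately show "\<exists>W. openin T W \<and> h \<in> W \<and> W \<subseteq> H" using openin_l_coset[OF U(2) hG] by blast
qed

lemma closedin_open_subgroup:
  assumes H: "subgroup H G" "openin T H" shows "closedin T H"
proof -
  have "openin T (carrier G - H)"
  proof (subst openin_subopen, intro ballI)
    fix g assume g: "g \<in> carrier G - H"
    have "g \<in> g <# H" using subgroup.one_closed[OF H(1)] g by (force simp: l_coset_def)
    moreover have "g <# H \<subseteq> carrier G - H"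
    proof
      fix b assume "b \<in> g <# H"
      then obtain h where h: "h \<in> H" "b = g \<otimes> h" by (auto simp: l_coset_def)
      have hG: "h \<in> carrier G" using h(1) subgroup.subset[OF H(1)] by blast
      have "b \<notin> H"
      proof
        assume "b \<in> H"
        then have "b \<otimes> inv h \<in> H" using h H(1) by (simp add: subgroup.m_closed subgroup.m_inv_closed)
        then show False using g h hG by (simp add: m_assoc)
      qed
      then show "b \<in> carrier G - H" using g h hG by simp
    qed
    ultimately show "\<exists>W. openin T W \<and> g \<in> W \<and> W \<subseteq> carrier G - H" using openin_l_coset[OF H(2), of g] g by blast
  qed
  then show ?thesis using openin_carrier[OF H(2)] by (simp add: closedin_def topspace_eq)
qed

lemma subgroup_closure_of:
  assumes H: "subgroup H G" shows "subgroup (T closure_of H) G"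
proof (rule subgroupI)
  have HG: "H \<subseteq> carrier G" using H by (rule subgroup.subset)
  let ?C = "T closure_of H"
  have HC: "H \<subseteq> ?C" using HG closure_of_subset topspace_eq by metis
  have CG: "?C \<subseteq> carrier G" using closure_of_subset_topspace topspace_eq by metis
  show "?C \<subseteq> carrier G" by (rule CG)
  show "?C \<noteq> {}" using HC subgroup.one_closed[OF H] by blast
  have closed: "closedin T {a \<in> carrier G. f a \<in> ?C}" if "continuous_map T T f" for f
    using closedin_continuous_map_preimage[OF that closedin_closure_of, of H] by (simp add: topspace_eq)
  have "?C \<subseteq> {a \<in> carrier G. inv a \<in> ?C}"
    using HG HC subgroup.m_inv_closed[OF H]
    by (intro closure_of_minimal closed continuous_inv) auto
  then show "inv a \<in> ?C" if "a \<in> ?C" for a using that by blast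
  have "?C \<subseteq> {b \<in> carrier G. a \<otimes> b \<in> ?C}" if a: "a \<in> H" for a
    using HG HC subgroup.m_closed[OF H] a
    by (intro closure_of_minimal closed continuous_mult_maps) (auto simp: topspace_eq)
  then have 1: "a \<otimes> b \<in> ?C" if "a \<in> H" "b \<in> ?C" for a b using that by blast
  \<comment> \<open>The two factors are moved into the closure one after the other, each time by
    continuity of a translation.\<close>
  have "?C \<subseteq> {a \<in> carrier G. a \<otimes> b \<in> ?C}" if b: "b \<in> ?C" for b
    using HG 1 b CG by (intro closure_of_minimal closed continuous_mult_maps) (auto simp: topspace_eq)
  then show "a \<otimes> b \<in> ?C" if "a \<in> ?C" "b \<in> ?C" for a b using that by blast
qed

lemma topological_group_subgroup:
  assumes H: "subgroup H G"
  shows "topological_group (G\<lparr>carrier := H\<rparr>) (subtopology T H)"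
proof -
  have HG: "H \<subseteq> carrier G" using H by (rule subgroup.subset)
  interpret H: group "G\<lparr>carrier := H\<rparr>" using H by (rule subgroup_imp_group)
  show ?thesis
  proof unfold_locales
    show "topspace (subtopology T H) = carrier (G\<lparr>carrier := H\<rparr>)"
      using HG by (auto simp: topspace_eq)
    have "continuous_map (subtopology (prod_topology T T) (H \<times> H)) (subtopology T H) (\<lambda>(a, b). a \<otimes> b)"
      using continuous_map_from_subtopology[OF continuous_mult] subgroup.m_closed[OF H]
      by (intro continuous_map_into_subtopology) auto
    then show "continuous_map (prod_topology (subtopology T H) (subtopology T H)) (subtopology T H)
        (\<lambda>(a, b). a \<otimes>\<^bsub>G\<lparr>carrier := H\<rparr>\<^esub> b)"
      by (simp add: subtopology_Times)
    have "continuous_map (subtopology T H) (subtopology T H) (\<lambda>a. inv a)"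
      using continuous_map_from_subtopology[OF continuous_inv] subgroup.m_inv_closed[OF H]
      by (intro continuous_map_into_subtopology) auto
    then show "continuous_map (subtopology T H) (subtopology T H) (\<lambda>a. inv\<^bsub>G\<lparr>carrier := H\<rparr>\<^esub> a)"
      by (rule continuous_map_eq) (use HG in \<open>auto simp: m_inv_consistent[OF H]\<close>)
  qed
qed

end

context pro_p_group
begin

text \<open>By compactness \<open>H\<close> has finitely many cosets, so its normal core is an
  intersection of finitely many conjugates and therefore open.\<close>

lemma open_subgroup_contains_normal:
  assumes H: "subgroup H G" "openin T H"
  shows "\<exists>N. N \<lhd> G \<and> openin T N \<and> N \<subseteq> H"
proof -
  have HG: "H \<subseteq> carrier G" using H(1) by (rule subgroup.subset)
  have "topspace T \<subseteq> \<Union>((\<lambda>a. a <# H) ` carrier G)"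
  proof
    fix a assume "a \<in> topspace T"
    then have a: "a \<in> carrier G" by (simp add: topspace_eq)
    then have "a \<in> a <# H" using subgroup.one_closed[OF H(1)] by (force simp: l_coset_def)
    then show "a \<in> \<Union>((\<lambda>a. a <# H) ` carrier G)" using a by blast
  qed
  moreover have "\<forall>U\<in>(\<lambda>a. a <# H) ` carrier G. openin T U" using openin_l_coset[OF H(2)] by blast
  ultimately obtain \<F> where \<F>: "finite \<F>" "\<F> \<subseteq> (\<lambda>a. a <# H) ` carrier G" "topspace T \<subseteq> \<Union>\<F>"
    using compact unfolding compact_space_alt by metis
  obtain A where A: "A \<subseteq> carrier G" "finite A" "\<F> = (\<lambda>a. a <# H) ` A"
    using finite_subset_image[OF \<F>(1,2)] by blast
  define N where "N = {g \<in> carrier G. \<forall>a\<in>carrier G. inv a \<otimes> g \<otimes> a \<in> H}"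
  have N_alt: "N = carrier G \<inter> (\<Inter>a\<in>A. {g \<in> carrier G. inv a \<otimes> g \<otimes> a \<in> H})"
  proof (intro equalityI subsetI)
    fix g assume g: "g \<in> carrier G \<inter> (\<Inter>a\<in>A. {g \<in> carrier G. inv a \<otimes> g \<otimes> a \<in> H})"
    have "inv b \<otimes> g \<otimes> b \<in> H" if b: "b \<in> carrier G" for b
    proof -
      obtain a where a: "a \<in> A" "b \<in> a <# H" using \<F>(3) A(3) b topspace_eq by auto
      then obtain h where h: "h \<in> H" "b = a \<otimes> h" by (auto simp: l_coset_def)
      have G: "a \<in> carrier G" "h \<in> carrier G" "g \<in> carrier G" using a(1) h(1) A HG g by auto
      have "inv h \<otimes> (inv a \<otimes> g \<otimes> a) \<otimes> h \<in> H"
        using g a(1) h(1) H(1) by (simp add: subgroup.m_closed subgroup.m_inv_closed)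
      then show ?thesis using G h(2) by (simp add: inv_mult_group m_assoc)
    qed
    then show "g \<in> N" using g by (simp add: N_def)
  qed (use A in \<open>auto simp: N_def\<close>)
  have "openin T {g \<in> carrier G. inv a \<otimes> g \<otimes> a \<in> H}" if "a \<in> carrier G" for a
  proof -
    have "continuous_map T T (\<lambda>g. inv a \<otimes> g \<otimes> a)"
      using that by (intro continuous_mult_maps) (auto simp: topspace_eq)
    from openin_continuous_map_preimage[OF this H(2)] show ?thesis by (simp add: topspace_eq)
  qed
  then have "openin T N"
    unfolding N_alt using A openin_topspace[of T] by (auto simp: topspace_eq intro!: openin_Int_Inter)
  moreover have "N \<lhd> G"
    unfolding normal_inv_iff
  proof (intro conjI ballI subgroupI)
    have conj_mult: "inv a \<otimes> (g \<otimes> h) \<otimes> a = (inv a \<otimes> g \<otimes> a) \<otimes> (inv a \<otimes> h \<otimes> a)"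
      if "a \<in> carrier G" "g \<in> carrier G" "h \<in> carrier G" for a g h
    proof -
      have "a \<otimes> (inv a \<otimes> y) = y" if "y \<in> carrier G" for y
        using that \<open>a \<in> carrier G\<close> by (simp add: m_assoc[symmetric])
      then show ?thesis using that by (simp add: m_assoc)
    qed
    show "N \<subseteq> carrier G" by (auto simp: N_def)
    show "N \<noteq> {}" using subgroup.one_closed[OF H(1)] by (auto simp: N_def intro!: exI[of _ \<one>])
    show "inv g \<in> N" if "g \<in> N" for g
    proof -
      have "inv a \<otimes> inv g \<otimes> a \<in> H" if "a \<in> carrier G" for a
      proof -
        have "inv (inv a \<otimes> g \<otimes> a) \<in> H" using that \<open>g \<in> N\<close> H(1) by (simp add: N_def subgroup.m_inv_closed)
        then show ?thesis using that \<open>g \<in> N\<close> by (simp add: N_def inv_mult_group m_assoc)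
      qed
      then show ?thesis using that by (simp add: N_def)
    qed
    show "g \<otimes> h \<in> N" if "g \<in> N" "h \<in> N" for g h
      using that H(1) by (simp add: N_def conj_mult subgroup.m_closed)
    show "b \<otimes> g \<otimes> inv b \<in> N" if b: "b \<in> carrier G" and g: "g \<in> N" for b g
    proof -
      have "inv a \<otimes> (b \<otimes> g \<otimes> inv b) \<otimes> a \<in> H" if "a \<in> carrier G" for a
      proof -
        have "inv (inv b \<otimes> a) \<otimes> g \<otimes> (inv b \<otimes> a) \<in> H" using that b g by (simp add: N_def)
        then show ?thesis using that b g by (simp add: N_def inv_mult_group m_assoc)
      qed
      then show ?thesis using b g by (simp add: N_def)
    qed
  qed
  moreover have "N \<subseteq> H"
    using bspec[of "carrier G" _ \<one>] by (force simp: N_def)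
  ultimately show ?thesis by blast
qed

text \<open>The finite case is applied to the quotient by an open normal \<open>N\<close> inside
  \<open>H\<close>: as \<open>N\<close> lies in \<open>H\<close>, the image of \<open>H\<close> is
  still proper, and the character pulls back.\<close>

lemma open_subgroup_mod_character:
  assumes p: "prime p" and H: "subgroup H G" "openin T H" "H \<noteq> carrier G"
  shows "\<exists>\<theta>. mod_character G p \<theta> \<and> (\<forall>h\<in>H. int p dvd \<theta> h) \<and> (\<exists>a\<in>carrier G. \<not> int p dvd \<theta> a)"
proof -
  obtain N where N: "N \<lhd> G" "openin T N" "N \<subseteq> H" using open_subgroup_contains_normal[OF H(1,2)] by blast
  interpret N: normal N G by (rule N(1))
  interpret Q: group "G Mod N" by (rule N.factorgroup_is_group)
  interpret \<pi>: group_hom G "G Mod N" "\<lambda>a. N #> a"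
    by unfold_locales (rule N.r_coset_hom_Mod)
  obtain k where k: "card (rcosets N) = p ^ k" using open_normal_index[OF N(1,2)] by blast
  then have order: "order (G Mod N) = p ^ k" by (simp add: Coset.order_def FactGroup_def)
  let ?H = "(\<lambda>a. N #> a) ` H"
  have HG: "H \<subseteq> carrier G" using H(1) by (rule subgroup.subset)
  have "subgroup ?H (G Mod N)" using H(1) by (rule \<pi>.subgroup_img_is_subgroup)
  moreover have "?H \<noteq> carrier (G Mod N)"
  proof
    assume eq: "?H = carrier (G Mod N)"
    have "a \<in> H" if a: "a \<in> carrier G" for a
    proof -
      have "N #> a \<in> ?H" using a eq by (simp add: FactGroup_def rcosetsI N.subset)
      then obtain h where h: "h \<in> H" "N #> a = N #> h" by blast
      then have "a \<in> N #> h" using rcos_self[OF a N.is_subgroup] by simp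
      then obtain m where "m \<in> N" "a = m \<otimes> h" by (auto simp: r_coset_def)
      then show ?thesis using N(3) h(1) H(1) by (auto simp: subgroup.m_closed)
    qed
    then show False using HG H(3) by blast
  qed
  ultimately obtain \<theta> where \<theta>: "mod_character (G Mod N) p \<theta>" "\<forall>h\<in>?H. int p dvd \<theta> h"
    "\<exists>a\<in>carrier (G Mod N). \<not> int p dvd \<theta> a"
    using Q.p_group_mod_character[OF p order] by blast
  have "mod_character G p (\<lambda>a. \<theta> (N #> a))"
    unfolding mod_character_def
  proof (intro ballI)
    fix a b assume ab: "a \<in> carrier G" "b \<in> carrier G"
    show "int p dvd \<theta> (N #> a \<otimes> b) - (\<theta> (N #> a) + \<theta> (N #> b))"
      using mod_characterD[OF \<theta>(1) \<pi>.hom_closed[OF ab(1)] \<pi>.hom_closed[OF ab(2)]] \<pi>.hom_mult[OF ab] by simp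
  qed
  moreover have "\<exists>a\<in>carrier G. \<not> int p dvd \<theta> (N #> a)"
    using \<theta>(3) by (auto simp: FactGroup_def RCOSETS_def)
  ultimately show ?thesis using \<theta>(2) by (intro exI[of _ "\<lambda>a. \<theta> (N #> a)"]) auto
qed

text \<open>An open normal subgroup \<open>N\<close> of \<open>H\<close> contains
  \<open>H \<inter> K\<close> for some open normal \<open>K\<close> of \<open>G\<close>, so its
  index divides the order of the \<open>p\<close>-group \<open>G Mod K\<close>. This makes the
  closure of a generated subgroup available as a target of the universal property.\<close>

lemma pro_p_group_closed_subgroup:
  assumes p: "prime p" and H: "subgroup H G" "closedin T H"
  shows "pro_p_group (G\<lparr>carrier := H\<rparr>) (subtopology T H) p"
proof -
  let ?H = "G\<lparr>carrier := H\<rparr>" and ?S = "subtopology T H"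
  have HG: "H \<subseteq> carrier G" using H(1) by (rule subgroup.subset)
  interpret H: topological_group ?H ?S using H(1) by (rule topological_group_subgroup)
  have base: "\<exists>K. subgroup K G \<and> openin T K \<and> H \<inter> K \<subseteq> U" if U: "openin ?S U" "\<one> \<in> U" for U
  proof -
    obtain V where V: "openin T V" "U = V \<inter> H" using U(1) by (auto simp: openin_subtopology)
    then obtain K where "subgroup K G" "openin T K" "K \<subseteq> V" using open_subgroup_base[of V] U(2) by auto
    then show ?thesis using V by blast
  qed
  show ?thesis
  proof unfold_locales
    show "compact_space ?S" using closedin_compact_space[OF compact H(2)] by (simp add: compact_space_subtopology)
    show "Hausdorff_space ?S" using Hausdorff by (rule Hausdorff_space_subtopology)
  next
    fix U assume "openin ?S U" "\<one>\<^bsub>?H\<^esub> \<in> U"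
    then obtain K where K: "subgroup K G" "openin T K" "H \<inter> K \<subseteq> U" using base by auto
    have "subgroup (H \<inter> K) G" using H(1) K(1) by (rule subgroups_Inter_pair)
    then have "subgroup (H \<inter> K) ?H" using H(1) by (simp add: subgroup_incl)
    moreover have "openin ?S (H \<inter> K)" using K(2) by (auto simp: openin_subtopology)
    ultimately show "\<exists>K. subgroup K ?H \<and> openin ?S K \<and> K \<subseteq> U" using K(3) by blast
  next
    fix N assume N: "N \<lhd> ?H" "openin ?S N"
    have Ns: "subgroup N ?H" using N(1) by (rule normal_imp_subgroup)
    have NH: "N \<subseteq> H" using subgroup.subset[OF Ns] by simp
    obtain K0 where K0: "subgroup K0 G" "openin T K0" "H \<inter> K0 \<subseteq> N"
      using base[OF N(2)] subgroup.one_closed[OF Ns] by auto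
    obtain K where K: "K \<lhd> G" "openin T K" "K \<subseteq> K0" using open_subgroup_contains_normal[OF K0(1,2)] by blast
    interpret K: normal K G by (rule K(1))
    interpret Q: group "G Mod K" by (rule K.factorgroup_is_group)
    interpret \<pi>: group_hom G "G Mod K" "\<lambda>a. K #> a" by unfold_locales (rule K.r_coset_hom_Mod)
    obtain k where k: "card (rcosets K) = p ^ k" using open_normal_index[OF K(1,2)] by blast
    then have order: "order (G Mod K) = p ^ k" by (simp add: Coset.order_def FactGroup_def)
    let ?\<pi> = "\<lambda>a. K #> a"
    \<comment> \<open>Because \<open>H \<inter> K\<close> lies in \<open>N\<close>, the cosets of
      \<open>N\<close> in \<open>H\<close> can be counted in the quotient by
      \<open>K\<close>.\<close>
    have KH: "a \<in> N" if "a \<in> H" "b \<in> N" "K #> a = K #> b" for a b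
    proof -
      have G: "a \<in> carrier G" "b \<in> carrier G" using that HG NH by auto
      have "a \<in> K #> b" using rcos_self[OF G(1) K.is_subgroup] that(3) by simp
      then obtain c where c: "c \<in> K" "a = c \<otimes> b" by (auto simp: r_coset_def)
      then have "c = a \<otimes> inv b" using G K.subset by (auto simp: m_assoc subset_iff)
      then have "c \<in> H" using that NH H(1) by (auto simp: subgroup.m_closed subgroup.m_inv_closed)
      then have "c \<in> N" using c(1) K(3) K0(3) by blast
      then show ?thesis using c(2) that(2) subgroup.m_closed[OF Ns] by auto
    qed
    have "card (rcosets\<^bsub>?H\<^esub> N) * card (?\<pi> ` N) = card (?\<pi> ` H)"
    proof -
      let ?Q = "(G Mod K)\<lparr>carrier := ?\<pi> ` H\<rparr>"
      have sH: "subgroup (?\<pi> ` H) (G Mod K)" using H(1) by (rule \<pi>.subgroup_img_is_subgroup)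
      interpret QH: group ?Q using sH by (rule Q.subgroup_imp_group)
      have "subgroup N G" using Ns H(1) incl_subgroup by blast
      then have "subgroup (?\<pi> ` N) (G Mod K)" by (rule \<pi>.subgroup_img_is_subgroup)
      then have "subgroup (?\<pi> ` N) ?Q" using sH NH by (intro Q.subgroup_incl) auto
      then have "card (rcosets\<^bsub>?Q\<^esub> (?\<pi> ` N)) * card (?\<pi> ` N) = card (?\<pi> ` H)"
        using QH.lagrange by (simp add: Coset.order_def)
      moreover have "card (rcosets\<^bsub>?Q\<^esub> (?\<pi> ` N)) = card (rcosets\<^bsub>?H\<^esub> N)"
      proof -
        have coset: "?\<pi> ` (N #>\<^bsub>?H\<^esub> a) = ?\<pi> ` N #>\<^bsub>?Q\<^esub> ?\<pi> a" if "a \<in> H" for a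
        proof -
          have "?\<pi> ` (N #>\<^bsub>?H\<^esub> a) = (\<lambda>m. ?\<pi> (m \<otimes> a)) ` N" by (auto simp: r_coset_def)
          also have "\<dots> = (\<lambda>m. ?\<pi> m \<otimes>\<^bsub>G Mod K\<^esub> ?\<pi> a) ` N"
            using that NH HG by (intro image_cong refl \<pi>.hom_mult) auto
          also have "\<dots> = ?\<pi> ` N #>\<^bsub>?Q\<^esub> ?\<pi> a" by (auto simp: r_coset_def)
          finally show ?thesis .
        qed
        have "rcosets\<^bsub>?Q\<^esub> (?\<pi> ` N) = (\<lambda>a. ?\<pi> ` N #>\<^bsub>?Q\<^esub> ?\<pi> a) ` H"
          by (auto simp: RCOSETS_def)
        also have "\<dots> = image ?\<pi> ` (rcosets\<^bsub>?H\<^esub> N)"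
          using coset by (auto simp: RCOSETS_def)
        finally have "rcosets\<^bsub>?Q\<^esub> (?\<pi> ` N) = image ?\<pi> ` (rcosets\<^bsub>?H\<^esub> N)" .
        moreover have "inj_on (image ?\<pi>) (rcosets\<^bsub>?H\<^esub> N)"
        proof (rule inj_onI)
          fix C D assume CD: "C \<in> rcosets\<^bsub>?H\<^esub> N" "D \<in> rcosets\<^bsub>?H\<^esub> N" "?\<pi> ` C = ?\<pi> ` D"
          obtain c d where c: "c \<in> H" "C = N #>\<^bsub>?H\<^esub> c" and d: "d \<in> H" "D = N #>\<^bsub>?H\<^esub> d"
            using CD(1,2) by (auto simp: RCOSETS_def)
          have cC: "c \<in> C" using H.rcos_self[OF _ Ns, of c] c by simp
          then obtain e where e: "e \<in> D" "?\<pi> c = ?\<pi> e" using CD(3) by blast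
          obtain m where m: "m \<in> N" "e = m \<otimes> d" using e(1) d(2) by (auto simp: r_coset_def)
          have G: "c \<in> carrier G" "d \<in> carrier G" "m \<in> carrier G" using c d m NH HG by auto
          have "?\<pi> (c \<otimes> inv d) = ?\<pi> c \<otimes>\<^bsub>G Mod K\<^esub> ?\<pi> (inv d)" using G by (intro \<pi>.hom_mult) auto
          also have "\<dots> = ?\<pi> (m \<otimes> d \<otimes> inv d)" using G e(2) m(2) \<pi>.hom_mult[of "m \<otimes> d" "inv d"] by simp
          also have "m \<otimes> d \<otimes> inv d = m" using G by (simp add: m_assoc)
          finally have "c \<otimes> inv d \<in> N"
            using KH[of "c \<otimes> inv d" m] m(1) c(1) d(1) H(1) by (simp add: subgroup.m_closed subgroup.m_inv_closed)
          moreover have "c = (c \<otimes> inv d) \<otimes> d" using G by (simp add: m_assoc)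
          ultimately have "c \<in> D" using d(2) by (auto simp: r_coset_def)
          then show "C = D" using H.repr_independence[of c N d] c d Ns by simp
        qed
        ultimately show ?thesis by (simp add: card_image)
      qed
      ultimately show ?thesis by simp
    qed
    moreover have "card (?\<pi> ` H) dvd p ^ k"
      using Q.lagrange[OF \<pi>.subgroup_img_is_subgroup[OF H(1)]] order by (metis dvd_triv_right)
    ultimately have "card (rcosets\<^bsub>?H\<^esub> N) dvd p ^ k" by (metis dvd_mult_left)
    then show "\<exists>k. card (rcosets\<^bsub>?H\<^esub> N) = p ^ k" using p divides_primepow_nat by blast
  qed
qed

text \<open>For \<open>a\<close> outside \<open>H\<close>, closedness provides an open normal
  \<open>N\<close> such that \<open>a\<close> is also outside the open subgroup
  \<open>N <#> H\<close>, to which the open case applies. The subgroup \<open>U\<close> in the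
  conclusion records the continuity of \<open>\<theta>\<close>.\<close>

lemma proper_closed_subgroup_mod_character:
  assumes p: "prime p" and H: "subgroup H G" "closedin T H" "H \<noteq> carrier G"
  shows "\<exists>\<theta> U. mod_character G p \<theta> \<and> subgroup U G \<and> openin T U \<and> (\<forall>h\<in>U. int p dvd \<theta> h) \<and>
    (\<forall>h\<in>H. int p dvd \<theta> h) \<and> (\<exists>a\<in>carrier G. \<not> int p dvd \<theta> a)"
proof -
  have HG: "H \<subseteq> carrier G" using H(1) by (rule subgroup.subset)
  obtain a where a: "a \<in> carrier G" "a \<notin> H" using H(3) HG by blast
  define V where "V = {b \<in> carrier G. a \<otimes> b \<notin> H}"
  have "openin T (carrier G - H)" using H(2) by (simp add: closedin_def topspace_eq)
  moreover have "continuous_map T T (\<lambda>b. a \<otimes> b)"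
    using a by (intro continuous_mult_maps) (auto simp: topspace_eq)
  ultimately have "openin T {b \<in> carrier G. a \<otimes> b \<in> carrier G - H}"
    using openin_continuous_map_preimage by (fastforce simp: topspace_eq)
  moreover have "{b \<in> carrier G. a \<otimes> b \<in> carrier G - H} = V" using a by (auto simp: V_def)
  ultimately have "openin T V" by simp
  moreover have "\<one> \<in> V" using a by (simp add: V_def)
  ultimately obtain U where U: "subgroup U G" "openin T U" "U \<subseteq> V" using open_subgroup_base by blast
  obtain N where N: "N \<lhd> G" "openin T N" "N \<subseteq> U" using open_subgroup_contains_normal[OF U(1,2)] by blast
  interpret N: normal N G by (rule N(1))
  have NH: "subgroup (N <#> H) G" using N(1) H(1) by (rule mult_norm_subgroup)
  have sub: "N \<subseteq> N <#> H" "H \<subseteq> N <#> H"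
  proof -
    show "N \<subseteq> N <#> H"
    proof
      fix m assume m: "m \<in> N"
      then have "m = m \<otimes> \<one>" using N.subset by auto
      then show "m \<in> N <#> H" using m subgroup.one_closed[OF H(1)] unfolding set_mult_def by blast
    qed
    show "H \<subseteq> N <#> H"
    proof
      fix h assume h: "h \<in> H"
      then have "h = \<one> \<otimes> h" using HG by auto
      then show "h \<in> N <#> H" using h subgroup.one_closed[OF N.is_subgroup] unfolding set_mult_def by blast
    qed
  qed
  have op: "openin T (N <#> H)" using NH N.is_subgroup N(2) sub(1) by (rule openin_subgroup)
  have "a \<notin> N <#> H"
  proof
    assume "a \<in> N <#> H"
    then obtain m h where mh: "m \<in> N" "h \<in> H" "a = m \<otimes> h" by (auto simp: set_mult_def)
    have G: "m \<in> carrier G" "h \<in> carrier G" using mh N.subset HG by auto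
    \<comment> \<open>This conjugate of \<open>inv m\<close> lies in \<open>N\<close> and hence in
      \<open>V\<close>, yet \<open>a\<close> times it is \<open>h\<close>.\<close>
    have "inv a \<otimes> inv m \<otimes> a \<in> N" using mh(1) a(1) N.inv_op_closed1 by simp
    then have "a \<otimes> (inv a \<otimes> inv m \<otimes> a) \<notin> H" using N(3) U(3) by (auto simp: V_def)
    moreover have "a \<otimes> (inv a \<otimes> inv m \<otimes> a) = inv m \<otimes> a" using a G by (simp add: m_assoc[symmetric])
    moreover have "inv m \<otimes> a = h" using mh(3) G by (simp add: m_assoc[symmetric])
    ultimately show False using mh(2) by simp
  qed
  then have "N <#> H \<noteq> carrier G" using a(1) by blast
  then show ?thesis using open_subgroup_mod_character[OF p NH op] sub NH op by blast
qed

end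

lemma finite_pro_p_group:
  fixes G (structure)
  assumes "group G" and p: "prime p" and order: "order G = p ^ k"
  shows "pro_p_group G (discrete_topology (carrier G)) p"
proof -
  interpret group G by fact
  have "order G > 0" using order prime_gt_0_nat[OF p] by simp
  then have fin: "finite (carrier G)" unfolding order_gt_0_iff_finite .
  show ?thesis
  proof unfold_locales
    show "continuous_map (prod_topology (discrete_topology (carrier G)) (discrete_topology (carrier G)))
        (discrete_topology (carrier G)) (\<lambda>(a, b). a \<otimes> b)"
      by (auto simp flip: prod_topology_discrete_topology)
    show "\<exists>k. card (rcosets N) = p ^ k" if N: "N \<lhd> G" for N
      using lagrange[OF normal_imp_subgroup[OF N]] order p by (metis divides_primepow_nat dvd_triv_left)
    show "\<exists>H. subgroup H G \<and> openin (discrete_topology (carrier G)) H \<and> H \<subseteq> U" if "\<one> \<in> U" for U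
      using that triv_subgroup by (intro exI[of _ "{\<one>}"]) auto
  qed (auto simp: fin compact_space_discrete_topology)
qed

section \<open>The Magnus embedding\<close>

lemma dvd_iff_dvd: "(d::int) dvd a - b \<Longrightarrow> d dvd a \<longleftrightarrow> d dvd b"
  using dvd_add_right_iff[of d "a - b" b] by simp

text \<open>The representative of a series modulo \<open>filt p (Suc q)\<close>.\<close>

definition red :: "nat \<Rightarrow> nat \<Rightarrow> ncps \<Rightarrow> ncps" where
  "red p q a = NCPS (\<lambda>w. if length w \<le> q then cf a w mod int p else 0)"

lemma cf_red: "cf (red p q a) w = (if length w \<le> q then cf a w mod int p else 0)"
  by (simp add: red_def)

lemma red_eq_iff: "red p q a = red p q b \<longleftrightarrow> eqf p (Suc q) a b"
proof
  assume "red p q a = red p q b"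
  then have "cf (red p q a) w = cf (red p q b) w" for w by simp
  then have "cf a w mod int p = cf b w mod int p" if "length w \<le> q" for w
    using that unfolding cf_red by (metis (full_types))
  then show "eqf p (Suc q) a b"
    by (auto simp: eqf_def filt_def mod_eq_dvd_iff less_Suc_eq_le)
next
  assume "eqf p (Suc q) a b"
  then show "red p q a = red p q b"
    by (intro ncps_eqI) (auto simp: cf_red eqf_def filt_def mod_eq_dvd_iff less_Suc_eq_le)
qed

lemma red_red [simp]: "red p q (red p q a) = red p q a"
  by (rule ncps_eqI) (simp add: cf_red)

lemma eqf_red: "eqf p (Suc q) (red p q a) a"
  by (simp flip: red_eq_iff)

section \<open>The finite groups of truncated series\<close>

definition supp :: "nat \<Rightarrow> ncps set" where
  "supp n = {a. \<forall>w. \<not> set w \<subseteq> {1..n} \<longrightarrow> cf a w = 0}"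

lemma supp_one [simp]: "1 \<in> supp n" by (auto simp: supp_def)
lemma supp_letter: "j \<in> {1..n} \<Longrightarrow> letter j \<in> supp n" by (auto simp: supp_def)
lemma supp_add: "a \<in> supp n \<Longrightarrow> b \<in> supp n \<Longrightarrow> a + b \<in> supp n" by (auto simp: supp_def)
lemma supp_red: "a \<in> supp n \<Longrightarrow> red p q a \<in> supp n" by (auto simp: supp_def cf_red)
lemma supp_mult: "a \<in> supp n \<Longrightarrow> b \<in> supp n \<Longrightarrow> a * b \<in> supp n"
  unfolding supp_def
proof (intro CollectI allI impI)
  fix w assume a: "a \<in> {a. \<forall>w. \<not> set w \<subseteq> {1..n} \<longrightarrow> cf a w = 0}"
    and b: "b \<in> {a. \<forall>w. \<not> set w \<subseteq> {1..n} \<longrightarrow> cf a w = 0}" and w: "\<not> set w \<subseteq> {1..n}"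
  have "cf a (take i w) * cf b (drop i w) = 0" for i
  proof -
    have "set w = set (take i w) \<union> set (drop i w)" by (metis append_take_drop_id set_append)
    then have "\<not> set (take i w) \<subseteq> {1..n} \<or> \<not> set (drop i w) \<subseteq> {1..n}" using w by blast
    then show ?thesis using a b by auto
  qed
  then show "cf (a * b) w = 0" unfolding cf_mult by (intro sum.neutral) blast
qed
lemma supp_power: "a \<in> supp n \<Longrightarrow> a ^ k \<in> supp n"
  by (induction k) (auto intro: supp_mult)

text \<open>Series with constant term 1 over the field of \<open>p\<close> elements, truncated above
  length \<open>q\<close>. The carrier consists of reduced representatives, so equality in the group
  is equality of series; the restriction to the letters \<open>1..n\<close> makes it finite.\<close>

definition magnus_group :: "nat \<Rightarrow> nat \<Rightarrow> nat \<Rightarrow> ncps monoid" where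
  "magnus_group p n q = \<lparr>carrier = {a \<in> supp n. cf a [] = 1 \<and> red p q a = a},
     mult = (\<lambda>a b. red p q (a * b)), one = 1\<rparr>"

lemma magnus_group_simps [simp]:
  "a \<in> carrier (magnus_group p n q) \<longleftrightarrow> a \<in> supp n \<and> cf a [] = 1 \<and> red p q a = a"
  "a \<otimes>\<^bsub>magnus_group p n q\<^esub> b = red p q (a * b)"
  "\<one>\<^bsub>magnus_group p n q\<^esub> = 1"
  by (simp_all add: magnus_group_def)

lemma red_in_magnus_group:
  assumes "prime p" "a \<in> supp n" "cf a [] = 1" shows "red p q a \<in> carrier (magnus_group p n q)"
  using assms prime_gt_1_nat[of p] by (simp add: supp_red cf_red)

lemma group_magnus_group:
  assumes p: "prime p" shows "group (magnus_group p n q)"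
proof (rule groupI)
  have red1: "red p q 1 = 1"
    using prime_gt_1_nat[OF p] by (intro ncps_eqI) (simp add: cf_red)
  then show "\<one>\<^bsub>magnus_group p n q\<^esub> \<in> carrier (magnus_group p n q)" by simp
  fix a assume a: "a \<in> carrier (magnus_group p n q)"
  show "\<one>\<^bsub>magnus_group p n q\<^esub> \<otimes>\<^bsub>magnus_group p n q\<^esub> a = a" using a by simp
  show "\<exists>b\<in>carrier (magnus_group p n q). b \<otimes>\<^bsub>magnus_group p n q\<^esub> a = \<one>\<^bsub>magnus_group p n q\<^esub>"
  proof -
    \<comment> \<open>As \<open>p ^ s \<ge> 2 ^ s > q\<close>, Frobenius makes
      \<open>a ^ (p ^ s)\<close> equal to 1 up to words of length \<open>q\<close>, so a power of
      \<open>a\<close> is its inverse.\<close>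
    define s where "s = Suc q"
    have s: "Suc q \<le> p ^ s" "p ^ s > 0"
      using less_exp[of s] power_mono[of 2 p s] prime_ge_2_nat[OF p] prime_gt_0_nat[OF p]
      by (auto simp: s_def simp del: power_Suc)
    have "eqf p (Suc q) ((1 + (a - 1)) ^ (p ^ s)) (1 + (a - 1) ^ (p ^ s))" using p by (rule frobenius)
    also have "eqf p (Suc q) \<dots> (1 + 0)"
    proof (intro eqf_add eqf_refl)
      have "(a - 1) ^ (p ^ s) \<in> filt p (p ^ s)" using a by (intro filt_power) simp
      then show "eqf p (Suc q) ((a - 1) ^ (p ^ s)) 0" using s(1) filt_mono by (simp add: eqf_def)
    qed
    finally have "eqf p (Suc q) (a ^ (p ^ s)) 1" by simp
    moreover have "a ^ (p ^ s) = a ^ (p ^ s - 1) * a" using s(2) by (metis Suc_diff_1 power_Suc2)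
    ultimately have 1: "eqf p (Suc q) (a ^ (p ^ s - 1) * a) 1" by simp
    let ?b = "red p q (a ^ (p ^ s - 1))"
    have "cf (a ^ k) [] = 1" for k using a by (induction k) auto
    then have "?b \<in> carrier (magnus_group p n q)" using a by (intro red_in_magnus_group p supp_power) auto
    moreover have "red p q (?b * a) = red p q 1"
      unfolding red_eq_iff using eqf_trans[OF eqf_mult[OF eqf_red eqf_refl] 1] .
    ultimately show ?thesis using red1 by auto
  qed
  fix b assume b: "b \<in> carrier (magnus_group p n q)"
  show "a \<otimes>\<^bsub>magnus_group p n q\<^esub> b \<in> carrier (magnus_group p n q)"
    using a b red_in_magnus_group[OF p supp_mult, of a n b q] by simp
  fix c assume c: "c \<in> carrier (magnus_group p n q)"
  have "eqf p (Suc q) (red p q (a * b) * c) (a * b * c)" by (intro eqf_mult eqf_red eqf_refl)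
  also have "eqf p (Suc q) (a * b * c) (a * red p q (b * c))"
    unfolding mult.assoc by (intro eqf_mult eqf_sym[OF eqf_red] eqf_refl)
  finally show "a \<otimes>\<^bsub>magnus_group p n q\<^esub> b \<otimes>\<^bsub>magnus_group p n q\<^esub> c =
      a \<otimes>\<^bsub>magnus_group p n q\<^esub> (b \<otimes>\<^bsub>magnus_group p n q\<^esub> c)"
    by (simp add: red_eq_iff)
qed

lemma order_magnus_group:
  assumes p: "prime p" shows "\<exists>k. Coset.order (magnus_group p n q) = p ^ k"
proof -
  \<comment> \<open>The words whose coefficients are free residues modulo \<open>p\<close>; all
    other coefficients are fixed.\<close>
  define W where "W = {w :: nat list. set w \<subseteq> {1..n} \<and> length w \<le> q} - {[]}"
  have finW: "finite W" unfolding W_def by (intro finite_Diff finite_lists_length_le) simp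
  let ?C = "carrier (magnus_group p n q)"
  define f where "f a = restrict (cf a) W" for a
  define g where "g h = NCPS (\<lambda>w. if w = [] then 1 else if w \<in> W then h w else 0)" for h
  have carr: "a \<in> ?C \<longleftrightarrow> cf a [] = 1 \<and> (\<forall>w. cf a w \<in> {0..<int p}) \<and> (\<forall>w. w \<notin> W \<longrightarrow> w \<noteq> [] \<longrightarrow> cf a w = 0)" for a
  proof -
    have red: "red p q a = a \<longleftrightarrow> (\<forall>w. (if length w \<le> q then cf a w mod int p else 0) = cf a w)"
      unfolding cf_red[symmetric] by (metis ncps_eqI)
    have p0: "int p > 0" using prime_gt_0_nat[OF p] by simp
    show ?thesis
    proof (intro iffI conjI allI impI)
      assume a: "a \<in> ?C"
      then show "cf a [] = 1" by simp
      fix w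
      have *: "(if length w \<le> q then cf a w mod int p else 0) = cf a w" using a red by auto
      have "(if length w \<le> q then cf a w mod int p else 0) \<in> {0..<int p}" using p0 by auto
      then show "cf a w \<in> {0..<int p}" by (simp only: *)
      show "cf a w = 0" if "w \<notin> W" "w \<noteq> []"
        using that a * by (auto simp: W_def supp_def split: if_splits)
    next
      assume a: "cf a [] = 1 \<and> (\<forall>w. cf a w \<in> {0..<int p}) \<and> (\<forall>w. w \<notin> W \<longrightarrow> w \<noteq> [] \<longrightarrow> cf a w = 0)"
      have "(if length w \<le> q then cf a w mod int p else 0) = cf a w" for w
      proof (cases "length w \<le> q")
        case True
        have "0 \<le> cf a w" "cf a w < int p" using a by auto
        then show ?thesis using True by simp
      next
        case False
        then have "w \<notin> W" "w \<noteq> []" by (auto simp: W_def)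
        then show ?thesis using a False by simp
      qed
      moreover have "cf a w = 0" if "\<not> set w \<subseteq> {1..n}" for w
      proof -
        have "w \<notin> W" "w \<noteq> []" using that by (auto simp: W_def)
        then show ?thesis using a by simp
      qed
      ultimately show "a \<in> ?C" using a red by (simp add: supp_def)
    qed
  qed
  have "bij_betw f ?C (W \<rightarrow>\<^sub>E {0..<int p})"
  proof (rule bij_betw_byWitness[where f' = g])
    show "\<forall>a\<in>?C. g (f a) = a"
    proof (intro ballI ncps_eqI)
      fix a w assume "a \<in> ?C"
      then have "cf a [] = 1" "w \<notin> W \<longrightarrow> w \<noteq> [] \<longrightarrow> cf a w = 0" using carr by blast+
      then show "cf (g (f a)) w = cf a w" by (simp add: f_def g_def)
    qed
    show "\<forall>h\<in>W \<rightarrow>\<^sub>E {0..<int p}. f (g h) = h"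
      by (auto simp: f_def g_def W_def fun_eq_iff PiE_def extensional_def)
    show "f ` ?C \<subseteq> W \<rightarrow>\<^sub>E {0..<int p}" 
    proof
      fix h assume "h \<in> f ` ?C"
      then obtain a where a: "a \<in> ?C" "h = f a" by blast
      have "cf a w \<in> {0..<int p}" for w using a(1) unfolding carr by blast
      then show "h \<in> W \<rightarrow>\<^sub>E {0..<int p}" unfolding a(2) f_def by (intro restrict_PiE_iff[THEN iffD2]) blast
    qed
    show "g ` (W \<rightarrow>\<^sub>E {0..<int p}) \<subseteq> ?C"
    proof
      fix a assume "a \<in> g ` (W \<rightarrow>\<^sub>E {0..<int p})"
      then obtain h where h: "h \<in> W \<rightarrow>\<^sub>E {0..<int p}" "a = g h" by blast
      have "h w \<in> {0..<int p}" if "w \<in> W" for w using h(1) that by (rule PiE_mem)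
      then show "a \<in> ?C" unfolding carr using h(2) prime_gt_1_nat[OF p] by (auto simp: g_def)
    qed
  qed
  then have "card ?C = card (W \<rightarrow>\<^sub>E {0..<int p})" by (rule bij_betw_same_card)
  then have "Coset.order (magnus_group p n q) = p ^ card W"
    using finW by (simp add: Coset.order_def card_PiE)
  then show ?thesis by blast
qed

text \<open>In \<open>free_pro_p_group.universal\<close> the type of the test group is tied to the record
  extension of \<open>F\<close>; the following version has no such restriction.\<close>

lemma (in free_pro_p_group) exists_continuous_hom_generated:
  fixes G :: "('c, 'd) monoid_scheme"
  assumes G: "pro_p_group G S p" and gen: "topologically_generates G S (y ` {1..n})"
  shows "\<exists>f\<in>continuous_hom F T G S. \<forall>i\<in>{1..n}. f (x i) = y i"
proof -
  interpret G: pro_p_group G S p by fact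
  let ?Y = "generate G (y ` {1..n})"
  have yG: "y ` {1..n} \<subseteq> carrier G" and cl: "S closure_of ?Y = topspace S"
    using gen by (auto simp: topologically_generates_def G.topspace_eq)
  have "countable ?Y" by (intro countable_generate countable_finite) simp
  from separable_Hausdorff_inj[OF G.Hausdorff this cl]
  obtain h :: "'c \<Rightarrow> nat set set" where "inj_on h (carrier G)" unfolding G.topspace_eq by blast
  from topological_group_transport[OF G.topological_group_axioms this]
  obtain H :: "nat set set monoid" and R where H: "group H" "topspace R = carrier H"
      and iso: "h \<in> iso G H" and homeo: "homeomorphic_map S R h" by blast
  interpret h: group_hom G H h
    using iso H(1) G.is_group by (simp add: group_hom_def group_hom_axioms_def iso_def)
  have "generate H ((h \<circ> y) ` {1..n}) = h ` ?Y"
    using h.generate_img[OF yG] by (simp add: image_comp)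
  moreover have "R closure_of (h ` ?Y) = h ` (S closure_of ?Y)"
    using G.generate_incl[OF yG] by (intro homeomorphic_map_closure_of[OF homeo]) (simp add: G.topspace_eq)
  ultimately have "topologically_generates H R ((h \<circ> y) ` {1..n})"
    using cl homeomorphic_imp_surjective_map[OF homeo] H(2) yG
    by (auto simp: topologically_generates_def)
  from universal_nat_set_set[OF pro_p_group_iso[OF G H(1) iso homeo H(2)] this]
  obtain f where f: "f \<in> continuous_hom F T H R" "\<forall>i\<in>{1..n}. f (x i) = h (y i)" by auto
  define k where "k = inv_into (carrier G) h"
  have k: "k \<in> hom H G" using G.iso_set_sym[OF iso] by (simp add: k_def iso_def)
  have kh: "k (h a) = a" if "a \<in> carrier G" for a
    using iso that by (simp add: k_def iso_def bij_betw_def)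
  obtain g where g: "homeomorphic_maps S R h g" using homeo homeomorphic_map_maps by blast
  have "g b = k b" if "b \<in> topspace R" for b
  proof -
    have "h (g b) = b" "g b \<in> carrier G"
      using g that by (auto simp: homeomorphic_maps_def continuous_map_def G.topspace_eq)
    then show ?thesis using kh by metis
  qed
  then have "continuous_map R S k"
    using g by (auto simp: homeomorphic_maps_def intro: continuous_map_eq)
  then have "k \<circ> f \<in> continuous_hom F T G S"
    using f(1) k Group.hom_compose continuous_map_compose by (auto simp: continuous_hom_def)
  moreover have "\<forall>i\<in>{1..n}. (k \<circ> f) (x i) = y i" using f(2) kh yG by auto
  ultimately show ?thesis by blast
qed

section \<open>Consequences of the universal property\<close>

locale prime_free_pro_p_group = free_pro_p_group +
  assumes p: "prime p"
begin

lemma x_carrier: "i \<in> {1..n} \<Longrightarrow> x i \<in> carrier F"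
  using generators by (auto simp: topologically_generates_def)

lemma closed_subgroup_eq_carrier:
  assumes "subgroup K F" "closedin T K" "\<And>i. i \<in> {1..n} \<Longrightarrow> x i \<in> K"
  shows "K = carrier F"
proof -
  have "generate F (x ` {1..n}) \<subseteq> K"
    using assms by (intro generate_subgroup_incl) auto
  then have "T closure_of (generate F (x ` {1..n})) \<subseteq> K" using assms(2) by (rule closure_of_minimal)
  then show ?thesis
    using generators subgroup.subset[OF assms(1)] by (auto simp: topologically_generates_def)
qed

text \<open>The form in which topological generation is mostly used: a property that defines a
  subgroup holds everywhere once it holds for the generators and on some open subgroup.\<close>

lemma open_subgroup_eq_carrier:
  assumes "subgroup K F" "subgroup U F" "openin T U" "U \<subseteq> K" "\<And>i. i \<in> {1..n} \<Longrightarrow> x i \<in> K"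
  shows "K = carrier F"
  using closed_subgroup_eq_carrier[OF assms(1) closedin_open_subgroup[OF assms(1) openin_subgroup[OF assms(1-4)]] assms(5)] .

lemma continuous_homs_agree:
  assumes f: "f \<in> continuous_hom F T G S" and g: "g \<in> continuous_hom F T G S"
    and G: "group G" "Hausdorff_space S" and eq: "\<And>i. i \<in> {1..n} \<Longrightarrow> f (x i) = g (x i)"
    and h: "h \<in> carrier F"
  shows "f h = g h"
proof -
  interpret G: group G by fact
  interpret f: group_hom F G f using f by unfold_locales (simp add: continuous_hom_def)
  interpret g: group_hom F G g using g by unfold_locales (simp add: continuous_hom_def)
  have "{h \<in> carrier F. f h = g h} = carrier F"
  proof (rule closed_subgroup_eq_carrier)
    show "subgroup {h \<in> carrier F. f h = g h} F"
      by (rule subgroupI) (auto intro!: exI[of _ \<one>])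
    show "closedin T {h \<in> carrier F. f h = g h}"
      using closedin_continuous_maps_eq[OF G(2), of T f g] f g by (simp add: continuous_hom_def topspace_eq)
  qed (use eq x_carrier in auto)
  then show ?thesis using h by blast
qed

text \<open>The universal property demands that the images generate the target. Replacing
  \<open>G\<close> by the closure of the subgroup they generate removes this condition.\<close>

lemma exists_continuous_hom:
  fixes G :: "('c, 'd) monoid_scheme"
  assumes G: "pro_p_group G S p" and y: "\<And>i. i \<in> {1..n} \<Longrightarrow> y i \<in> carrier G"
  shows "\<exists>f\<in>continuous_hom F T G S. \<forall>i\<in>{1..n}. f (x i) = y i"
proof -
  interpret G: pro_p_group G S p by fact
  let ?H = "S closure_of (generate G (y ` {1..n}))"
  have yG: "y ` {1..n} \<subseteq> carrier G" using y by blast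
  have gen: "subgroup (generate G (y ` {1..n})) G" using yG by (rule G.generate_is_subgroup)
  have H: "subgroup ?H G" using gen by (rule G.subgroup_closure_of)
  have HG: "?H \<subseteq> carrier G" using H by (rule subgroup.subset)
  have gH: "generate G (y ` {1..n}) \<subseteq> ?H"
    using subgroup.subset[OF gen] by (intro closure_of_subset) (simp add: G.topspace_eq)
  have yH: "y ` {1..n} \<subseteq> ?H" using gH generate.incl[of _ "y ` {1..n}" G] by blast
  have pro_p: "pro_p_group (G\<lparr>carrier := ?H\<rparr>) (subtopology S ?H) p"
    using p H by (rule G.pro_p_group_closed_subgroup) (rule closedin_closure_of)
  have "topologically_generates (G\<lparr>carrier := ?H\<rparr>) (subtopology S ?H) (y ` {1..n})"
  proof -
    have "generate (G\<lparr>carrier := ?H\<rparr>) (y ` {1..n}) = generate G (y ` {1..n})"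
      using yH H by (rule G.generate_consistent)
    moreover have "subtopology S ?H closure_of generate G (y ` {1..n}) = ?H"
      using gH by (simp add: closure_of_subtopology Int_absorb1)
    ultimately show ?thesis using yH by (simp add: topologically_generates_def)
  qed
  from exists_continuous_hom_generated[OF pro_p this]
  obtain f where f: "f \<in> continuous_hom F T (G\<lparr>carrier := ?H\<rparr>) (subtopology S ?H)"
    "\<forall>i\<in>{1..n}. f (x i) = y i"
    by blast
  have "f \<in> continuous_hom F T G S"
    using f(1) HG by (auto simp: continuous_hom_def hom_def continuous_map_in_subtopology Pi_iff)
  then show ?thesis using f(2) by blast
qed

text \<open>The truncation at \<open>q\<close> makes the target a finite \<open>p\<close>-group, to
  which the universal property applies with the discrete topology.\<close>

definition magnus_map :: "nat \<Rightarrow> 'a \<Rightarrow> ncps" where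
  "magnus_map q = (SOME f. f \<in> continuous_hom F T (magnus_group p n q)
      (discrete_topology (carrier (magnus_group p n q))) \<and>
    (\<forall>i\<in>{1..n}. f (x i) = red p q (1 + letter i)))"

lemma magnus_map:
  "magnus_map q \<in> continuous_hom F T (magnus_group p n q)
      (discrete_topology (carrier (magnus_group p n q)))"
  "i \<in> {1..n} \<Longrightarrow> magnus_map q (x i) = red p q (1 + letter i)"
proof -
  obtain k where k: "Coset.order (magnus_group p n q) = p ^ k" using order_magnus_group[OF p] by blast
  have "\<exists>f. f \<in> continuous_hom F T (magnus_group p n q)
      (discrete_topology (carrier (magnus_group p n q))) \<and>
    (\<forall>i\<in>{1..n}. f (x i) = red p q (1 + letter i))"
  proof -
    have "red p q (1 + letter i) \<in> carrier (magnus_group p n q)" if "i \<in> {1..n}" for i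
      by (rule red_in_magnus_group[OF p]) (use that in \<open>auto intro!: supp_add supp_letter\<close>)
    then show ?thesis
      using exists_continuous_hom[OF finite_pro_p_group[OF group_magnus_group[OF p] p k],
          of "\<lambda>i. red p q (1 + letter i)"] by blast
  qed
  from someI_ex[OF this, folded magnus_map_def]
  show "magnus_map q \<in> continuous_hom F T (magnus_group p n q)
      (discrete_topology (carrier (magnus_group p n q)))"
    "i \<in> {1..n} \<Longrightarrow> magnus_map q (x i) = red p q (1 + letter i)" by auto
qed

sublocale magnus: group "magnus_group p n q" for q
  by (rule group_magnus_group[OF p])

sublocale magnus_hom: group_hom F "magnus_group p n q" "magnus_map q" for q
  using magnus_map(1) by unfold_locales (simp add: continuous_hom_def)

lemma magnus_Nil: "h \<in> carrier F \<Longrightarrow> cf (magnus_map q h) [] = 1"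
  using magnus_hom.hom_closed[of h q] by simp

lemma magnus_mult:
  "g \<in> carrier F \<Longrightarrow> h \<in> carrier F \<Longrightarrow>
    eqf p (Suc q) (magnus_map q (g \<otimes> h)) (magnus_map q g * magnus_map q h)"
  using magnus_hom.hom_mult[of g h q] eqf_red[of p q] by simp

lemma magnus_one: "magnus_map q \<one> = 1"
  using magnus_hom.hom_one[of q] by simp

lemma magnus_generator:
  "i \<in> {1..n} \<Longrightarrow> eqf p (Suc q) (magnus_map q (x i)) (1 + letter i)"
  using magnus_map(2)[of i q] eqf_red[of p q] by simp

lemma magnus_pow:
  "h \<in> carrier F \<Longrightarrow> eqf p (Suc q) (magnus_map q (h [^] k)) (magnus_map q h ^ k)"
proof (induction k)
  case (Suc k)
  have "eqf p (Suc q) (magnus_map q (h [^] k \<otimes> h)) (magnus_map q (h [^] k) * magnus_map q h)"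
    using Suc by (intro magnus_mult) auto
  also have "eqf p (Suc q) \<dots> (magnus_map q h ^ k * magnus_map q h)"
    using Suc by (intro eqf_mult eqf_refl) auto
  finally show ?case by (simp add: power_Suc2 del: power_Suc)
qed (simp add: magnus_one)

definition magnus_kernel :: "nat \<Rightarrow> 'a set" where
  "magnus_kernel q = {h \<in> carrier F. magnus_map q h = 1}"

lemma magnus_kernel: "subgroup (magnus_kernel q) F" "openin T (magnus_kernel q)"
proof -
  have "kernel F (magnus_group p n q) (magnus_map q) = magnus_kernel q"
    by (simp add: kernel_def magnus_kernel_def)
  then show "subgroup (magnus_kernel q) F" using magnus_hom.subgroup_kernel[of q] by simp
  have "openin T {h \<in> topspace T. magnus_map q h \<in> {1}}"
    using magnus_map(1)[of q] magnus.one_closed[of q]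
    by (intro openin_continuous_map_preimage[where Y = "discrete_topology (carrier (magnus_group p n q))"])
      (auto simp: continuous_hom_def)
  then show "openin T (magnus_kernel q)" by (simp add: magnus_kernel_def topspace_eq)
qed

lemma finite_range_magnus: "finite (magnus_map q ` carrier F)"
proof -
  obtain k where "Coset.order (magnus_group p n q) = p ^ k" using order_magnus_group[OF p] by blast
  then have "Coset.order (magnus_group p n q) > 0" using prime_gt_0_nat[OF p] by simp
  then have "finite (carrier (magnus_group p n q))" unfolding magnus.order_gt_0_iff_finite .
  moreover have "magnus_map q ` carrier F \<subseteq> carrier (magnus_group p n q)"
    using magnus_hom.hom_closed by blast
  ultimately show ?thesis by (rule finite_subset[rotated])
qed

text \<open>Modulo \<open>p\<close>, the exponent sum of \<open>x i\<close> in \<open>h\<close>.\<close>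

definition lin :: "nat \<Rightarrow> 'a \<Rightarrow> int" where "lin i h = cf (magnus_map 1 h) [i]"

lemma mod_character_magnus:
  assumes "0 < q" shows "mod_character F p (\<lambda>h. cf (magnus_map q h) [i])"
  unfolding mod_character_def
proof (intro ballI)
  fix g h assume gh: "g \<in> carrier F" "h \<in> carrier F"
  have "magnus_map q (g \<otimes> h) - magnus_map q g * magnus_map q h \<in> filt p (Suc q)"
    using magnus_mult[OF gh] by (simp add: eqf_def)
  from filtD[OF this, of "[i]"] assms gh
  show "int p dvd cf (magnus_map q (g \<otimes> h)) [i] - (cf (magnus_map q g) [i] + cf (magnus_map q h) [i])"
    by (simp add: cf_mult magnus_Nil algebra_simps)
qed

lemma mod_character_lin: "mod_character F p (lin i)"
  using mod_character_magnus[of 1 i] by (simp add: lin_def[abs_def])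

lemma magnus_generator_coeff:
  "0 < q \<Longrightarrow> j \<in> {1..n} \<Longrightarrow> int p dvd cf (magnus_map q (x j)) [i] - of_bool (i = j)"
  using magnus_generator[of j q] filtD[of "magnus_map q (x j) - (1 + letter j)" p "Suc q" "[i]"]
  by (auto simp: eqf_def)

lemma lin_generator: "j \<in> {1..n} \<Longrightarrow> int p dvd lin i (x j) - of_bool (i = j)"
  using magnus_generator_coeff[of 1 j i] by (simp add: lin_def)

text \<open>The \<open>lin i\<close> are dual to the generators, so both sides agree there;
  \<open>U\<close> expresses the continuity of \<open>\<theta>\<close>. Thus the
  \<open>lin i\<close> span the continuous characters modulo \<open>p\<close>.\<close>

lemma mod_character_eq_lin:
  assumes \<theta>: "mod_character F p \<theta>" and U: "subgroup U F" "openin T U" "\<And>h. h \<in> U \<Longrightarrow> int p dvd \<theta> h"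
    and h: "h \<in> carrier F"
  shows "int p dvd \<theta> h - (\<Sum>i=1..n. \<theta> (x i) * lin i h)"
proof -
  define D where "D h = \<theta> h - (\<Sum>i=1..n. \<theta> (x i) * lin i h)" for h
  have D: "mod_character F p D"
    unfolding mod_character_def
  proof (intro ballI)
    fix a b assume ab: "a \<in> carrier F" "b \<in> carrier F"
    have "int p dvd (\<theta> (a \<otimes> b) - (\<theta> a + \<theta> b)) -
        (\<Sum>i=1..n. \<theta> (x i) * (lin i (a \<otimes> b) - (lin i a + lin i b)))"
      by (intro dvd_diff dvd_sum dvd_mult mod_characterD[OF \<theta> ab] mod_characterD[OF mod_character_lin ab])
    then show "int p dvd D (a \<otimes> b) - (D a + D b)"
      by (simp add: D_def algebra_simps sum.distrib sum_subtractf)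
  qed
  have "{h \<in> carrier F. int p dvd D h} = carrier F"
  proof (rule open_subgroup_eq_carrier)
    show "subgroup {h \<in> carrier F. int p dvd D h} F" using D by (rule subgroup_mod_character)
    show "subgroup (U \<inter> magnus_kernel 1) F" using U(1) magnus_kernel(1) by (rule subgroups_Inter_pair)
    show "openin T (U \<inter> magnus_kernel 1)" using U(2) magnus_kernel(2) by (rule openin_Int)
    show "U \<inter> magnus_kernel 1 \<subseteq> {h \<in> carrier F. int p dvd D h}"
      using U(3) by (auto simp: D_def lin_def magnus_kernel_def)
    fix j assume j: "j \<in> {1..n}"
    have "int p dvd (\<Sum>i=1..n. \<theta> (x i) * (lin i (x j) - of_bool (i = j)))"
      using lin_generator[OF j] by (intro dvd_sum dvd_mult)
    moreover have "(\<Sum>i=1..n. \<theta> (x i) * (lin i (x j) - of_bool (i = j))) =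
        (\<Sum>i=1..n. \<theta> (x i) * lin i (x j)) - (\<Sum>i=1..n. if i = j then \<theta> (x i) else 0)"
      unfolding sum_subtractf[symmetric] by (intro sum.cong) (auto simp: algebra_simps)
    ultimately have "int p dvd (\<Sum>i=1..n. \<theta> (x i) * lin i (x j)) - \<theta> (x j)" using j by simp
    then show "x j \<in> {h \<in> carrier F. int p dvd D h}"
      using x_carrier[OF j] by (simp add: D_def dvd_diff_commute)
  qed
  then show ?thesis using h by (auto simp: D_def)
qed

text \<open>The coefficient at level \<open>q\<close> is a character with the same values on the
  generators as \<open>lin i\<close>, which is read off at level 1.\<close>

lemma magnus_coeff_eq_lin:
  assumes "0 < q" "h \<in> carrier F" "i \<in> {1..n}"
  shows "int p dvd cf (magnus_map q h) [i] - lin i h"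
proof -
  have 1: "int p dvd cf (magnus_map q h) [i] - (\<Sum>j=1..n. cf (magnus_map q (x j)) [i] * lin j h)"
    by (rule mod_character_eq_lin[OF mod_character_magnus[OF assms(1)] magnus_kernel[of q]])
      (use assms in \<open>auto simp: magnus_kernel_def\<close>)
  have 2: "int p dvd (\<Sum>j=1..n. (cf (magnus_map q (x j)) [i] - of_bool (i = j)) * lin j h)"
    using assms by (intro dvd_sum dvd_mult2 magnus_generator_coeff)
  have 3: "(\<Sum>j=1..n. (cf (magnus_map q (x j)) [i] - of_bool (i = j)) * lin j h) =
      (\<Sum>j=1..n. cf (magnus_map q (x j)) [i] * lin j h) - lin i h"
  proof -
    have "(\<Sum>j=1..n. of_bool (i = j) * lin j h) = (\<Sum>j=1..n. if j = i then lin j h else 0)"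
      by (intro sum.cong) auto
    then show ?thesis using assms(3) by (simp add: left_diff_distrib sum_subtractf)
  qed
  show ?thesis using dvd_add[OF 1 2[unfolded 3]] by simp
qed

text \<open>The hypothesis says that the matrix of the \<open>lin i (y j)\<close> is invertible modulo \<open>p\<close>.\<close>

lemma topologically_generatesI:
  assumes y: "\<And>j. j \<in> {1..n} \<Longrightarrow> y j \<in> carrier F"
    and indep: "\<And>c i. (\<And>j. j \<in> {1..n} \<Longrightarrow> int p dvd (\<Sum>i=1..n. c i * lin i (y j))) \<Longrightarrow>
      i \<in> {1..n} \<Longrightarrow> int p dvd c i"
  shows "topologically_generates F T (y ` {1..n})"
proof (rule ccontr)
  assume neg: "\<not> ?thesis"
  have yF: "y ` {1..n} \<subseteq> carrier F" using y by blast
  let ?H = "T closure_of (generate F (y ` {1..n}))"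
  have gen: "subgroup (generate F (y ` {1..n})) F" using yF by (rule generate_is_subgroup)
  have H: "subgroup ?H F" using gen by (rule subgroup_closure_of)
  have "generate F (y ` {1..n}) \<subseteq> ?H"
    using subgroup.subset[OF gen] by (intro closure_of_subset) (simp add: topspace_eq)
  then have yH: "y j \<in> ?H" if "j \<in> {1..n}" for j
    using generate.incl[of "y j" "y ` {1..n}" F] that by blast
  have "?H \<noteq> carrier F" using neg yF by (simp add: topologically_generates_def)
  \<comment> \<open>A proper closure is killed by a nonzero character. Its coefficients
    \<open>\<theta> (x i)\<close> annihilate the matrix of the \<open>lin i (y j)\<close>, hence
    vanish modulo \<open>p\<close>.\<close>
  from proper_closed_subgroup_mod_character[OF p H closedin_closure_of this]
  obtain \<theta> U where \<theta>: "mod_character F p \<theta>" "subgroup U F" "openin T U" "\<And>h. h \<in> U \<Longrightarrow> int p dvd \<theta> h"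
    "\<And>h. h \<in> ?H \<Longrightarrow> int p dvd \<theta> h" "\<exists>a\<in>carrier F. \<not> int p dvd \<theta> a" by blast
  have formula: "int p dvd \<theta> h \<longleftrightarrow> int p dvd (\<Sum>i=1..n. \<theta> (x i) * lin i h)" if "h \<in> carrier F" for h
    using dvd_iff_dvd[OF mod_character_eq_lin[OF \<theta>(1-4) that]] .
  have "int p dvd \<theta> (x i)" if "i \<in> {1..n}" for i
  proof (rule indep[of "\<lambda>i. \<theta> (x i)"])
    show "int p dvd (\<Sum>i=1..n. \<theta> (x i) * lin i (y j))" if "j \<in> {1..n}" for j
      using formula[OF y[OF that]] \<theta>(5)[OF yH[OF that]] by simp
  qed (rule that)
  then have "int p dvd (\<Sum>i=1..n. \<theta> (x i) * lin i h)" for h by (intro dvd_sum dvd_mult2)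
  then show False using formula \<theta>(6) by blast
qed

end

section \<open>Endomorphisms and the Frattini subgroup\<close>

lemma continuous_hom_compose:
  "f \<in> continuous_hom G T H S \<Longrightarrow> g \<in> continuous_hom H S K R \<Longrightarrow> g \<circ> f \<in> continuous_hom G T K R"
  using Group.hom_compose continuous_map_compose by (auto simp: continuous_hom_def)

lemma continuous_hom_id: "id \<in> continuous_hom G T G T"
  by (auto simp: continuous_hom_def hom_def)

lemma continuous_hom_funpow:
  "f \<in> continuous_hom G T G T \<Longrightarrow> f ^^ k \<in> continuous_hom G T G T"
  by (induction k) (auto intro: continuous_hom_compose continuous_hom_id simp flip: id_def)

context prime_free_pro_p_group
begin

lemma endomorphism_closed: "f \<in> continuous_hom F T F T \<Longrightarrow> h \<in> carrier F \<Longrightarrow> f h \<in> carrier F"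
  by (auto simp: continuous_hom_def hom_def)

lemma endomorphism_group_hom: "f \<in> continuous_hom F T F T \<Longrightarrow> group_hom F F f"
  by unfold_locales (simp add: continuous_hom_def)

text \<open>Both routes from \<open>F\<close> to truncated series are multiplicative and agree on
  the generators. In this way an endomorphism becomes a substitution, to which the Fox calculus
  applies.\<close>

lemma magnus_endomorphism:
  assumes e: "e \<in> continuous_hom F T F T" and q: "0 < q" and h: "h \<in> carrier F"
  shows "eqf p (Suc q) (trunc_subst n (\<lambda>j. magnus_map q (e (x j)) - 1) q (magnus_map q h)) (magnus_map q (e h))"
proof -
  interpret e: group_hom F F e using e by (rule endomorphism_group_hom)
  define z where "z j = magnus_map q (e (x j)) - 1" for j
  have z: "cf (z j) [] = 0" if "j \<in> {1..n}" for j
    using that by (simp add: z_def magnus_Nil x_carrier)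
  define S where "S = trunc_subst n z q"
  define \<mu> where "\<mu> = magnus_map q"
  have S_mult: "eqf p (Suc q) (S (a * b)) (S a * S b)" for a b unfolding S_def by (rule trunc_subst_mult[OF z])
  have S_eqf: "eqf p (Suc q) (S a) (S b)" if "eqf p (Suc q) a b" for a b
    unfolding S_def by (rule trunc_subst_eqf[OF z that])
  have \<mu>_mult: "eqf p (Suc q) (\<mu> (a \<otimes> b)) (\<mu> a * \<mu> b)" if "a \<in> carrier F" "b \<in> carrier F" for a b
    unfolding \<mu>_def using that by (rule magnus_mult)
  have S_one: "S 1 = 1" by (simp add: S_def)
  define K where "K = {h \<in> carrier F. eqf p (Suc q) (S (\<mu> h)) (\<mu> (e h))}"
  define U where "U = {h \<in> carrier F. \<mu> h = 1 \<and> \<mu> (e h) = 1}"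
  have "K = carrier F"
  proof (rule open_subgroup_eq_carrier)
    show "subgroup K F"
    proof (rule subgroupI)
      show "K \<subseteq> carrier F" by (auto simp: K_def)
      have "\<one> \<in> K" by (simp add: K_def \<mu>_def magnus_one S_one)
      then show "K \<noteq> {}" by blast
      show "a \<otimes> b \<in> K" if "a \<in> K" "b \<in> K" for a b
      proof -
        have ab: "a \<in> carrier F" "b \<in> carrier F" using that by (auto simp: K_def)
        have "eqf p (Suc q) (S (\<mu> (a \<otimes> b))) (S (\<mu> a * \<mu> b))" by (intro S_eqf \<mu>_mult ab)
        also have "eqf p (Suc q) \<dots> (S (\<mu> a) * S (\<mu> b))" by (rule S_mult)
        also have "eqf p (Suc q) \<dots> (\<mu> (e a) * \<mu> (e b))" using that by (intro eqf_mult) (auto simp: K_def)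
        also have "eqf p (Suc q) \<dots> (\<mu> (e a \<otimes> e b))" using ab by (intro eqf_sym[OF \<mu>_mult]) auto
        finally show ?thesis using ab by (simp add: K_def)
      qed
      show "inv a \<in> K" if aK: "a \<in> K" for a
      proof -
        have a: "a \<in> carrier F" using aK by (simp add: K_def)
        \<comment> \<open>The substitution is multiplicative only up to order, so uniqueness of
          inverses is carried out by hand, from \<open>?s\<close> to \<open>?t\<close>.\<close>
        let ?s = "S (\<mu> (inv a))" and ?t = "\<mu> (e (inv a))"
        have "eqf p (Suc q) (\<mu> (e a) * ?t) 1"
          using eqf_sym[OF \<mu>_mult[of "e a" "e (inv a)"]] a by (simp add: \<mu>_def magnus_one)
        from eqf_sym[OF eqf_mult[OF eqf_refl[of _ _ ?s] this]]
        have "eqf p (Suc q) ?s (?s * (\<mu> (e a) * ?t))" by simp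
        also have "eqf p (Suc q) \<dots> (?s * (S (\<mu> a) * ?t))"
          using aK by (intro eqf_mult eqf_refl) (auto simp: K_def intro: eqf_sym)
        also have "?s * (S (\<mu> a) * ?t) = ?s * S (\<mu> a) * ?t" by (simp add: mult.assoc)
        also have "eqf p (Suc q) \<dots> (S (\<mu> (inv a) * \<mu> a) * ?t)"
          by (intro eqf_mult eqf_refl eqf_sym[OF S_mult])
        also have "eqf p (Suc q) \<dots> (S (\<mu> (inv a \<otimes> a)) * ?t)"
          using a by (intro eqf_mult eqf_refl S_eqf eqf_sym[OF \<mu>_mult]) auto
        also have "S (\<mu> (inv a \<otimes> a)) * ?t = ?t" using a by (simp add: \<mu>_def magnus_one S_one)
        finally show ?thesis using a by (simp add: K_def)
      qed
    qed
    show "subgroup U F"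
    proof (rule subgroupI)
      show "U \<noteq> {}" using magnus_one by (auto simp: U_def \<mu>_def intro!: exI[of _ \<one>])
      show "inv a \<in> U" if "a \<in> U" for a
      proof -
        have "\<mu> a = 1" "\<mu> (e a) = 1" "a \<in> carrier F" using that by (auto simp: U_def)
        then show ?thesis
          using magnus_hom.hom_inv[of a q] magnus_hom.hom_inv[of "e a" q] magnus.inv_one[of q]
          by (simp add: U_def \<mu>_def)
      qed
      show "a \<otimes> b \<in> U" if "a \<in> U" "b \<in> U" for a b
      proof -
        have "\<mu> a = 1" "\<mu> (e a) = 1" "\<mu> b = 1" "\<mu> (e b) = 1" "a \<in> carrier F" "b \<in> carrier F"
          using that by (auto simp: U_def)
        then show ?thesis
          using magnus_hom.hom_mult[of a b q] magnus_hom.hom_mult[of "e a" "e b" q] magnus.r_one[of 1 q]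
            magnus.one_closed[of q]
          by (simp add: U_def \<mu>_def)
      qed
    qed (auto simp: U_def)
    have "openin T {h \<in> topspace T. e h \<in> magnus_kernel q}"
      using e magnus_kernel(2) by (intro openin_continuous_map_preimage) (auto simp: continuous_hom_def)
    then have "openin T (magnus_kernel q \<inter> {h \<in> topspace T. e h \<in> magnus_kernel q})"
      using magnus_kernel(2) by (intro openin_Int)
    moreover have "magnus_kernel q \<inter> {h \<in> topspace T. e h \<in> magnus_kernel q} = U"
      by (auto simp: magnus_kernel_def U_def \<mu>_def topspace_eq)
    ultimately show "openin T U" by simp
    show "U \<subseteq> K" by (auto simp: U_def K_def S_one)
    fix j assume j: "j \<in> {1..n}"
    obtain q' where q': "q = Suc q'" using q by (cases q) auto
    have "eqf p (Suc q) (S (\<mu> (x j))) (S (1 + letter j))"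
      unfolding \<mu>_def by (intro S_eqf magnus_generator j)
    also have "S (1 + letter j) = 1 + z j" unfolding S_def q' by (simp only: trunc_subst_add trunc_subst_one trunc_subst_letter[OF j])
    finally show "x j \<in> K" using x_carrier[OF j] by (simp add: K_def z_def \<mu>_def)
  qed
  then show ?thesis using h by (auto simp: K_def S_def z_def[abs_def] \<mu>_def)
qed

text \<open>The image is compact, hence closed, and contains topological generators.\<close>

lemma endomorphism_surj:
  assumes f: "f \<in> continuous_hom F T F T" and gen: "topologically_generates F T ((\<lambda>i. f (x i)) ` {1..n})"
  shows "f ` carrier F = carrier F"
proof
  interpret f: group_hom F F f using f by (rule endomorphism_group_hom)
  show "f ` carrier F \<subseteq> carrier F" by auto
  have "compactin T (f ` topspace T)"
    using f compact by (intro image_compactin) (auto simp: continuous_hom_def compact_space_def)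
  then have "closedin T (f ` carrier F)" using Hausdorff by (simp add: compactin_imp_closedin topspace_eq)
  moreover have "generate F ((\<lambda>i. f (x i)) ` {1..n}) \<subseteq> f ` carrier F"
    using x_carrier by (intro generate_subgroup_incl f.img_is_subgroup) auto
  ultimately have "T closure_of (generate F ((\<lambda>i. f (x i)) ` {1..n})) \<subseteq> f ` carrier F"
    by (intro closure_of_minimal)
  then show "carrier F \<subseteq> f ` carrier F" using gen by (simp add: topologically_generates_def)
qed

lemma topologically_generatesI_identity:
  assumes y: "\<And>j. j \<in> {1..n} \<Longrightarrow> y j \<in> carrier F"
    and lin: "\<And>i j. i \<in> {1..n} \<Longrightarrow> j \<in> {1..n} \<Longrightarrow> int p dvd lin i (y j) - of_bool (i = j)"
  shows "topologically_generates F T (y ` {1..n})"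
proof (rule topologically_generatesI[OF y])
  fix c :: "nat \<Rightarrow> int" and j
  assume c: "\<And>j. j \<in> {1..n} \<Longrightarrow> int p dvd (\<Sum>i=1..n. c i * lin i (y j))" and j: "j \<in> {1..n}"
  have "int p dvd (\<Sum>i=1..n. c i * (lin i (y j) - of_bool (i = j)))"
    using lin j by (intro dvd_sum dvd_mult) auto
  moreover have "(\<Sum>i=1..n. c i * (lin i (y j) - of_bool (i = j))) =
      (\<Sum>i=1..n. c i * lin i (y j)) - (\<Sum>i=1..n. if i = j then c i else 0)"
    unfolding sum_subtractf[symmetric] by (intro sum.cong) (auto simp: algebra_simps)
  ultimately have "int p dvd (\<Sum>i=1..n. c i * lin i (y j)) - c j" using j by simp
  then show "int p dvd c j" using dvd_iff_dvd c[OF j] by blast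
qed

text \<open>\<open>lin i\<close> after \<open>\<phi>\<close> is again a continuous character, so its
  values on the generators determine it; they form the matrix of \<open>\<phi>\<close> on F /
  \<Phi>(F).\<close>

lemma lin_endomorphism:
  assumes \<phi>: "\<phi> \<in> continuous_hom F T F T" and h: "h \<in> carrier F"
  shows "int p dvd lin i (\<phi> h) - (\<Sum>j=1..n. lin i (\<phi> (x j)) * lin j h)"
proof -
  interpret \<phi>: group_hom F F \<phi> using \<phi> by (rule endomorphism_group_hom)
  let ?U = "{h \<in> topspace T. \<phi> h \<in> magnus_kernel 1}"
  have "mod_character F p (\<lambda>h. lin i (\<phi> h))"
    unfolding mod_character_def
  proof (intro ballI)
    fix a b assume ab: "a \<in> carrier F" "b \<in> carrier F"
    then show "int p dvd lin i (\<phi> (a \<otimes> b)) - (lin i (\<phi> a) + lin i (\<phi> b))"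
      using mod_characterD[OF mod_character_lin, of "\<phi> a" "\<phi> b"] by simp
  qed
  moreover have "subgroup ?U F"
    using magnus_kernel(1)[of 1]
    by (intro subgroupI) (auto simp: topspace_eq subgroup.m_closed subgroup.m_inv_closed subgroup.one_closed intro!: exI[of _ \<one>])
  moreover have "openin T ?U"
    using \<phi> magnus_kernel(2) by (intro openin_continuous_map_preimage) (auto simp: continuous_hom_def)
  moreover have "int p dvd lin i (\<phi> h)" if "h \<in> ?U" for h
    using that by (simp add: magnus_kernel_def lin_def)
  ultimately show "int p dvd lin i (\<phi> h) - (\<Sum>j=1..n. lin i (\<phi> (x j)) * lin j h)"
    using h by (rule mod_character_eq_lin)
qed

text \<open>A Hopfian argument: \<open>\<phi> = f ^^ k\<close> is the identity on F / \<Phi>(F),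
  hence onto. The endomorphism \<open>s\<close> that sends each generator to a preimage is the
  identity there too, hence onto, and then \<open>\<phi> \<circ> s = id\<close> makes
  \<open>\<phi>\<close> injective. Bijectivity passes to \<open>f\<close>, and compactness makes
  \<open>f\<close> a homeomorphism.\<close>

lemma topological_automorphismI:
  assumes f: "f \<in> continuous_hom F T F T" and k: "0 < k"
    and lin: "\<And>i j. i \<in> {1..n} \<Longrightarrow> j \<in> {1..n} \<Longrightarrow> int p dvd lin i ((f ^^ k) (x j)) - of_bool (i = j)"
  shows "topological_automorphism F T f"
proof -
  define \<phi> where "\<phi> = f ^^ k"
  have \<phi>: "\<phi> \<in> continuous_hom F T F T" unfolding \<phi>_def using f by (rule continuous_hom_funpow)
  interpret \<phi>: group_hom F F \<phi> using \<phi> by (rule endomorphism_group_hom)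
  have surj: "\<phi> ` carrier F = carrier F"
    using lin x_carrier by (intro endomorphism_surj[OF \<phi>] topologically_generatesI_identity) (auto simp: \<phi>_def[symmetric])
  have "\<exists>y. \<forall>i\<in>{1..n}. y i \<in> carrier F \<and> \<phi> (y i) = x i"
    using surj x_carrier by (intro bchoice) (metis imageE)
  then obtain y where y: "\<And>i. i \<in> {1..n} \<Longrightarrow> y i \<in> carrier F" "\<And>i. i \<in> {1..n} \<Longrightarrow> \<phi> (y i) = x i"
    by blast
  have lin\<phi>: "int p dvd lin i (\<phi> h) - lin i h" if i: "i \<in> {1..n}" and h: "h \<in> carrier F" for i h
  proof -
    have 1: "int p dvd lin i (\<phi> h) - (\<Sum>j=1..n. lin i (\<phi> (x j)) * lin j h)"
      using \<phi> h by (rule lin_endomorphism)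
    have 2: "int p dvd (\<Sum>j=1..n. (lin i (\<phi> (x j)) - of_bool (i = j)) * lin j h)"
      using lin i by (intro dvd_sum dvd_mult2) (auto simp: \<phi>_def)
    have "(\<Sum>j=1..n. of_bool (i = j) * lin j h) = (\<Sum>j=1..n. if j = i then lin j h else 0)"
      by (intro sum.cong) auto
    then have "(\<Sum>j=1..n. (lin i (\<phi> (x j)) - of_bool (i = j)) * lin j h) =
        (\<Sum>j=1..n. lin i (\<phi> (x j)) * lin j h) - lin i h"
      using i by (simp add: left_diff_distrib sum_subtractf)
    from dvd_add[OF 1 2[unfolded this]] show ?thesis by simp
  qed
  have lin_y: "int p dvd lin i (y j) - of_bool (i = j)" if ij: "i \<in> {1..n}" "j \<in> {1..n}" for i j
  proof -
    have "int p dvd lin i (x j) - lin i (y j)" using lin\<phi>[OF ij(1) y(1)[OF ij(2)]] y(2)[OF ij(2)] by simp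
    from dvd_diff[OF lin_generator[OF ij(2), of i] this] show ?thesis by simp
  qed
  obtain s where s: "s \<in> continuous_hom F T F T" "\<And>i. i \<in> {1..n} \<Longrightarrow> s (x i) = y i"
    using exists_continuous_hom[where y = y, OF pro_p_group_axioms y(1)] by blast
  have "(\<lambda>i. s (x i)) ` {1..n} = y ` {1..n}" using s(2) by (intro image_cong) auto
  then have s_surj: "s ` carrier F = carrier F"
    using topologically_generatesI_identity[OF y(1) lin_y] by (intro endomorphism_surj s(1)) simp
  have \<phi>s: "\<phi> (s h) = h" if "h \<in> carrier F" for h
    using continuous_homs_agree[OF continuous_hom_compose[OF s(1) \<phi>] continuous_hom_id is_group Hausdorff _ that]
      s(2) y(2) by simp
  have "inj_on \<phi> (carrier F)"
  proof (rule inj_onI)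
    fix a b assume ab: "a \<in> carrier F" "b \<in> carrier F" "\<phi> a = \<phi> b"
    have "a \<in> s ` carrier F" "b \<in> s ` carrier F" using ab(1,2) s_surj by simp_all
    then show "a = b" using ab(3) \<phi>s by auto
  qed
  moreover obtain k' where k': "k = Suc k'" using k by (cases k) auto
  ultimately have inj: "inj_on f (carrier F)"
    by (auto simp: \<phi>_def funpow_swap1 funpow_Suc_right inj_on_def simp del: funpow.simps)
  have "\<phi> = f \<circ> (f ^^ k')" by (simp add: \<phi>_def k')
  then have "carrier F = f ` ((f ^^ k') ` carrier F)" using surj by (simp add: image_comp)
  moreover have "(f ^^ k') ` carrier F \<subseteq> carrier F"
    using endomorphism_closed[OF continuous_hom_funpow[OF f]] by blast
  moreover have "f ` carrier F \<subseteq> carrier F" using endomorphism_closed[OF f] by blast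
  ultimately have f_surj: "f ` carrier F = carrier F" by blast
  have "f \<in> iso F F" using f inj f_surj by (auto simp: iso_def bij_betw_def continuous_hom_def)
  moreover have "homeomorphic_map T T f"
    using f inj f_surj compact Hausdorff
    by (intro continuous_imp_homeomorphic_map) (auto simp: continuous_hom_def topspace_eq)
  ultimately show ?thesis by (simp add: topological_automorphism_def)
qed

text \<open>The kernel of each \<open>lin i\<close> is a maximal open subgroup, since the powers of
  any element outside it attain every value modulo \<open>p\<close>. Conversely, a maximal open
  subgroup is the kernel of a character, which is a combination of the \<open>lin i\<close>.\<close>

lemma mem_frattini_iff:
  "g \<in> frattini F T \<longleftrightarrow> g \<in> carrier F \<and> (\<forall>i\<in>{1..n}. int p dvd lin i g)"
proof (intro iffI conjI ballI)
  assume g: "g \<in> frattini F T"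
  then show gF: "g \<in> carrier F" by (simp add: frattini_def)
  fix i assume i: "i \<in> {1..n}"
  define M where "M = {h \<in> carrier F. int p dvd lin i h}"
  have M: "subgroup M F" unfolding M_def by (rule subgroup_mod_character[OF mod_character_lin])
  have "maximal_open_subgroup F T M"
    unfolding maximal_open_subgroup_def
  proof (intro conjI allI impI)
    show "subgroup M F" by (rule M)
    have "magnus_kernel 1 \<subseteq> M" by (auto simp: M_def magnus_kernel_def lin_def)
    then show "openin T M" using openin_subgroup[OF M magnus_kernel] by blast
    have "\<not> int p dvd lin i (x i)"
    proof
      assume "int p dvd lin i (x i)"
      then have "int p dvd 1" using dvd_iff_dvd[OF lin_generator[OF i, of i]] by simp
      then show False using p by (simp add: prime_nat_iff)
    qed
    then show "M \<noteq> carrier F" using x_carrier[OF i] by (auto simp: M_def)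
    fix H assume H: "subgroup H F \<and> openin T H \<and> M \<subseteq> H"
    show "H = M \<or> H = carrier F"
    proof (cases "H = M")
      case False
      then obtain h where h: "h \<in> H" "h \<notin> M" using H by blast
      have hF: "h \<in> carrier F" using h H subgroup.subset by blast
      then have nd: "\<not> int p dvd lin i h" using h(2) by (simp add: M_def)
      have "y \<in> H" if y: "y \<in> carrier F" for y
      proof -
        have "coprime (lin i h) (int p)" using nd p prime_imp_coprime[of "int p" "lin i h"] by (simp add: coprime_commute)
        then obtain c where c: "[lin i h * c = 1] (mod int p)" using cong_solve_coprime_int by blast
        \<comment> \<open>The exponent for which \<open>lin i\<close> takes the same value modulo
          \<open>p\<close> on \<open>h [^] m\<close> as on \<open>y\<close>, so that their quotient
          lies in \<open>M\<close>.\<close>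
        define m where "m = nat ((c * lin i y) mod int p)"
        have m: "int m = (c * lin i y) mod int p" using prime_gt_0_nat[OF p] by (simp add: m_def)
        have "[int m * lin i h = lin i y] (mod int p)"
        proof -
          have "[int m * lin i h = (c * lin i y) * lin i h] (mod int p)"
            unfolding m by (intro cong_mult cong_refl) (simp add: cong_def)
          also have "(c * lin i y) * lin i h = (lin i h * c) * lin i y" by (simp add: algebra_simps)
          also have "[\<dots> = 1 * lin i y] (mod int p)" by (intro cong_mult c cong_refl)
          finally show ?thesis by simp
        qed
        then have 1: "int p dvd int m * lin i h - lin i y" by (simp add: cong_iff_dvd_diff)
        let ?y' = "y \<otimes> inv (h [^] m)"
        have 2: "int p dvd lin i ?y' - (lin i y + lin i (inv (h [^] m)))"
          using mod_characterD[OF mod_character_lin] y hF by simp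
        have 3: "int p dvd lin i (inv (h [^] m)) + lin i (h [^] m)"
          using mod_character_inv[OF mod_character_lin] hF by simp
        have 4: "int p dvd lin i (h [^] m) - int m * lin i h"
          using mod_character_pow[OF mod_character_lin hF] .
        have "int p dvd lin i ?y'"
          using dvd_diff[OF dvd_diff[OF dvd_add[OF 2 3] 4] 1] by simp
        then have "?y' \<in> H" using H y hF by (auto simp: M_def)
        moreover have "h [^] m \<in> H" using h(1) H
          by (induction m) (auto simp: subgroup.one_closed subgroup.m_closed)
        ultimately have "?y' \<otimes> h [^] m \<in> H" using H by (auto simp: subgroup.m_closed)
        then show ?thesis using y hF by (simp add: m_assoc)
      qed
      then show ?thesis using H subgroup.subset by blast
    qed simp
  qed
  then have "g \<in> M" using g by (simp add: frattini_def)
  then show "int p dvd lin i g" by (simp add: M_def)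
next
  assume g: "g \<in> carrier F \<and> (\<forall>i\<in>{1..n}. int p dvd lin i g)"
  have "g \<in> M" if M: "maximal_open_subgroup F T M" for M
  proof -
    have M': "subgroup M F" "openin T M" "M \<noteq> carrier F" using M by (auto simp: maximal_open_subgroup_def)
    obtain \<theta> where \<theta>: "mod_character F p \<theta>" "\<forall>h\<in>M. int p dvd \<theta> h" "\<exists>a\<in>carrier F. \<not> int p dvd \<theta> a"
      using open_subgroup_mod_character[OF p M'] by blast
    let ?K = "{h \<in> carrier F. int p dvd \<theta> h}"
    have K: "subgroup ?K F" using \<theta>(1) by (rule subgroup_mod_character)
    have MK: "M \<subseteq> ?K" using \<theta>(2) subgroup.subset[OF M'(1)] by blast
    have "openin T ?K" using K M'(1,2) MK by (rule openin_subgroup)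
    then have "?K = M" using M K MK \<theta>(3) unfolding maximal_open_subgroup_def by blast
    moreover have "int p dvd \<theta> g - (\<Sum>i=1..n. \<theta> (x i) * lin i g)"
      by (rule mod_character_eq_lin[OF \<theta>(1) M'(1,2)]) (use \<theta>(2) g in auto)
    moreover have "int p dvd (\<Sum>i=1..n. \<theta> (x i) * lin i g)" using g by (intro dvd_sum dvd_mult) auto
    ultimately show ?thesis using g dvd_iff_dvd by blast
  qed
  then show "g \<in> frattini F T" using g by (auto simp: frattini_def)
qed

end

section \<open>Density of the test elements\<close>

lemma prod_list_indicator:
  assumes "\<And>l. int p dvd f l - of_bool (l \<in> S)"
  shows "int p dvd (\<Prod>l\<leftarrow>w. f l) - of_bool (set w \<subseteq> S)"
proof (induction w)
  case (Cons l w)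
  have "int p dvd f l * ((\<Prod>l\<leftarrow>w. f l) - of_bool (set w \<subseteq> S)) + (f l - of_bool (l \<in> S)) * of_bool (set w \<subseteq> S)"
    using Cons assms by (intro dvd_add dvd_mult dvd_mult2)
  then show ?case by (simp add: algebra_simps of_bool_conj)
qed simp

text \<open>Such a sequence is eventually periodic. If it has period \<open>m\<close> from index
  \<open>i\<close> on, any positive multiple of \<open>m\<close> that is at least \<open>i\<close>
  will do.\<close>

lemma finite_semigroup_idempotent_index:
  fixes t :: "nat \<Rightarrow> 'c"
  assumes fin: "finite (range t)" and step: "\<And>i j. t i = t j \<Longrightarrow> t (Suc i) = t (Suc j)"
  shows "\<exists>k>0. t (k + k) = t k"
proof -
  have "\<not> inj t" using fin finite_imageD infinite_UNIV_nat by blast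
  then obtain a b where "t a = t b" "a \<noteq> b" by (auto simp: inj_def)
  then obtain a b where ab: "t a = t b" "a < b" by (metis linorder_neqE_nat)
  define i m where "i = a" and "m = b - a"
  have im: "t i = t (i + m)" "0 < m" using ab by (simp_all add: i_def m_def)
  have shift: "t (a + c) = t (b + c)" if "t a = t b" for a b c
  proof (induction c)
    case (Suc c)
    then have "t (Suc (a + c)) = t (Suc (b + c))" by (rule step)
    then show ?case by simp
  qed (simp add: that)
  have period: "t s = t (s + m)" if "i \<le> s" for s
    using shift[OF im(1), of "s - i"] that by (simp add: add.commute add.left_commute)
  have multiple: "t s = t (s + l * m)" if s: "i \<le> s" for s l
  proof (induction l)
    case (Suc l)
    have "t (s + l * m) = t (s + l * m + m)" using s by (intro period) simp
    moreover have "s + l * m + m = s + Suc l * m" by simp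
    ultimately show ?case using Suc by simp
  qed simp
  \<comment> \<open>\<open>Suc i\<close> instead of \<open>i\<close> keeps the index positive for
    \<open>i = 0\<close>.\<close>
  have "i \<le> Suc i * m" using im(2) by (cases m) auto
  from multiple[OF this, of "Suc i"] show ?thesis
    using im(2) by (intro exI[of _ "Suc i * m"]) simp
qed

context prime_free_pro_p_group
begin

text \<open>Centralizers are closed subgroups; this is applied to a generator and then to an
  arbitrary element. The lemma serves to extract a second generator from non-commutativity.\<close>

lemma comm_group_if_generators_commute:
  assumes "\<And>i j. i \<in> {1..n} \<Longrightarrow> j \<in> {1..n} \<Longrightarrow> x i \<otimes> x j = x j \<otimes> x i"
  shows "comm_group F"
proof -
  have centralizer: "{h \<in> carrier F. h \<otimes> b = b \<otimes> h} = carrier F"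
    if b: "b \<in> carrier F" and gen: "\<And>i. i \<in> {1..n} \<Longrightarrow> x i \<otimes> b = b \<otimes> x i" for b
  proof (rule closed_subgroup_eq_carrier)
    show "subgroup {h \<in> carrier F. h \<otimes> b = b \<otimes> h} F"
    proof (rule subgroupI)
      show "{h \<in> carrier F. h \<otimes> b = b \<otimes> h} \<noteq> {}" using b by (auto intro!: exI[of _ \<one>])
      show "inv h \<in> {h \<in> carrier F. h \<otimes> b = b \<otimes> h}" if "h \<in> {h \<in> carrier F. h \<otimes> b = b \<otimes> h}" for h
      proof -
        have h: "h \<in> carrier F" "h \<otimes> b = b \<otimes> h" using that by auto
        have "inv h \<otimes> (h \<otimes> b) \<otimes> inv h = inv h \<otimes> (b \<otimes> h) \<otimes> inv h" using h(2) by simp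
        moreover have "inv h \<otimes> (h \<otimes> b) \<otimes> inv h = b \<otimes> inv h"
          using h(1) b by (simp add: m_assoc[symmetric])
        moreover have "inv h \<otimes> (b \<otimes> h) \<otimes> inv h = inv h \<otimes> b"
          using h(1) b by (simp add: m_assoc)
        ultimately show ?thesis using h(1) by simp
      qed
      show "h \<otimes> k \<in> {h \<in> carrier F. h \<otimes> b = b \<otimes> h}"
        if "h \<in> {h \<in> carrier F. h \<otimes> b = b \<otimes> h}" "k \<in> {h \<in> carrier F. h \<otimes> b = b \<otimes> h}" for h k
      proof -
        have hk: "h \<in> carrier F" "k \<in> carrier F" "h \<otimes> b = b \<otimes> h" "k \<otimes> b = b \<otimes> k" using that by auto
        have "h \<otimes> k \<otimes> b = h \<otimes> (b \<otimes> k)" using hk b by (simp add: m_assoc)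
        also have "\<dots> = (b \<otimes> h) \<otimes> k" using hk b by (simp add: m_assoc[symmetric])
        also have "\<dots> = b \<otimes> (h \<otimes> k)" using hk(1,2) b by (rule_tac m_assoc)
        finally show ?thesis using hk by simp
      qed
    qed auto
    have "closedin T {h \<in> topspace T. h \<otimes> b = b \<otimes> h}"
      using b by (intro closedin_continuous_maps_eq[OF Hausdorff] continuous_mult_maps) (auto simp: topspace_eq)
    then show "closedin T {h \<in> carrier F. h \<otimes> b = b \<otimes> h}" by (simp add: topspace_eq)
  qed (use gen x_carrier in auto)
  have 1: "x i \<otimes> b = b \<otimes> x i" if "i \<in> {1..n}" "b \<in> carrier F" for i b
  proof -
    have "b \<in> {h \<in> carrier F. h \<otimes> x i = x i \<otimes> h}"
      using centralizer[OF x_carrier[OF that(1)] assms[OF _ that(1)]] that(2) by simp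
    then show ?thesis by simp
  qed
  show ?thesis
    by (rule group_comm_groupI) (use centralizer 1 in blast)
qed

text \<open>Outside \<Phi>(F) some \<open>lin i g\<close> is nonzero modulo \<open>p\<close>, so
  \<open>g\<close> can replace \<open>x i\<close> among the generators. The projection onto this
  generator along the others fixes \<open>g\<close> and kills some \<open>x j\<close>, hence is no
  automorphism.\<close>

lemma test_element_frattini:
  assumes nc: "\<not> comm_group F" and test: "test_element F T g"
  shows "g \<in> frattini F T"
proof (rule ccontr)
  assume "g \<notin> frattini F T"
  moreover have g: "g \<in> carrier F" using test by (simp add: test_element_def)
  ultimately obtain i where i: "i \<in> {1..n}" "\<not> int p dvd lin i g" by (auto simp: mem_frattini_iff)
  have P: "prime (int p)" using p by simp
  have "\<exists>j\<in>{1..n}. j \<noteq> i"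
  proof (rule ccontr)
    assume "\<not> ?thesis"
    then have eq: "a = i" if "a \<in> {1..n}" for a using that by blast
    have "x a \<otimes> x b = x b \<otimes> x a" if "a \<in> {1..n}" "b \<in> {1..n}" for a b
      using eq[OF that(1)] eq[OF that(2)] by simp
    then have "comm_group F" by (rule comm_group_if_generators_commute)
    then show False using nc by simp
  qed
  then obtain j where j: "j \<in> {1..n}" "j \<noteq> i" by blast
  have generates: "topologically_generates F T ((\<lambda>l. if l = i then h else x l) ` {1..n})"
    if h: "h \<in> carrier F" and hi: "\<not> int p dvd lin i h" for h
  proof (rule topologically_generatesI)
    show "(if l = i then h else x l) \<in> carrier F" if "l \<in> {1..n}" for l using x_carrier that h by simp
    fix c :: "nat \<Rightarrow> int" and m
    assume c: "\<And>l. l \<in> {1..n} \<Longrightarrow> int p dvd (\<Sum>k=1..n. c k * lin k (if l = i then h else x l))"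
      and m: "m \<in> {1..n}"
    have cl: "int p dvd c l" if l: "l \<in> {1..n}" "l \<noteq> i" for l
    proof -
      have "int p dvd (\<Sum>k=1..n. c k * (lin k (x l) - of_bool (k = l)))"
        using lin_generator l by (intro dvd_sum dvd_mult) auto
      moreover have "(\<Sum>k=1..n. c k * (lin k (x l) - of_bool (k = l))) =
          (\<Sum>k=1..n. c k * lin k (x l)) - (\<Sum>k=1..n. if k = l then c k else 0)"
        unfolding sum_subtractf[symmetric] by (intro sum.cong) (auto simp: algebra_simps)
      ultimately have "int p dvd (\<Sum>k=1..n. c k * lin k (x l)) - c l" using l by simp
      from dvd_iff_dvd[OF this] show ?thesis using c[OF l(1)] l(2) by simp
    qed
    have "(\<Sum>k=1..n. c k * lin k h) = c i * lin i h + (\<Sum>k\<in>{1..n} - {i}. c k * lin k h)"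
      using i(1) by (intro sum.remove) auto
    moreover have "int p dvd (\<Sum>k\<in>{1..n} - {i}. c k * lin k h)" using cl by (intro dvd_sum dvd_mult2) auto
    ultimately have "int p dvd c i * lin i h" using c[OF i(1)] by (simp add: dvd_add_left_iff)
    then have "int p dvd c i" using P hi prime_dvd_mult_iff by blast
    then show "int p dvd c m" using cl m by (cases "m = i") auto
  qed
  obtain \<alpha> where \<alpha>: "\<alpha> \<in> continuous_hom F T F T" "\<And>l. l \<in> {1..n} \<Longrightarrow> \<alpha> (x l) = (if l = i then g else x l)"
  proof -
    have "(if l = i then g else x l) \<in> carrier F" if "l \<in> {1..n}" for l using g x_carrier that by simp
    from exists_continuous_hom[where y = "\<lambda>l. if l = i then g else x l", OF pro_p_group_axioms this]
    show ?thesis using that by blast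
  qed
  have "(\<lambda>l. \<alpha> (x l)) ` {1..n} = (\<lambda>l. if l = i then g else x l) ` {1..n}" using \<alpha>(2) by (intro image_cong) auto
  then have \<alpha>_surj: "\<alpha> ` carrier F = carrier F"
    using generates[OF g i(2)] by (intro endomorphism_surj \<alpha>(1)) simp
  \<comment> \<open>Sending \<open>x i\<close> to \<open>u\<close> and fixing the other generators
    will give a right inverse \<open>s\<close> of \<open>\<alpha>\<close>, which is onto and
    therefore also a left inverse.\<close>
  obtain u where u: "u \<in> carrier F" "\<alpha> u = x i" using \<alpha>_surj x_carrier[OF i(1)] by (metis imageE)
  have lin_u: "\<not> int p dvd lin i u"
  proof
    assume "int p dvd lin i u"
    have "int p dvd lin i (\<alpha> (x l)) * lin l u" if "l \<in> {1..n}" for l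
    proof (cases "l = i")
      case False
      then have "int p dvd lin i (x l)" using lin_generator[OF that, of i] by simp
      then show ?thesis using \<alpha>(2)[OF that] False by simp
    qed (use \<open>int p dvd lin i u\<close> in simp)
    then have "int p dvd (\<Sum>l=1..n. lin i (\<alpha> (x l)) * lin l u)" by (intro dvd_sum)
    then have "int p dvd lin i (x i)" using dvd_iff_dvd[OF lin_endomorphism[OF \<alpha>(1) u(1), of i]] u(2) by simp
    then have "int p dvd 1" using dvd_iff_dvd[OF lin_generator[OF i(1), of i]] by simp
    then show False using p by (simp add: prime_nat_iff)
  qed
  obtain s where s: "s \<in> continuous_hom F T F T" "\<And>l. l \<in> {1..n} \<Longrightarrow> s (x l) = (if l = i then u else x l)"
  proof -
    have "(if l = i then u else x l) \<in> carrier F" if "l \<in> {1..n}" for l using u x_carrier that by simp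
    from exists_continuous_hom[where y = "\<lambda>l. if l = i then u else x l", OF pro_p_group_axioms this]
    show ?thesis using that by blast
  qed
  have "(\<lambda>l. s (x l)) ` {1..n} = (\<lambda>l. if l = i then u else x l) ` {1..n}" using s(2) by (intro image_cong) auto
  then have s_surj: "s ` carrier F = carrier F"
    using generates[OF u(1) lin_u] by (intro endomorphism_surj s(1)) simp
  have \<alpha>s: "\<alpha> (s h) = h" if "h \<in> carrier F" for h
    using continuous_homs_agree[OF continuous_hom_compose[OF s(1) \<alpha>(1)] continuous_hom_id is_group Hausdorff _ that]
      s(2) \<alpha>(2) u(2) by simp
  have s\<alpha>: "s (\<alpha> h) = h" if h: "h \<in> carrier F" for h
  proof -
    have "h \<in> s ` carrier F" using h s_surj by simp
    then show ?thesis using \<alpha>s by auto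
  qed
  obtain \<pi> where \<pi>: "\<pi> \<in> continuous_hom F T F T" "\<And>l. l \<in> {1..n} \<Longrightarrow> \<pi> (x l) = (if l = i then x i else \<one>)"
  proof -
    have "(if l = i then x i else \<one>) \<in> carrier F" if "l \<in> {1..n}" for l using x_carrier[OF i(1)] by simp
    from exists_continuous_hom[where y = "\<lambda>l. if l = i then x i else \<one>", OF pro_p_group_axioms this]
    show ?thesis using that by blast
  qed
  define \<phi> where "\<phi> = \<alpha> \<circ> \<pi> \<circ> s"
  have \<phi>: "\<phi> \<in> continuous_hom F T F T"
    unfolding \<phi>_def using \<alpha>(1) \<pi>(1) s(1) by (intro continuous_hom_compose)
  interpret \<alpha>: group_hom F F \<alpha> using \<alpha>(1) by (rule endomorphism_group_hom)
  interpret \<phi>: group_hom F F \<phi> using \<phi> by (rule endomorphism_group_hom)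
  have "\<phi> g = g"
    using s\<alpha>[OF x_carrier[OF i(1)]] \<alpha>(2)[OF i(1)] \<pi>(2)[OF i(1)] by (simp add: \<phi>_def)
  then have "\<phi> \<in> iso F F" using test \<phi> by (auto simp: test_element_def topological_automorphism_def)
  moreover have "\<phi> (x j) = \<one>" using s(2)[OF j(1)] \<pi>(2)[OF j(1)] j(2) by (simp add: \<phi>_def)
  ultimately have "x j = \<one>" using \<phi>.iso_iff x_carrier[OF j(1)] by blast
  then have "int p dvd lin j (x j)" by (simp add: lin_def magnus_one)
  then have "int p dvd 1" using dvd_iff_dvd[OF lin_generator[OF j(1), of j]] by simp
  then show False using p by (simp add: prime_nat_iff)
qed

text \<open>At level \<open>q\<close> the images of the generators under the powers of
  \<open>f\<close> take finitely many values, which yields an idempotent power \<open>e\<close>;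
  \<open>z j\<close> replaces \<open>letter j\<close> in the substitution induced by
  \<open>e\<close>. If its linear part were the identity matrix, \<open>e\<close> would act
  trivially on F / \<Phi>(F), and \<open>f\<close> would be an automorphism.\<close>

lemma level_idempotent:
  assumes f: "f \<in> continuous_hom F T F T" "\<not> topological_automorphism F T f"
    and w: "w \<in> carrier F" "f w = w" and q: "0 < q"
  shows "\<exists>z j l. (\<forall>j\<in>{1..n}. cf (z j) [] = 0 \<and> eqf p (Suc q) (trunc_subst n z q (z j)) (z j)) \<and>
    eqf p (Suc q) (trunc_subst n z q (magnus_map q w - 1)) (magnus_map q w - 1) \<and>
    j \<in> {1..n} \<and> l \<in> {1..n} \<and> \<not> int p dvd cf (z j) [l] - of_bool (j = l)"
proof -
  let ?\<mu> = "magnus_map q"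
  have fk: "f ^^ k \<in> continuous_hom F T F T" for k using f(1) by (rule continuous_hom_funpow)
  define t where "t k = (\<lambda>j\<in>{1..n}. ?\<mu> ((f ^^ k) (x j)))" for k
  have "range t \<subseteq> {1..n} \<rightarrow>\<^sub>E ?\<mu> ` carrier F"
    using endomorphism_closed[OF fk x_carrier] by (auto simp: t_def)
  moreover have "finite ({1..n} \<rightarrow>\<^sub>E ?\<mu> ` carrier F)" using finite_range_magnus by (intro finite_PiE) auto
  ultimately have "finite (range t)" by (rule finite_subset)
  moreover have same: "?\<mu> ((f ^^ a) h) = ?\<mu> ((f ^^ b) h)" if ab: "t a = t b" and h: "h \<in> carrier F" for a b h
  proof -
    have "(?\<mu> \<circ> (f ^^ a)) h = (?\<mu> \<circ> (f ^^ b)) h"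
    proof (rule continuous_homs_agree[OF continuous_hom_compose[OF fk magnus_map(1)]
          continuous_hom_compose[OF fk magnus_map(1)] magnus.is_group _ _ h])
      show "(?\<mu> \<circ> (f ^^ a)) (x j) = (?\<mu> \<circ> (f ^^ b)) (x j)" if "j \<in> {1..n}" for j
        using fun_cong[OF ab, of j] that by (simp add: t_def)
    qed simp
    then show ?thesis by simp
  qed
  have "t (Suc a) = t (Suc b)" if "t a = t b" for a b
    using same[OF that endomorphism_closed[OF f(1) x_carrier]]
    by (auto simp: t_def fun_eq_iff funpow_Suc_right simp del: funpow.simps)
  ultimately obtain k where k: "0 < k" "t (k + k) = t k"
    using finite_semigroup_idempotent_index[of t] by blast
  define e where "e = f ^^ k"
  have e: "e \<in> continuous_hom F T F T" unfolding e_def by (rule fk)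
  define z where "z j = ?\<mu> (e (x j)) - 1" for j
  have ew: "e w = w" unfolding e_def using w(2) by (induction k) auto
  have S: "eqf p (Suc q) (trunc_subst n z q (?\<mu> h - 1)) (?\<mu> (e h) - 1)" if "h \<in> carrier F" for h
    using eqf_diff[OF magnus_endomorphism[OF e q that] eqf_refl[of p "Suc q" 1]] by (simp add: z_def[abs_def])
  have "?\<mu> (e (e (x j))) = ?\<mu> (e (x j))" if "j \<in> {1..n}" for j
    using fun_cong[OF k(2), of j] that by (simp add: t_def e_def funpow_add)
  then have "eqf p (Suc q) (trunc_subst n z q (z j)) (z j)" if "j \<in> {1..n}" for j
    using S[OF endomorphism_closed[OF e x_carrier[OF that]]] that by (simp add: z_def)
  moreover have "cf (z j) [] = 0" if "j \<in> {1..n}" for j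
    using magnus_Nil[OF endomorphism_closed[OF e x_carrier[OF that]]] by (simp add: z_def)
  moreover have "\<exists>j\<in>{1..n}. \<exists>l\<in>{1..n}. \<not> int p dvd cf (z j) [l] - of_bool (j = l)"
  proof (rule ccontr)
    assume neg: "\<not> ?thesis"
    have "int p dvd lin l ((f ^^ k) (x j)) - of_bool (l = j)" if jl: "j \<in> {1..n}" "l \<in> {1..n}" for j l
    proof -
      have 1: "int p dvd cf (?\<mu> (e (x j))) [l] - lin l (e (x j))"
        using magnus_coeff_eq_lin[OF q endomorphism_closed[OF e x_carrier[OF jl(1)]] jl(2)] .
      have 2: "int p dvd cf (?\<mu> (e (x j))) [l] - of_bool (l = j)"
      proof -
        have "int p dvd cf (z j) [l] - of_bool (j = l)" using neg jl by blast
        then show ?thesis unfolding eq_commute[of l j] by (simp add: z_def)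
      qed
      show ?thesis using dvd_diff[OF 2 1] by (simp add: e_def)
    qed
    then show False using topological_automorphismI[OF f(1) k(1)] f(2) by blast
  qed
  moreover have "eqf p (Suc q) (trunc_subst n z q (?\<mu> w - 1)) (?\<mu> w - 1)" using S[OF w(1)] by (simp only: ew)
  ultimately show ?thesis by (intro exI[of _ z]) blast
qed

text \<open>Diagonal pairs encode single generators, so one index set of pairs covers both kinds of
  factors of \<open>v\<close>.\<close>

definition pair_product :: "nat \<times> nat \<Rightarrow> 'a" where
  "pair_product = (\<lambda>(i, j). if i = j then x i else x i \<otimes> x j)"

lemma pair_product_closed: "i \<in> {1..n} \<Longrightarrow> j \<in> {1..n} \<Longrightarrow> pair_product (i, j) \<in> carrier F"
  using x_carrier by (simp add: pair_product_def)

lemma pair_product_coeff: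
  assumes q: "0 < q" and ij: "i \<in> {1..n}" "j \<in> {1..n}"
  shows "int p dvd cf (magnus_map q (pair_product (i, j)) - 1) [l] - of_bool (l \<in> {i, j})"
proof (cases "i = j")
  case True
  then show ?thesis using magnus_generator_coeff[OF q ij(1), of l] by (simp add: pair_product_def)
next
  case False
  have "int p dvd cf (magnus_map q (x i \<otimes> x j)) [l] - (cf (magnus_map q (x i)) [l] + cf (magnus_map q (x j)) [l])"
    using mod_characterD[OF mod_character_magnus[OF q] x_carrier[OF ij(1)] x_carrier[OF ij(2)]] .
  from dvd_add[OF dvd_add[OF this magnus_generator_coeff[OF q ij(1), of l]] magnus_generator_coeff[OF q ij(2), of l]]
  show ?thesis using False by (auto simp: pair_product_def split: if_splits)
qed

text \<open>Each factor is \<open>1 + t ^ q\<close> with \<open>t ^ q\<close> of order at least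
  \<open>q\<close>. Products of two such terms have order at least \<open>2 * q > q\<close>, so the
  leading forms simply add up.\<close>

lemma exists_pair_power_product:
  assumes q: "q = p ^ s" and N: "subgroup N F" and pow: "\<And>h. h \<in> carrier F \<Longrightarrow> h [^] q \<in> N"
    and A: "finite A" "A \<subseteq> {1..n} \<times> {1..n}"
  shows "\<exists>v\<in>N. eqf p (Suc q) (magnus_map q v) (1 + (\<Sum>a\<in>A. (magnus_map q (pair_product a) - 1) ^ q))"
  using A
proof (induction A rule: finite_induct)
  case empty
  show ?case using subgroup.one_closed[OF N] by (intro bexI[of _ \<one>]) (simp_all add: magnus_one)
next
  case (insert a A)
  let ?\<mu> = "magnus_map q"
  let ?u = "\<Sum>a\<in>A. (?\<mu> (pair_product a) - 1) ^ q" and ?t = "(?\<mu> (pair_product a) - 1) ^ q"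
  have q0: "0 < q" using prime_gt_0_nat[OF p] q by simp
  obtain v where v: "v \<in> N" "eqf p (Suc q) (?\<mu> v) (1 + ?u)" using insert by auto
  have vF: "v \<in> carrier F" using v(1) subgroup.subset[OF N] by blast
  have pF: "pair_product b \<in> carrier F" if "b \<in> insert a A" for b
    using insert.prems that pair_product_closed by (cases b) auto
  define h where "h = pair_product a [^] q"
  have h: "h \<in> N" "h \<in> carrier F" using pow pF by (auto simp: h_def)
  have "eqf p (Suc q) (?\<mu> h) ((1 + (?\<mu> (pair_product a) - 1)) ^ q)"
    unfolding h_def using magnus_pow[OF pF, of a q q] by simp
  also have "eqf p (Suc q) \<dots> (1 + ?t)" unfolding q using p by (rule frobenius)
  finally have \<mu>h: "eqf p (Suc q) (?\<mu> h) (1 + ?t)" .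
  have filt1: "(?\<mu> (pair_product b) - 1) ^ q \<in> filt p q" if "b \<in> insert a A" for b
    using magnus_Nil[OF pF[OF that], of q] by (intro filt_power) simp
  then have "?u * ?t \<in> filt p (q + q)" by (intro filt_mult filt_sum) auto
  then have ut: "?u * ?t \<in> filt p (Suc q)" using q0 by (auto intro: filt_mono)
  have "eqf p (Suc q) (?\<mu> (v \<otimes> h)) (?\<mu> v * ?\<mu> h)" using vF h(2) by (rule magnus_mult)
  also have "eqf p (Suc q) \<dots> ((1 + ?u) * (1 + ?t))" using v(2) \<mu>h by (rule eqf_mult)
  also have "eqf p (Suc q) \<dots> (1 + (?t + ?u))" using ut by (simp add: eqf_def algebra_simps)
  finally show ?case
    using v(1) h(1) subgroup.m_closed[OF N] insert.hyps by (intro bexI[of _ "v \<otimes> h"]) auto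
qed

lemma test_element_near:
  assumes w: "w \<in> frattini F T" and N: "N \<lhd> F" "openin T N"
  shows "\<exists>v\<in>N. test_element F T (w \<otimes> v)"
proof (rule ccontr)
  assume neg: "\<not> ?thesis"
  have wF: "w \<in> carrier F" and lin_w: "\<And>i. i \<in> {1..n} \<Longrightarrow> int p dvd lin i w" using w by (auto simp: mem_frattini_iff)
  interpret N: normal N F by (rule N(1))
  obtain k where k: "card (rcosets N) = p ^ k" using open_normal_index[OF N] by blast
  \<comment> \<open>\<open>p ^ k\<close> is the index of \<open>N\<close>, so \<open>q\<close>-th
    powers lie in \<open>N\<close>. The two further factors \<open>p\<close> ensure
    \<open>q \<ge> 4\<close>, which leaves inner words of length at least 2.\<close>
  define q where "q = p ^ (k + 2)"
  have q4: "4 \<le> q"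
  proof -
    have "2 * 2 \<le> p * p" using prime_ge_2_nat[OF p] by (intro mult_le_mono)
    moreover have "1 \<le> p ^ k" using prime_gt_0_nat[OF p] by simp
    ultimately have "1 * (2 * 2) \<le> p ^ k * (p * p)" by (rule mult_le_mono[rotated])
    then show ?thesis by (simp add: q_def power_add power2_eq_square ac_simps)
  qed
  have q0: "0 < q" using q4 by simp
  have pow: "h [^] q \<in> N" if h: "h \<in> carrier F" for h
  proof -
    interpret Q: group "F Mod N" by (rule N.factorgroup_is_group)
    interpret \<pi>: group_hom F "F Mod N" "\<lambda>a. N #> a" by unfold_locales (rule N.r_coset_hom_Mod)
    have "Coset.order (F Mod N) = p ^ k" using k by (simp add: Coset.order_def FactGroup_def)
    then have "(N #> h) [^]\<^bsub>F Mod N\<^esub> (p ^ k) = N"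
      using Q.pow_order_eq_1[OF \<pi>.hom_closed[OF h]] by (simp only: one_FactGroup)
    then have "N #> (h [^] (p ^ k)) = N" by (simp only: \<pi>.hom_nat_pow[OF h])
    then have "h [^] (p ^ k) \<in> N" using h N.is_subgroup by (rule_tac coset_join1) auto
    then have "(h [^] (p ^ k)) [^] m \<in> N" for m :: nat
      by (induction m) (use N.is_subgroup in \<open>auto simp: subgroup.one_closed subgroup.m_closed\<close>)
    from this[of "p ^ 2"] have "h [^] (p ^ k * p ^ 2) \<in> N" using h by (simp only: nat_pow_pow)
    then show ?thesis by (simp only: q_def power_add)
  qed
  let ?\<mu> = "magnus_map q"
  define A where "A = {(i, j). 1 \<le> i \<and> i \<le> j \<and> j \<le> n}"
  have A: "A \<subseteq> {1..n} \<times> {1..n}" by (auto simp: A_def)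
  then have finA: "finite A" by (rule finite_subset) simp
  define u where "u = (\<Sum>a\<in>A. (?\<mu> (pair_product a) - 1) ^ q)"
  obtain v where v: "v \<in> N" "eqf p (Suc q) (?\<mu> v) (1 + u)"
    using exists_pair_power_product[OF q_def N.is_subgroup pow finA A] unfolding u_def by blast
  have vF: "v \<in> carrier F" using v(1) N.subset by blast
  define a where "a = ?\<mu> w - 1"
  define b where "b = ?\<mu> (w \<otimes> v) - 1"
  have t1: "?\<mu> (pair_product c) - 1 \<in> filt p 1" if c: "c \<in> A" for c
  proof -
    obtain i j where "c = (i, j)" "i \<in> {1..n}" "j \<in> {1..n}" using c A by auto
    then show ?thesis using magnus_Nil[OF pair_product_closed, of i j q] by simp
  qed
  have u: "u \<in> filt p q" unfolding u_def by (intro filt_sum filt_power t1)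
  \<comment> \<open>Membership in \<Phi>(F) kills the linear coefficients modulo \<open>p\<close> at
    the letters \<open>1..n\<close>; at other letters they vanish by the support of the
    series.\<close>
  have a: "a \<in> filt p 2"
  proof (rule filtI)
    fix W :: "nat list" assume "length W < 2"
    then consider "W = []" | l where "W = [l]" by (cases W) auto
    then show "int p dvd cf a W"
    proof cases
      case 1
      then show ?thesis using magnus_Nil[OF wF, of q] by (simp add: a_def)
    next
      case (2 l)
      show ?thesis
      proof (cases "l \<in> {1..n}")
        case True
        then have "int p dvd cf (?\<mu> w) [l]" using dvd_iff_dvd[OF magnus_coeff_eq_lin[OF q0 wF True]] lin_w by simp
        then show ?thesis using 2 by (simp add: a_def)
      next
        case False
        have "?\<mu> w \<in> supp n" using magnus_hom.hom_closed[OF wF, of q] by simp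
        then show ?thesis using False 2 by (auto simp: a_def supp_def)
      qed
    qed
  qed
  have b: "eqf p (Suc q) b (a + u)"
  proof -
    have "eqf p (Suc q) (?\<mu> (w \<otimes> v)) (?\<mu> w * ?\<mu> v)" using wF vF by (rule magnus_mult)
    also have "eqf p (Suc q) \<dots> ((1 + a) * (1 + u))" using v(2) by (intro eqf_mult) (auto simp: a_def)
    finally have "eqf p (Suc q) b ((1 + a) * (1 + u) - 1)" unfolding b_def by (intro eqf_diff eqf_refl)
    also have "eqf p (Suc q) \<dots> (a + u)"
    proof -
      have "a \<in> filt p 1" using a by (rule filt_mono) simp
      then have "a * u \<in> filt p (Suc q)" using u by (intro filt_mult_Suc)
      then show ?thesis by (simp add: eqf_def algebra_simps)
    qed
    finally show ?thesis .
  qed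
  \<comment> \<open>The negated claim also covers \<open>w\<close> itself, as
    \<open>w \<otimes> \<one>\<close>.\<close>
  have nontest: "\<exists>f\<in>continuous_hom F T F T. f h = h \<and> \<not> topological_automorphism F T f"
    if "h = w \<or> h = w \<otimes> v" for h
  proof -
    have "h \<in> carrier F" using that wF vF by auto
    moreover have "\<not> test_element F T h"
    proof -
      have "\<not> test_element F T (w \<otimes> \<one>)" using neg subgroup.one_closed[OF N.is_subgroup] by blast
      then show ?thesis using that neg v(1) wF by auto
    qed
    ultimately show ?thesis by (auto simp: test_element_def)
  qed
  have "\<exists>c. (\<Sum>i=1..n. c i * Dl i a) \<in> filt p q \<and> (\<exists>i\<in>{1..n}. \<not> int p dvd cf (c i) [])"
  proof -
    obtain f where "f \<in> continuous_hom F T F T" "f w = w" "\<not> topological_automorphism F T f"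
      using nontest by blast
    with level_idempotent[OF _ _ wF _ q0, of f] obtain z j l where
      "\<forall>j\<in>{1..n}. cf (z j) [] = 0 \<and> eqf p (Suc q) (trunc_subst n z q (z j)) (z j)"
      "eqf p (Suc q) (trunc_subst n z q a) a" "j \<in> {1..n}" "l \<in> {1..n}"
      "\<not> int p dvd cf (z j) [l] - of_bool (j = l)" unfolding a_def by blast
    then show ?thesis using left_relation[OF q0, of n z p a j l] by blast
  qed
  then obtain c' i where c': "(\<Sum>i=1..n. c' i * Dl i a) \<in> filt p q" "i \<in> {1..n}" "\<not> int p dvd cf (c' i) []" by blast
  have "\<exists>c. (\<Sum>i=1..n. Dr i b * c i) \<in> filt p q \<and> (\<exists>i\<in>{1..n}. \<not> int p dvd cf (c i) [])"
  proof -
    obtain f where "f \<in> continuous_hom F T F T" "f (w \<otimes> v) = w \<otimes> v" "\<not> topological_automorphism F T f"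
      using nontest by blast
    with level_idempotent[OF _ _ m_closed[OF wF vF] _ q0, of f] obtain z j l where
      "\<forall>j\<in>{1..n}. cf (z j) [] = 0 \<and> eqf p (Suc q) (trunc_subst n z q (z j)) (z j)"
      "eqf p (Suc q) (trunc_subst n z q b) b" "j \<in> {1..n}" "l \<in> {1..n}"
      "\<not> int p dvd cf (z j) [l] - of_bool (j = l)" unfolding b_def by blast
    then show ?thesis using right_relation[OF q0, of n z p b j l] by blast
  qed
  then obtain c j where c: "(\<Sum>j=1..n. Dr j b * c j) \<in> filt p q" "j \<in> {1..n}" "\<not> int p dvd cf (c j) []" by blast
  obtain r where r: "q = Suc (Suc r)" using q4 by (cases q; cases "q - 1") auto
  show False
  proof (rule pair_powers_separate[where r = r and u = "cf u" and \<xi> = "\<lambda>i. cf (c' i) []"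
        and \<epsilon> = "\<lambda>j. cf (c j) []", OF p _ _ _ c'(2,3) c(2,3)])
    show "2 \<le> r" using q4 r by simp
    show "int p dvd cf u W - (\<Sum>(i, j)\<in>{(i, j). 1 \<le> i \<and> i \<le> j \<and> j \<le> n}. of_bool (set W \<subseteq> {i, j}))"
      if W: "length W = Suc (Suc r)" for W
    proof -
      have "int p dvd cf ((?\<mu> (pair_product d) - 1) ^ q) W - (case d of (i, j) \<Rightarrow> of_bool (set W \<subseteq> {i, j}))"
        if d: "d \<in> A" for d
      proof -
        obtain i j where ij: "d = (i, j)" "i \<in> {1..n}" "j \<in> {1..n}" using d A by auto
        have 1: "int p dvd cf ((?\<mu> (pair_product d) - 1) ^ q) W - (\<Prod>l\<leftarrow>W. cf (?\<mu> (pair_product d) - 1) [l])"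
          using leading_power[OF t1[OF d], of W] W r by simp
        have 2: "int p dvd (\<Prod>l\<leftarrow>W. cf (?\<mu> (pair_product d) - 1) [l]) - of_bool (set W \<subseteq> {i, j})"
          using pair_product_coeff[OF q0 ij(2,3)] unfolding ij(1) by (rule prod_list_indicator)
        show ?thesis using dvd_add[OF 1 2] ij(1) by simp
      qed
      then show ?thesis
        unfolding u_def A_def[symmetric] cf_sum sum_subtractf[symmetric] by (intro dvd_sum)
    qed
    show "int p dvd (\<Sum>k=1..n. \<Sum>l=1..n. cf (c' k) [] * cf u (k # W @ [l]) * cf (c l) [])"
      if "length W = r" for W
      using two_sided_relation[OF r a b u c(1) c'(1) that] .
  qed
qed

end

theorem theorem5p18:
  fixes F :: "('a, 'b) monoid_scheme" and T :: "'a topology"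
    and p n :: nat and x :: "nat \<Rightarrow> 'a"
  assumes "prime p"
    and "free_pro_p_group F T p n x"
    and "\<not> comm_group F"
  shows "dense_subset_of T {g. test_element F T g} (frattini F T)"
proof -
  interpret prime_free_pro_p_group F T p n x
    using assms(1,2) by (simp add: prime_free_pro_p_group_def prime_free_pro_p_group_axioms_def)
  have sub: "{g. test_element F T g} \<subseteq> frattini F T" using test_element_frattini[OF assms(3)] by blast
  have FT: "frattini F T \<subseteq> topspace T" by (simp add: frattini_def topspace_eq)
  have "w \<in> subtopology T (frattini F T) closure_of {g. test_element F T g}" if w: "w \<in> frattini F T" for w
    unfolding in_closure_of
  proof (intro conjI allI impI)
    show "w \<in> topspace (subtopology T (frattini F T))" using w FT by auto
    fix U assume "w \<in> U \<and> openin (subtopology T (frattini F T)) U"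
    then obtain V where V: "openin T V" "U = V \<inter> frattini F T" "w \<in> V" by (auto simp: openin_subtopology)
    have wF: "w \<in> carrier F" using w by (simp add: frattini_def)
    \<comment> \<open>Translation by \<open>w\<close> turns \<open>V\<close> into a neighbourhood of
      the identity, which contains an open normal subgroup \<open>N\<close>; the coset of
      \<open>w\<close> then stays inside \<open>V\<close>.\<close>
    have "continuous_map T T (\<lambda>b. w \<otimes>\<^bsub>F\<^esub> b)"
      using wF by (intro continuous_mult_maps) (auto simp: topspace_eq)
    from openin_continuous_map_preimage[OF this V(1)]
    have "openin T {b \<in> carrier F. w \<otimes>\<^bsub>F\<^esub> b \<in> V}" by (simp add: topspace_eq)
    moreover have "\<one>\<^bsub>F\<^esub> \<in> {b \<in> carrier F. w \<otimes>\<^bsub>F\<^esub> b \<in> V}" using wF V(3) by simp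
    ultimately obtain H where H: "subgroup H F" "openin T H" "H \<subseteq> {b \<in> carrier F. w \<otimes>\<^bsub>F\<^esub> b \<in> V}"
      using open_subgroup_base by blast
    obtain N where N: "N \<lhd> F" "openin T N" "N \<subseteq> H" using open_subgroup_contains_normal[OF H(1,2)] by blast
    obtain v where v: "v \<in> N" "test_element F T (w \<otimes>\<^bsub>F\<^esub> v)" using test_element_near[OF w N(1,2)] by blast
    then have "w \<otimes>\<^bsub>F\<^esub> v \<in> U" using sub N(3) H(3) V(2) by blast
    then show "\<exists>y. y \<in> {g. test_element F T g} \<and> y \<in> U" using v(2) by blast
  qed
  moreover have "subtopology T (frattini F T) closure_of {g. test_element F T g} \<subseteq> frattini F T"
    using closure_of_subset_topspace[of "subtopology T (frattini F T)"] by auto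
  ultimately show ?thesis using sub unfolding dense_subset_of_def by blast
qed

end
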